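(* Let $\Gamma$ be finitely generated and virtually $(\mathcal H,F)$-indicable with strong graph height function $(h_F,\mathcal H)$, and let $\phi\in\Phi$ and $\ell\in\Lambda_\varepsilon(C,\phi)$ for some $\varepsilon\in[1,2)$ and $C>0$. (a) $\mu_{\phi,\ell}=\beta_{\phi,\ell}$, and furthermore, for all sufficiently large $c$, $$\mu_{\phi,\ell}=\lim_{m\to\infty}w_\phi(\sigma_{m,c})^{1/m}.$$ (b) (Monotonicity) If $\nu\in\Phi$ and $\nu\le\phi$, then $\ell\in\Lambda_\varepsilon(C,\nu)$ and $\mu_{\nu,\ell}\le\mu_{\phi,\ell}$.
   Context: $\Gamma$ is virtually $(\mathcal H,F)$-indicable if $\mathcal H\trianglelefteq\Gamma$ has finite index and $F:\mathcal H\to\mathbb Z$ is a surjective homomorphism. $\Phi$: set of $\phi:\Gamma\to[0,\infty)$ with $\phi(\mathrm{id})=0$, $\phi(\gamma^{-1})=\phi(\gamma)$, $\sum_\gamma\phi(\gamma)<\infty$, and $\mathrm{supp}(\phi)=\{\gamma:\phi(\gamma)>0\}$ generating $\Gamma$. $K_\phi$: graph on $\Gamma$ with edges $\langle u,v\rangle$, $u^{-1}v\in\mathrm{supp}(\phi)$. A strong graph height function on $K_\phi$ is a pair $(h,\mathcal H)$ with $\mathcal H\trianglelefteq\Gamma$ of finite index acting by left multiplication, $h:\Gamma\to\mathbb Z$, $h(\mathrm{id})=0$, $h(\alpha v)-h(\alpha u)=h(v)-h(u)$ for $\alpha\in\mathcal H$, and every vertex has $K_\phi$-neighbours of strictly smaller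 and strictly larger height; the paper fixes such a function $(h_F,\mathcal H)$ constructed from $F$. $\Lambda$: set of $\ell:\Gamma\to(0,\infty)$ with $\ell(\gamma^{-1})=\ell(\gamma)$ and $\inf_\gamma\ell(\gamma)>0$. $\Lambda_\varepsilon(C,\phi)$: set of $\ell\in\Lambda$ with $|h_F(u)-h_F(v)|\le C[\ell(u^{-1}v)]^\varepsilon$ for all $u,v\in\Gamma$ with $\phi(u^{-1}v)>0$. A self-avoiding walk (SAW) on the complete graph on $\Gamma$ is a sequence $\pi=(\pi_0,\dots,\pi_n)$ of distinct elements, with weight $w_\phi(\pi)=\prod_{i=1}^n\phi(\pi_{i-1}^{-1}\pi_i)$ and $\ell$-length $\ell(\pi)=\sum_{i=1}^n\ell(\pi_{i-1}^{-1}\pi_i)$; $w_\phi(\Pi)=\sum_{\pi\in\Pi}w_\phi(\pi)$. A bridge is a SAW with $h_F(\pi_0)<h_F(\pi_i)\le h_F(\pi_n)$, $1\le i\le n$. $\sigma_{m,c}$: SAWs from $\mathrm{id}$ with $m\le\ell(\pi)<m+c$; $\beta_{m,c}(v)$: bridges from $v$ with $m\le\ell(\pi)<m+c$. For $c$ sufficiently large, the connective constant $\mu_{\phi,\ell}=\limsup_m w_\phi(\sigma_{m,c})^{1/m}$ and bridge constant $\beta_{\phi,\ell}=\lim_m w_\phi(\beta_{m,c}(v))^{1/m}$ exist and do not depend on $c$ or $v$. *)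

theory Defs
  imports
    "HOL-Algebra.Elementary_Groups"
    "HOL-Analysis.Infinite_Sum"
    "HOL-Library.Extended_Real"
    "HOL-Library.Liminf_Limsup"
begin

definition finitely_generated_group :: "('a, 'b) monoid_scheme \<Rightarrow> bool" where
  "finitely_generated_group G \<longleftrightarrow>
     group G \<and> (\<exists>S. finite S \<and> S \<subseteq> carrier G \<and> generate G S = carrier G)"

definition virtually_indicable ::
  "('a, 'b) monoid_scheme \<Rightarrow> 'a set \<Rightarrow> ('a \<Rightarrow> int) \<Rightarrow> bool" where
  "virtually_indicable G H F \<longleftrightarrow>
     H \<lhd> G \<and> finite (rcosets\<^bsub>G\<^esub> H) \<and> F \<in> epi (G\<lparr>carrier := H\<rparr>) integer_group"

text \<open>Functions on the group are total HOL functions on the ambient type; only their values on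
  \<^term>\<open>carrier G\<close> are constrained or used.\<close>

definition weight_support :: "('a, 'b) monoid_scheme \<Rightarrow> ('a \<Rightarrow> real) \<Rightarrow> 'a set" where
  "weight_support G \<phi> = {\<gamma> \<in> carrier G. \<phi> \<gamma> > 0}"

definition weight_functions :: "('a, 'b) monoid_scheme \<Rightarrow> ('a \<Rightarrow> real) set" where
  "weight_functions G = {\<phi>.
     (\<forall>\<gamma>\<in>carrier G. 0 \<le> \<phi> \<gamma>) \<and>
     \<phi> \<one>\<^bsub>G\<^esub> = 0 \<and>
     (\<forall>\<gamma>\<in>carrier G. \<phi> (inv\<^bsub>G\<^esub> \<gamma>) = \<phi> \<gamma>) \<and>
     \<phi> summable_on carrier G \<and>
     generate G (weight_support G \<phi>) = carrier G}"

text \<open>Adjacency in the graph \<open>K\<^sub>\<phi>\<close>.\<close>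

definition weight_adj :: "('a, 'b) monoid_scheme \<Rightarrow> ('a \<Rightarrow> real) \<Rightarrow> 'a \<Rightarrow> 'a \<Rightarrow> bool" where
  "weight_adj G \<phi> u v \<longleftrightarrow>
     u \<in> carrier G \<and> v \<in> carrier G \<and> inv\<^bsub>G\<^esub> u \<otimes>\<^bsub>G\<^esub> v \<in> weight_support G \<phi>"

definition strong_graph_height_function ::
  "('a, 'b) monoid_scheme \<Rightarrow> ('a \<Rightarrow> real) \<Rightarrow> ('a \<Rightarrow> int) \<Rightarrow> 'a set \<Rightarrow> bool" where
  "strong_graph_height_function G \<phi> h H \<longleftrightarrow>
     H \<lhd> G \<and> finite (rcosets\<^bsub>G\<^esub> H) \<and>
     h \<one>\<^bsub>G\<^esub> = 0 \<and>
     (\<forall>\<alpha>\<in>H. \<forall>u\<in>carrier G. \<forall>v\<in>carrier G.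
        h (\<alpha> \<otimes>\<^bsub>G\<^esub> v) - h (\<alpha> \<otimes>\<^bsub>G\<^esub> u) = h v - h u) \<and>
     (\<forall>v\<in>carrier G. (\<exists>u. weight_adj G \<phi> v u \<and> h u < h v) \<and>
                      (\<exists>w. weight_adj G \<phi> v w \<and> h v < h w))"

definition length_functions :: "('a, 'b) monoid_scheme \<Rightarrow> ('a \<Rightarrow> real) set" where
  "length_functions G = {\<l>.
     (\<forall>\<gamma>\<in>carrier G. 0 < \<l> \<gamma>) \<and>
     (\<forall>\<gamma>\<in>carrier G. \<l> (inv\<^bsub>G\<^esub> \<gamma>) = \<l> \<gamma>) \<and>
     0 < (INF \<gamma>\<in>carrier G. \<l> \<gamma>)}"

text \<open>The set \<open>\<Lambda>\<^sub>\<epsilon>(C, \<phi>)\<close>, relative to a height function \<open>h\<close>.\<close>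

definition holder_length_functions ::
  "('a, 'b) monoid_scheme \<Rightarrow> ('a \<Rightarrow> int) \<Rightarrow> real \<Rightarrow> real \<Rightarrow> ('a \<Rightarrow> real) \<Rightarrow> ('a \<Rightarrow> real) set" where
  "holder_length_functions G h \<epsilon> C \<phi> = {\<l> \<in> length_functions G.
     \<forall>u\<in>carrier G. \<forall>v\<in>carrier G. \<phi> (inv\<^bsub>G\<^esub> u \<otimes>\<^bsub>G\<^esub> v) > 0 \<longrightarrow>
       real_of_int \<bar>h u - h v\<bar> \<le> C * \<l> (inv\<^bsub>G\<^esub> u \<otimes>\<^bsub>G\<^esub> v) powr \<epsilon>}"

text \<open>A walk \<open>(\<pi>\<^sub>0, \<dots>, \<pi>\<^sub>n)\<close> is the nonempty list of its \<open>n + 1\<close> vertices, so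
  \<open>n = length \<pi> - 1\<close>.\<close>

definition saw :: "('a, 'b) monoid_scheme \<Rightarrow> 'a list \<Rightarrow> bool" where
  "saw G \<pi> \<longleftrightarrow> \<pi> \<noteq> [] \<and> set \<pi> \<subseteq> carrier G \<and> distinct \<pi>"

definition walk_weight :: "('a, 'b) monoid_scheme \<Rightarrow> ('a \<Rightarrow> real) \<Rightarrow> 'a list \<Rightarrow> real" where
  "walk_weight G \<phi> \<pi> = (\<Prod>i=1..length \<pi> - 1. \<phi> (inv\<^bsub>G\<^esub> (\<pi> ! (i - 1)) \<otimes>\<^bsub>G\<^esub> \<pi> ! i))"

definition walk_length :: "('a, 'b) monoid_scheme \<Rightarrow> ('a \<Rightarrow> real) \<Rightarrow> 'a list \<Rightarrow> real" where
  "walk_length G \<l> \<pi> = (\<Sum>i=1..length \<pi> - 1. \<l> (inv\<^bsub>G\<^esub> (\<pi> ! (i - 1)) \<otimes>\<^bsub>G\<^esub> \<pi> ! i))"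

text \<open>For the two families of walks below the sum converges, so the value 0 that \<^const>\<open>infsum\<close>
  assigns to divergent sums plays no role: since \<open>\<l>\<close> is bounded away from 0, the number of
  steps is at most some \<open>N\<close>, and the total weight is at most \<open>\<Sum>n\<le>N. (\<Sum>\<gamma>. \<phi> \<gamma>)^n\<close>.\<close>

definition total_weight :: "('a, 'b) monoid_scheme \<Rightarrow> ('a \<Rightarrow> real) \<Rightarrow> 'a list set \<Rightarrow> real" where
  "total_weight G \<phi> P = (\<Sum>\<^sub>\<infinity>\<pi>\<in>P. walk_weight G \<phi> \<pi>)"

definition bridge :: "('a, 'b) monoid_scheme \<Rightarrow> ('a \<Rightarrow> int) \<Rightarrow> 'a list \<Rightarrow> bool" where
  "bridge G h \<pi> \<longleftrightarrow> saw G \<pi> \<and>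
     (\<forall>i\<in>{1..length \<pi> - 1}. h (\<pi> ! 0) < h (\<pi> ! i) \<and> h (\<pi> ! i) \<le> h (\<pi> ! (length \<pi> - 1)))"

definition saws :: "('a, 'b) monoid_scheme \<Rightarrow> ('a \<Rightarrow> real) \<Rightarrow> nat \<Rightarrow> real \<Rightarrow> 'a list set" where
  "saws G \<l> m c = {\<pi>. saw G \<pi> \<and> \<pi> ! 0 = \<one>\<^bsub>G\<^esub> \<and>
     real m \<le> walk_length G \<l> \<pi> \<and> walk_length G \<l> \<pi> < real m + c}"

definition bridges ::
  "('a, 'b) monoid_scheme \<Rightarrow> ('a \<Rightarrow> int) \<Rightarrow> ('a \<Rightarrow> real) \<Rightarrow> nat \<Rightarrow> real \<Rightarrow> 'a \<Rightarrow> 'a list set" where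
  "bridges G h \<l> m c v = {\<pi>. bridge G h \<pi> \<and> \<pi> ! 0 = v \<and>
     real m \<le> walk_length G \<l> \<pi> \<and> walk_length G \<l> \<pi> < real m + c}"

text \<open>The constants \<open>\<mu>\<close> and \<open>\<beta>\<close> are the common values, for all sufficiently large \<open>c\<close> (and all
  starting points \<open>v\<close>), of the limits below. The description operator carries no existence
  assumption: anything proved about these constants needs that the common value exists.\<close>

definition connective_constant ::
  "('a, 'b) monoid_scheme \<Rightarrow> ('a \<Rightarrow> real) \<Rightarrow> ('a \<Rightarrow> real) \<Rightarrow> real" where
  "connective_constant G \<phi> \<l> = (THE \<mu>. \<forall>\<^sub>F c in at_top.
     limsup (\<lambda>m. ereal (root m (total_weight G \<phi> (saws G \<l> m c)))) = ereal \<mu>)"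

definition bridge_constant ::
  "('a, 'b) monoid_scheme \<Rightarrow> ('a \<Rightarrow> int) \<Rightarrow> ('a \<Rightarrow> real) \<Rightarrow> ('a \<Rightarrow> real) \<Rightarrow> real" where
  "bridge_constant G h \<phi> \<l> = (THE \<beta>. \<forall>\<^sub>F c in at_top. \<forall>v\<in>carrier G.
     (\<lambda>m. root m (total_weight G \<phi> (bridges G h \<l> m c v))) \<longlonglongrightarrow> \<beta>)"

end

theory Submission
  imports Defs "HOL-Analysis.Infinite_Set_Sum"
begin

text \<open>Tilting the weight to \<open>\<phi> \<gamma> * x powr \<l> \<gamma>\<close> turns \<open>walk_weight\<close> into the term of a generating function in
  which the length is recorded by the exponent of \<open>x\<close>; the growth rate of the window sums is the
  inverse of its radius of convergence, for every window width \<open>c \<ge> 1\<close>. A self-avoiding walk splits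
  at its last lowest vertex into two half-space walks, and a half-space walk splits into alternately
  ascending and descending bridges of strictly decreasing spans, so the generating function of half-space
  walks is at most \<open>\<Prod>j. 1 + q j\<close>, where \<open>q j\<close> is the generating function of the bridges of span \<open>j\<close>;
  the product is at most \<open>exp (\<Sum>j. q j)\<close>. Translation by \<open>H\<close> and reversal replace descending bridges by
  ascending ones. Hence self-avoiding walks and bridges have the same radius of convergence, and the
  upper growth rates agree. The lower growth rate of bridges from any vertex is no smaller,
  because two bridges can be joined through a connecting bridge of bounded cost and the
  result prolonged by up-steps until its length reaches a prescribed window.\<close>

section \<open>Sums of nonnegative terms\<close>

text \<open>The height is invariant only under \<open>H\<close>, so bridge weights depend on the
  coset of the starting vertex. Comparisons between starting points therefore run through a finite
  set \<open>R\<close> of representatives, and constants become uniform by a sum or a maximum over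
  it. Since lengths are real numbers, windows replace the coefficients of the generating function;
  windows of width at least 1 at the integers cover the half-line, so a power bound on them sums to
  a geometric series. Working at a tilt where the bridge series converges removes any count of
  partitions of the span: the expanded product ranges over sets of distinct spans, and only its
  finiteness is needed. A bridge is strict at its start but not at its end, so reversal leaves the
  class, and extra down-steps repair this at constant cost. The decomposition yields only one vertex
  whose bridge weights are large for infinitely many lengths; joining is what reaches every vertex
  and every length. Sums live in \<open>ennreal\<close>, where rearrangement needs no convergence;
  finiteness is a conclusion, and only then are real sums recovered.\<close>

definition nsum :: "('b \<Rightarrow> ennreal) \<Rightarrow> 'b set \<Rightarrow> ennreal" where
  "nsum f A = (\<integral>\<^sup>+x. f x \<partial>count_space A)"

lemma nsum_mono: "(\<And>x. x \<in> A \<Longrightarrow> f x \<le> g x) \<Longrightarrow> nsum f A \<le> nsum g A"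
  unfolding nsum_def by (intro nn_integral_mono) simp

lemma nsum_cong: "(\<And>x. x \<in> A \<Longrightarrow> f x = g x) \<Longrightarrow> nsum f A = nsum g A"
  unfolding nsum_def by (intro nn_integral_cong) simp

lemma nsum_subset: "A \<subseteq> B \<Longrightarrow> nsum f A \<le> nsum f B"
  unfolding nsum_def
  by (auto simp: nn_integral_count_space_indicator intro!: nn_integral_mono split: split_indicator)

lemma nsum_Un: "nsum f (A \<union> B) \<le> nsum f A + nsum f B"
proof -
  have "nsum f (A \<union> B) \<le> (\<integral>\<^sup>+x. f x * indicator A x + f x * indicator B x \<partial>count_space UNIV)"
    unfolding nsum_def
    by (auto simp: nn_integral_count_space_indicator intro!: nn_integral_mono split: split_indicator)
  also have "\<dots> = nsum f A + nsum f B"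
    unfolding nsum_def by (simp add: nn_integral_add nn_integral_count_space_indicator)
  finally show ?thesis .
qed

lemma nsum_cmult: "nsum (\<lambda>x. c * f x) A = c * nsum f A"
  unfolding nsum_def by (simp add: nn_integral_cmult)

lemma nsum_finite: "finite A \<Longrightarrow> nsum f A = sum f A"
  unfolding nsum_def by (rule nn_integral_count_space_finite)

lemma nsum_reindex: "inj_on g A \<Longrightarrow> nsum f (g ` A) = nsum (\<lambda>x. f (g x)) A"
  unfolding nsum_def
  by (rule nn_integral_bij_count_space[symmetric]) (simp add: inj_on_imp_bij_betw)

lemma nsum_Sigma: "nsum (\<lambda>(i, j). f i j) (Sigma I J) = nsum (\<lambda>i. nsum (f i) (J i)) I"
proof -
  have "nsum (\<lambda>(i, j). f i j) (Sigma I J) =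
      (\<integral>\<^sup>+p. (\<lambda>(i, j). f i j) p * indicator (Sigma I J) p \<partial>count_space UNIV)"
    unfolding nsum_def
    by (auto simp: nn_integral_count_space_indicator intro!: nn_integral_cong split: split_indicator)
  also have "\<dots> = (\<integral>\<^sup>+i. \<integral>\<^sup>+j. f i j * indicator (Sigma I J) (i, j) \<partial>count_space UNIV \<partial>count_space UNIV)"
    by (subst nn_integral_fst_count_space[symmetric]) simp
  also have "\<dots> = (\<integral>\<^sup>+i. (\<integral>\<^sup>+j. f i j * indicator (J i) j \<partial>count_space UNIV) * indicator I i \<partial>count_space UNIV)"
    by (auto intro!: nn_integral_cong simp: nn_integral_multc[symmetric] split: split_indicator)
  also have "\<dots> = nsum (\<lambda>i. nsum (f i) (J i)) I"
    unfolding nsum_def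
    by (auto simp: nn_integral_count_space_indicator intro!: nn_integral_cong split: split_indicator)
  finally show ?thesis .
qed

lemma nsum_le_inj:
  assumes "inj_on a X" "\<And>x. x \<in> X \<Longrightarrow> a x \<in> Y" "\<And>x. x \<in> X \<Longrightarrow> f x \<le> g (a x)"
  shows "nsum f X \<le> nsum g Y"
proof -
  have "nsum f X \<le> nsum (\<lambda>x. g (a x)) X" by (rule nsum_mono) (rule assms)
  also have "\<dots> = nsum g (a ` X)" by (rule nsum_reindex[OF assms(1), symmetric])
  also have "\<dots> \<le> nsum g Y" by (rule nsum_subset) (use assms in auto)
  finally show ?thesis .
qed

text \<open>The form in which decompositions of walks enter: \<open>a\<close> picks one piece,
  \<open>b\<close> a piece whose range depends on the first, and both together must determine the
  walk. Surjectivity is not asked for, as only upper bounds are wanted.\<close>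

lemma nsum_le_Sigma:
  assumes "inj_on (\<lambda>x. (a x, b x)) X"
    "\<And>x. x \<in> X \<Longrightarrow> a x \<in> I" "\<And>x. x \<in> X \<Longrightarrow> b x \<in> J (a x)"
    "\<And>x. x \<in> X \<Longrightarrow> f x \<le> g (a x) (b x)"
  shows "nsum f X \<le> nsum (\<lambda>i. nsum (g i) (J i)) I"
  unfolding nsum_Sigma[symmetric] by (rule nsum_le_inj[OF assms(1)]) (use assms in auto)

text \<open>The marker \<open>i\<close> makes the map \<open>a\<close> injective, so the fibre of
  \<open>a\<close> over \<open>y\<close> embeds into \<open>I y\<close> and has at most
  \<open>K\<close> elements. Later \<open>a\<close> prolongs or joins walks and \<open>i\<close>
  tells where the original one ended.\<close>

lemma nsum_le_fibers:
  fixes i :: "'b \<Rightarrow> nat"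
  assumes inj: "inj_on (\<lambda>x. (a x, i x)) X"
    and a: "\<And>x. x \<in> X \<Longrightarrow> a x \<in> Y"
    and i: "\<And>x. x \<in> X \<Longrightarrow> i x \<in> I (a x)"
    and I: "\<And>y. y \<in> Y \<Longrightarrow> finite (I y) \<and> card (I y) \<le> K"
    and le: "\<And>x. x \<in> X \<Longrightarrow> f x \<le> c * g (a x)"
  shows "nsum f X \<le> of_nat K * c * nsum g Y"
proof -
  have "nsum f X \<le> nsum (\<lambda>y. nsum (\<lambda>_. c * g y) (I y)) Y"
    by (rule nsum_le_Sigma[OF inj a i]) (use le in auto)
  also have "\<dots> \<le> nsum (\<lambda>y. of_nat K * c * g y) Y"
  proof (rule nsum_mono)
    fix y assume y: "y \<in> Y"
    have "nsum (\<lambda>_. c * g y) (I y) = of_nat (card (I y)) * (c * g y)"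
      using I[OF y] by (simp add: nsum_finite)
    also have "\<dots> \<le> of_nat K * (c * g y)"
      using I[OF y] by (intro mult_right_mono) auto
    finally show "nsum (\<lambda>_. c * g y) (I y) \<le> of_nat K * c * g y"
      by (simp add: mult.assoc)
  qed
  also have "\<dots> = of_nat K * c * nsum g Y" by (rule nsum_cmult)
  finally show ?thesis .
qed

lemma nsum_product: "nsum (\<lambda>(x, y). f x * g y) (X \<times> Y) = nsum f X * nsum g Y"
proof -
  have "nsum (\<lambda>(x, y). f x * g y) (X \<times> Y) = nsum (\<lambda>x. nsum (\<lambda>y. f x * g y) Y) X"
    by (rule nsum_Sigma)
  also have "\<dots> = nsum (\<lambda>x. nsum g Y * f x) X"
    by (rule nsum_cong) (simp add: nsum_cmult mult.commute)
  also have "\<dots> = nsum f X * nsum g Y"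
    by (subst nsum_cmult) (rule mult.commute)
  finally show ?thesis .
qed

text \<open>Monotone convergence. It removes a truncation: a bound for half-space walks of height at
  most \<open>T\<close>, uniform in \<open>T\<close>, passes to all half-space walks.\<close>

lemma nsum_incseq:
  assumes "\<And>n::nat. nsum f (A n) \<le> B" "incseq A" "X \<subseteq> (\<Union>n. A n)"
  shows "nsum f X \<le> B"
proof -
  have "nsum f X \<le> nsum f (\<Union>n. A n)" by (rule nsum_subset) fact
  also have "\<dots> = (\<integral>\<^sup>+x. f x * indicator (\<Union>n. A n) x \<partial>count_space UNIV)"
    unfolding nsum_def
    by (auto simp: nn_integral_count_space_indicator intro!: nn_integral_cong split: split_indicator)
  also have "\<dots> \<le> (\<integral>\<^sup>+x. (SUP n. f x * indicator (A n) x) \<partial>count_space UNIV)"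
    by (intro nn_integral_mono) (auto intro: SUP_upper2 split: split_indicator)
  also have "\<dots> = (SUP n. \<integral>\<^sup>+x. f x * indicator (A n) x \<partial>count_space UNIV)"
    using \<open>incseq A\<close>
    by (intro nn_integral_monotone_convergence_SUP)
       (auto simp: incseq_def le_fun_def intro!: mult_left_mono split: split_indicator)
  also have "\<dots> \<le> B"
    using assms(1) unfolding nsum_def by (auto simp: nn_integral_count_space_indicator intro!: SUP_least)
  finally show ?thesis .
qed

lemma nsum_abs_summable:
  assumes "Infinite_Set_Sum.abs_summable_on f A" "\<And>x. x \<in> A \<Longrightarrow> 0 \<le> f x"
  shows "nsum (\<lambda>x. ennreal (f x)) A = ennreal (infsum f A)"
  using nn_integral_conv_infsetsum[OF assms] infsetsum_infsum[OF assms(1)] by (simp add: nsum_def)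

lemma nsum_summable:
  fixes f :: "'b \<Rightarrow> real"
  assumes "f summable_on A" "\<And>x. x \<in> A \<Longrightarrow> 0 \<le> f x"
  shows "nsum (\<lambda>x. ennreal (f x)) A = ennreal (infsum f A)"
  using assms abs_summable_equivalent[THEN iffD1, OF summable_on_iff_abs_summable_on_real[THEN iffD1]]
  by (intro nsum_abs_summable) auto

text \<open>Finiteness in \<open>ennreal\<close> gives absolute summability, so the default value
  that \<open>infsum\<close> takes on divergent families is excluded.\<close>

lemma nsum_infsum:
  assumes "\<And>x. x \<in> A \<Longrightarrow> 0 \<le> f x" "nsum (\<lambda>x. ennreal (f x)) A \<noteq> \<infinity>"
  shows "ennreal (infsum f A) = nsum (\<lambda>x. ennreal (f x)) A"
proof -
  have "(\<integral>\<^sup>+x. ennreal (norm (f x)) \<partial>count_space A) = nsum (\<lambda>x. ennreal (f x)) A"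
    unfolding nsum_def using assms(1) by (intro nn_integral_cong) auto
  then have "integrable (count_space A) f"
    using assms(2) by (intro integrableI_bounded) (simp_all add: less_top)
  then have "Infinite_Set_Sum.abs_summable_on f A" by (simp add: Infinite_Set_Sum.abs_summable_on_def)
  then show ?thesis using nsum_abs_summable assms(1) by metis
qed

section \<open>Walks in a group\<close>

context group
begin

text \<open>The increments of a walk. Weight and length depend on the walk only through this list,
  which reduces translation, reversal and concatenation to list identities.\<close>

fun steps :: "'a list \<Rightarrow> 'a list" where
  "steps [] = []"
| "steps [u] = []"
| "steps (u # v # \<pi>) = (inv u \<otimes> v) # steps (v # \<pi>)"

lemma length_steps [simp]: "length (steps \<pi>) = length \<pi> - 1"
  by (induction \<pi> rule: steps.induct) auto

lemma nth_steps: "Suc i < length \<pi> \<Longrightarrow> steps \<pi> ! i = inv (\<pi> ! i) \<otimes> \<pi> ! Suc i"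
  by (induction \<pi> arbitrary: i rule: steps.induct) (auto simp: less_Suc_eq_0_disj)

lemma walk_weight_steps: "walk_weight G \<psi> \<pi> = prod_list (map \<psi> (steps \<pi>))"
  unfolding walk_weight_def prod.list_conv_set_nth
  by (rule prod.reindex_bij_witness[where i = Suc and j = "\<lambda>i. i - 1"])
     (auto simp: nth_steps)

lemma walk_length_steps: "walk_length G \<l> \<pi> = sum_list (map \<l> (steps \<pi>))"
  unfolding walk_length_def sum_list_sum_nth
  by (rule sum.reindex_bij_witness[where i = Suc and j = "\<lambda>i. i - 1"])
     (auto simp: nth_steps)

lemma steps_append: "steps (\<pi> @ u # \<rho>) = steps (\<pi> @ [u]) @ steps (u # \<rho>)"
  by (induction \<pi> rule: steps.induct) auto

lemma steps_carrier: "set \<pi> \<subseteq> carrier G \<Longrightarrow> set (steps \<pi>) \<subseteq> carrier G"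
  by (induction \<pi> rule: steps.induct) auto

lemma steps_rev:
  "set \<pi> \<subseteq> carrier G \<Longrightarrow> steps (rev \<pi>) = rev (map (\<lambda>x. inv x) (steps \<pi>))"
proof (induction \<pi> rule: steps.induct)
  case (3 u v \<pi>)
  have "steps (rev (u # v # \<pi>)) = steps (rev (v # \<pi>)) @ steps [v, u]"
    using steps_append[of "rev \<pi>" v "[u]"] by simp
  then show ?case using 3 by (simp add: inv_mult_group)
qed auto

lemma steps_translate:
  assumes "\<alpha> \<in> carrier G"
  shows "set \<pi> \<subseteq> carrier G \<Longrightarrow> steps (map ((\<otimes>) \<alpha>) \<pi>) = steps \<pi>"
proof (induction \<pi> rule: steps.induct)
  case (3 u v \<pi>)
  have "inv (\<alpha> \<otimes> u) \<otimes> (\<alpha> \<otimes> v) = inv u \<otimes> v"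
    using assms 3 by (simp add: inv_mult_group m_assoc) (simp add: m_assoc[symmetric])
  then show ?case using 3 by simp
qed auto

lemma walk_weight_singleton [simp]: "walk_weight G \<psi> [u] = 1"
  by (simp add: walk_weight_steps)

lemma walk_length_singleton [simp]: "walk_length G \<l> [u] = 0"
  by (simp add: walk_length_steps)

lemma walk_weight_append:
  "walk_weight G \<psi> (\<pi> @ u # \<rho>) = walk_weight G \<psi> (\<pi> @ [u]) * walk_weight G \<psi> (u # \<rho>)"
  unfolding walk_weight_steps by (subst steps_append) simp

lemma walk_length_append:
  "walk_length G \<l> (\<pi> @ u # \<rho>) = walk_length G \<l> (\<pi> @ [u]) + walk_length G \<l> (u # \<rho>)"
  unfolding walk_length_steps by (subst steps_append) simp

lemma walk_weight_Cons:
  "walk_weight G \<psi> (u # v # \<rho>) = \<psi> (inv u \<otimes> v) * walk_weight G \<psi> (v # \<rho>)"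
  by (simp add: walk_weight_steps)

lemma walk_length_Cons:
  "walk_length G \<l> (u # v # \<rho>) = \<l> (inv u \<otimes> v) + walk_length G \<l> (v # \<rho>)"
  by (simp add: walk_length_steps)

lemma walk_weight_translate:
  "\<alpha> \<in> carrier G \<Longrightarrow> set \<pi> \<subseteq> carrier G \<Longrightarrow>
    walk_weight G \<psi> (map ((\<otimes>) \<alpha>) \<pi>) = walk_weight G \<psi> \<pi>"
  by (simp add: walk_weight_steps steps_translate)

lemma walk_length_translate:
  "\<alpha> \<in> carrier G \<Longrightarrow> set \<pi> \<subseteq> carrier G \<Longrightarrow>
    walk_length G \<l> (map ((\<otimes>) \<alpha>) \<pi>) = walk_length G \<l> \<pi>"
  by (simp add: walk_length_steps steps_translate)

lemma walk_weight_rev: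
  assumes "\<And>\<gamma>. \<gamma> \<in> carrier G \<Longrightarrow> \<psi> (inv \<gamma>) = \<psi> \<gamma>" "set \<pi> \<subseteq> carrier G"
  shows "walk_weight G \<psi> (rev \<pi>) = walk_weight G \<psi> \<pi>"
proof -
  have "map \<psi> (steps (rev \<pi>)) = rev (map \<psi> (steps \<pi>))"
    using assms steps_carrier[OF assms(2)] by (auto simp: steps_rev rev_map)
  then show ?thesis by (simp add: walk_weight_steps prod_list.rev)
qed

lemma walk_weight_nonneg:
  assumes "\<And>\<gamma>. \<gamma> \<in> carrier G \<Longrightarrow> 0 \<le> \<psi> \<gamma>" "set \<pi> \<subseteq> carrier G"
  shows "0 \<le> walk_weight G \<psi> \<pi>"
  using assms(1) steps_carrier[OF assms(2)]
  unfolding walk_weight_steps by (intro prod_list_nonneg) auto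

lemma walk_weight_mono:
  assumes "\<And>\<gamma>. \<gamma> \<in> carrier G \<Longrightarrow> 0 \<le> \<nu> \<gamma> \<and> \<nu> \<gamma> \<le> \<psi> \<gamma>" "set \<pi> \<subseteq> carrier G"
  shows "walk_weight G \<nu> \<pi> \<le> walk_weight G \<psi> \<pi>"
proof -
  have "0 \<le> prod_list (map \<nu> xs) \<and> prod_list (map \<nu> xs) \<le> prod_list (map \<psi> xs)"
    if "set xs \<subseteq> carrier G" for xs
    using that
  proof (induction xs)
    case (Cons x xs)
    then have "0 \<le> \<nu> x" "\<nu> x \<le> \<psi> x" using assms(1) by auto
    then show ?case using Cons by (auto intro!: mult_mono)
  qed simp
  then show ?thesis using steps_carrier[OF assms(2)] by (simp add: walk_weight_steps)
qed

lemma walk_weight_tilt: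
  assumes "0 < x"
  shows "walk_weight G (\<lambda>\<gamma>. \<phi> \<gamma> * x powr \<l> \<gamma>) \<pi> =
    walk_weight G \<phi> \<pi> * x powr walk_length G \<l> \<pi>"
proof -
  have "prod_list (map (\<lambda>\<gamma>. \<phi> \<gamma> * x powr \<l> \<gamma>) xs) = prod_list (map \<phi> xs) * x powr sum_list (map \<l> xs)"
    for xs using assms by (induction xs) (auto simp: powr_add)
  then show ?thesis by (simp add: walk_weight_steps walk_length_steps)
qed

lemma walk_length_ge:
  assumes "\<And>\<gamma>. \<gamma> \<in> carrier G \<Longrightarrow> a \<le> \<l> \<gamma>" "set \<pi> \<subseteq> carrier G"
  shows "a * real (length \<pi> - 1) \<le> walk_length G \<l> \<pi>"
proof -
  have "a * real (length xs) \<le> sum_list (map \<l> xs)" if "set xs \<subseteq> carrier G" for xs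
    using that assms(1) by (induction xs) (auto simp: algebra_simps add_mono)
  from this[OF steps_carrier[OF assms(2)]] show ?thesis by (simp add: walk_length_steps)
qed

text \<open>With \<open>hd\<close>, \<open>tl\<close> and \<open>last\<close> in place of indices
  the condition can be followed through \<open>map\<close>, \<open>rev\<close> and append. A
  one-vertex walk in the group is a bridge, its tail being empty.\<close>

lemma bridge_iff:
  "bridge G h \<pi> \<longleftrightarrow> saw G \<pi> \<and> (\<forall>y\<in>set (tl \<pi>). h (hd \<pi>) < h y \<and> h y \<le> h (last \<pi>))"
proof (cases \<pi>)
  case (Cons u \<rho>)
  have "(!) (u # \<rho>) ` Suc ` {0..<length \<rho>} = set \<rho>"
    by (auto simp: set_conv_nth image_image simp del: image_Suc_atLeastLessThan)
  then have "(!) (u # \<rho>) ` {1..length \<rho>} = set \<rho>"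
    by (simp only: image_Suc_atLeastLessThan atLeastLessThanSuc_atLeastAtMost One_nat_def)
  then have "(\<forall>i\<in>{1..length \<rho>}. P ((u # \<rho>) ! i)) \<longleftrightarrow> (\<forall>y\<in>set \<rho>. P y)" for P
    by (metis (no_types, lifting) ball_imageD image_eqI imageE)
  from this[of "\<lambda>y. h u < h y \<and> h y \<le> h (last \<pi>)"] Cons show ?thesis
    by (auto simp: bridge_def last_conv_nth)
qed (simp add: bridge_def saw_def)

end

lemma (in group) inv_mult_cancel_left [simp]:
  "a \<in> carrier G \<Longrightarrow> b \<in> carrier G \<Longrightarrow> inv a \<otimes> (a \<otimes> b) = b"
  "a \<in> carrier G \<Longrightarrow> b \<in> carrier G \<Longrightarrow> a \<otimes> (inv a \<otimes> b) = b"
  by (simp_all add: m_assoc[symmetric])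

lemma (in group) map_inv_mult_cancel:
  assumes "\<alpha> \<in> carrier G" "set \<pi> \<subseteq> carrier G"
  shows "map ((\<otimes>) \<alpha>) (map ((\<otimes>) (inv \<alpha>)) \<pi>) = \<pi>"
    "map ((\<otimes>) (inv \<alpha>)) (map ((\<otimes>) \<alpha>) \<pi>) = \<pi>"
  using assms by (auto intro!: map_idI)

lemma (in group) saw_translate:
  "\<alpha> \<in> carrier G \<Longrightarrow> saw G \<pi> \<Longrightarrow> saw G (map ((\<otimes>) \<alpha>) \<pi>)"
  by (auto simp: saw_def distinct_map inj_on_def subset_eq)

section \<open>Finitely many coset representatives and translation by the subgroup\<close>

locale coset_transversal = group G for G :: "('a, 'b) monoid_scheme" (structure) +
  fixes H R :: "'a set"
  assumes H_subgroup: "subgroup H G"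
    and R_finite: "finite R"
    and R_carrier: "R \<subseteq> carrier G"
    and R_cover: "\<And>v. v \<in> carrier G \<Longrightarrow> \<exists>\<alpha>\<in>H. \<exists>r\<in>R. v = \<alpha> \<otimes> r"
begin

lemma H_carrier: "\<alpha> \<in> H \<Longrightarrow> \<alpha> \<in> carrier G"
  using subgroup.subset[OF H_subgroup] by blast

lemma H_inv: "\<alpha> \<in> H \<Longrightarrow> inv \<alpha> \<in> H"
  using subgroup.m_inv_closed[OF H_subgroup] .

text \<open>\<open>R\<close> is only required to meet every coset, possibly more than once, so a
  representative is chosen; \<open>shift\<close> is an element of \<open>H\<close> carrying that
  representative to \<open>v\<close>.\<close>

definition rep :: "'a \<Rightarrow> 'a" where
  "rep v = (SOME r. r \<in> R \<and> (\<exists>\<alpha>\<in>H. v = \<alpha> \<otimes> r))"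

definition shift :: "'a \<Rightarrow> 'a" where
  "shift v = (SOME \<alpha>. \<alpha> \<in> H \<and> v = \<alpha> \<otimes> rep v)"

lemma rep_shift:
  assumes "v \<in> carrier G"
  shows "rep v \<in> R" "shift v \<in> H" "v = shift v \<otimes> rep v"
proof -
  have "\<exists>r. r \<in> R \<and> (\<exists>\<alpha>\<in>H. v = \<alpha> \<otimes> r)" using R_cover[OF assms] by blast
  then have *: "rep v \<in> R \<and> (\<exists>\<alpha>\<in>H. v = \<alpha> \<otimes> rep v)" unfolding rep_def by (rule someI_ex)
  then have "\<exists>\<alpha>. \<alpha> \<in> H \<and> v = \<alpha> \<otimes> rep v" by blast
  then have "shift v \<in> H \<and> v = shift v \<otimes> rep v" unfolding shift_def by (rule someI_ex)
  with * show "rep v \<in> R" "shift v \<in> H" "v = shift v \<otimes> rep v" by blast+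
qed

lemma inv_shift:
  assumes "v \<in> carrier G"
  shows "inv (shift v) \<otimes> v = rep v"
proof -
  have "inv (shift v) \<otimes> (shift v \<otimes> rep v) = rep v"
    using rep_shift(1,2)[OF assms] R_carrier H_carrier by (intro inv_mult_cancel_left) auto
  then show ?thesis using rep_shift(3)[OF assms] by simp
qed

text \<open>Isolates what is needed to move endpoints to representatives. It is applied to bridges
  of fixed span, to reversed bridges for \<open>- h\<close>, and to walks that start at a lowest
  vertex.\<close>

definition invariant_walks :: "'a list set \<Rightarrow> bool" where
  "invariant_walks P \<longleftrightarrow>
     (\<forall>\<pi>\<in>P. \<pi> \<noteq> [] \<and> set \<pi> \<subseteq> carrier G) \<and> (\<forall>\<alpha>\<in>H. \<forall>\<pi>\<in>P. map ((\<otimes>) \<alpha>) \<pi> \<in> P)"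

text \<open>Each walk is translated so that its start becomes a representative, which preserves its
  weight. The translation is not lost: the end was the known vertex \<open>v\<close>, and its new
  position reveals the shift.\<close>

lemma nsum_walks_to:
  assumes P: "invariant_walks P" and v: "v \<in> carrier G"
  shows "nsum (\<lambda>\<pi>. ennreal (walk_weight G \<psi> \<pi>)) {\<pi>\<in>P. last \<pi> = v} \<le>
    (\<Sum>r\<in>R. nsum (\<lambda>\<pi>. ennreal (walk_weight G \<psi> \<pi>)) {\<pi>\<in>P. hd \<pi> = r})"
proof (subst nsum_finite[OF R_finite, symmetric], rule nsum_le_Sigma[where a = "\<lambda>\<pi>. rep (hd \<pi>)"
      and b = "\<lambda>\<pi>. map ((\<otimes>) (inv (shift (hd \<pi>)))) \<pi>"])
  have W: "\<pi> \<noteq> [] \<and> set \<pi> \<subseteq> carrier G \<and> hd \<pi> \<in> carrier G \<and> shift (hd \<pi>) \<in> H \<and> shift (hd \<pi>) \<in> carrier G"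
    if "\<pi> \<in> P" for \<pi>
  proof -
    have "\<pi> \<noteq> []" "set \<pi> \<subseteq> carrier G" using P that by (auto simp: invariant_walks_def)
    moreover from this have "hd \<pi> \<in> carrier G" using hd_in_set by blast
    ultimately show ?thesis using rep_shift(2) H_carrier by simp
  qed
  show "inj_on (\<lambda>\<pi>. (rep (hd \<pi>), map ((\<otimes>) (inv (shift (hd \<pi>)))) \<pi>)) {\<pi> \<in> P. last \<pi> = v}"
  proof (rule inj_onI)
    fix \<pi> \<rho>
    assume "\<pi> \<in> {\<pi> \<in> P. last \<pi> = v}" "\<rho> \<in> {\<pi> \<in> P. last \<pi> = v}"
      and "(rep (hd \<pi>), map ((\<otimes>) (inv (shift (hd \<pi>)))) \<pi>) =
        (rep (hd \<rho>), map ((\<otimes>) (inv (shift (hd \<rho>)))) \<rho>)"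
    then have *: "\<pi> \<in> P" "\<rho> \<in> P" "last \<pi> = v" "last \<rho> = v"
      and eq: "map ((\<otimes>) (inv (shift (hd \<pi>)))) \<pi> = map ((\<otimes>) (inv (shift (hd \<rho>)))) \<rho>"
      by simp_all
    note W1 = W[OF *(1)] and W2 = W[OF *(2)]
    have "last (map ((\<otimes>) (inv (shift (hd \<pi>)))) \<pi>) = inv (shift (hd \<pi>)) \<otimes> v"
      "last (map ((\<otimes>) (inv (shift (hd \<rho>)))) \<rho>) = inv (shift (hd \<rho>)) \<otimes> v"
      using W1 W2 * by (simp_all add: last_map)
    with eq have "inv (shift (hd \<pi>)) \<otimes> v = inv (shift (hd \<rho>)) \<otimes> v" by simp
    then have "shift (hd \<pi>) = shift (hd \<rho>)"
      using W1 W2 v by (metis inv_closed inv_inv right_cancel)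
    then show "\<pi> = \<rho>"
      using eq map_inv_mult_cancel(1)[of "shift (hd \<pi>)"] W1 W2 by metis
  qed
  fix \<pi> assume "\<pi> \<in> {\<pi> \<in> P. last \<pi> = v}"
  then have \<pi>: "\<pi> \<in> P" by simp
  note W1 = W[OF \<pi>]
  show "rep (hd \<pi>) \<in> R" using W1 rep_shift by blast
  show "map ((\<otimes>) (inv (shift (hd \<pi>)))) \<pi> \<in> {\<pi>' \<in> P. hd \<pi>' = rep (hd \<pi>)}"
    using W1 P \<pi> H_inv inv_shift by (simp add: invariant_walks_def hd_map)
  show "ennreal (walk_weight G \<psi> \<pi>) \<le> ennreal (walk_weight G \<psi> (map ((\<otimes>) (inv (shift (hd \<pi>)))) \<pi>))"
    using W1 by (simp add: walk_weight_translate)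
qed

lemma nsum_walks_from:
  assumes P: "invariant_walks P" and v: "v \<in> carrier G"
  shows "nsum (\<lambda>\<pi>. ennreal (walk_weight G \<psi> \<pi>)) {\<pi>\<in>P. hd \<pi> = v} \<le>
    nsum (\<lambda>\<pi>. ennreal (walk_weight G \<psi> \<pi>)) {\<pi>\<in>P. hd \<pi> = rep v}"
proof (rule nsum_le_inj[where a = "map ((\<otimes>) (inv (shift v)))"])
  have s: "shift v \<in> H" "shift v \<in> carrier G"
    using rep_shift(2)[OF v] H_carrier by auto
  show "inj_on (map ((\<otimes>) (inv (shift v)))) {\<pi>\<in>P. hd \<pi> = v}"
    using P map_inv_mult_cancel(1)[OF s(2)]
    by (intro inj_on_inverseI[where g = "map ((\<otimes>) (shift v))"]) (auto simp: invariant_walks_def)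
  fix \<pi> assume "\<pi> \<in> {\<pi>\<in>P. hd \<pi> = v}"
  then have \<pi>: "\<pi> \<in> P" "hd \<pi> = v" "\<pi> \<noteq> []" "set \<pi> \<subseteq> carrier G"
    using P by (auto simp: invariant_walks_def)
  show "map ((\<otimes>) (inv (shift v))) \<pi> \<in> {\<pi>'\<in>P. hd \<pi>' = rep v}"
    using \<pi> P s H_inv inv_shift[OF v] by (simp add: invariant_walks_def hd_map)
  show "ennreal (walk_weight G \<psi> \<pi>) \<le> ennreal (walk_weight G \<psi> (map ((\<otimes>) (inv (shift v))) \<pi>))"
    using \<pi> s by (simp add: walk_weight_translate)
qed

definition invariant_height :: "('a \<Rightarrow> int) \<Rightarrow> bool" where
  "invariant_height h \<longleftrightarrow>
     (\<forall>\<alpha>\<in>H. \<forall>u\<in>carrier G. \<forall>v\<in>carrier G. h (\<alpha> \<otimes> v) - h (\<alpha> \<otimes> u) = h v - h u)"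

lemma invariant_heightD:
  assumes "invariant_height h" "\<alpha> \<in> H" "u \<in> carrier G" "v \<in> carrier G"
  shows "h (\<alpha> \<otimes> v) = h (\<alpha> \<otimes> u) + h v - h u"
proof -
  have "h (\<alpha> \<otimes> v) - h (\<alpha> \<otimes> u) = h v - h u"
    using assms unfolding invariant_height_def by blast
  then show ?thesis by simp
qed

lemma invariant_height_uminus: "invariant_height h \<Longrightarrow> invariant_height (\<lambda>v. - h v)"
  unfolding invariant_height_def minus_diff_minus neg_equal_iff_equal .

lemma bridge_translate:
  assumes h: "invariant_height h" and \<alpha>: "\<alpha> \<in> H" and \<pi>: "bridge G h \<pi>"
  shows "bridge G h (map ((\<otimes>) \<alpha>) \<pi>)"
proof -
  have ne: "\<pi> \<noteq> []" "set \<pi> \<subseteq> carrier G" "saw G \<pi>"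
    using \<pi> by (auto simp: bridge_iff saw_def)
  have *: "h (\<alpha> \<otimes> y) = h (\<alpha> \<otimes> hd \<pi>) + h y - h (hd \<pi>)" if "y \<in> set \<pi>" for y
    using that ne hd_in_set[OF ne(1)] by (intro invariant_heightD[OF h \<alpha>]) auto
  have mem: "last \<pi> \<in> set \<pi>" "\<And>y. y \<in> set (tl \<pi>) \<Longrightarrow> y \<in> set \<pi>"
    using ne(1) list.set_sel(2) by auto
  have "h (\<alpha> \<otimes> hd \<pi>) < h (\<alpha> \<otimes> y) \<and> h (\<alpha> \<otimes> y) \<le> h (\<alpha> \<otimes> last \<pi>)"
    if "y \<in> set (tl \<pi>)" for y
    using \<pi> that *[OF mem(1)] *[OF mem(2)[OF that]] unfolding bridge_iff by auto
  then show ?thesis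
    using ne saw_translate[OF H_carrier[OF \<alpha>]]
    by (auto simp: bridge_iff map_tl[symmetric] hd_map last_map)
qed

end

section \<open>The Hammersley--Welsh decomposition\<close>

text \<open>Expanding the product sums over subsets of \<open>{1..T}\<close>; the left side sorts
  them by the largest element \<open>j\<close>, leaving a subset of \<open>{1..j - 1}\<close>.
  Cutting off the first and longest bridge produces exactly this recursion.\<close>

lemma prod_Suc_telescope:
  fixes q :: "nat \<Rightarrow> 'c :: comm_semiring_1"
  shows "1 + (\<Sum>j = 1..T. q j * (\<Prod>i = 1..j - 1. 1 + q i)) = (\<Prod>j = 1..T. 1 + q j)"
proof (induction T)
  case (Suc T)
  have "1 + (\<Sum>j = 1..Suc T. q j * (\<Prod>i = 1..j - 1. 1 + q i)) =
      (1 + (\<Sum>j = 1..T. q j * (\<Prod>i = 1..j - 1. 1 + q i))) + q (Suc T) * (\<Prod>i = 1..T. 1 + q i)"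
    by (simp add: ac_simps)
  also have "\<dots> = (\<Prod>j = 1..Suc T. 1 + q j)"
    unfolding Suc.IH by (simp add: algebra_simps)
  finally show ?case .
qed simp

text \<open>\<open>1 + r \<le> exp r\<close> in every factor. The bound depends on \<open>S\<close>
  and not on \<open>A\<close>, so it survives an unbounded range of spans. As
  \<open>enn2real\<close> sends infinity to 0, finiteness of \<open>S\<close> is essential.\<close>

lemma ennreal_prod_le_exp:
  fixes q :: "'b \<Rightarrow> ennreal"
  assumes A: "finite A" and le: "sum q A \<le> S" and S: "S < \<infinity>"
  shows "(\<Prod>j\<in>A. 1 + q j) \<le> ennreal (exp (enn2real S))"
proof -
  define r where "r j = enn2real (q j)" for j
  have "q j \<le> sum q A" if "j \<in> A" for j
    using A that by (intro member_le_sum) auto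
  then have "q j < \<infinity>" if "j \<in> A" for j
    using that le S by (meson le_less_trans order_trans)
  then have r: "q j = ennreal (r j)" "0 \<le> r j" if "j \<in> A" for j
    using that unfolding r_def by (auto simp: less_top)
  have "(\<Prod>j\<in>A. 1 + q j) = (\<Prod>j\<in>A. ennreal (1 + r j))"
    using r by (intro prod.cong) auto
  also have "\<dots> = ennreal (\<Prod>j\<in>A. 1 + r j)"
    using r by (intro prod_ennreal) auto
  also have "(\<Prod>j\<in>A. 1 + r j) \<le> (\<Prod>j\<in>A. exp (r j))"
    using r by (intro prod_mono) auto
  also have "\<dots> = exp (sum r A)" using A by (simp add: exp_sum)
  also have "sum r A \<le> enn2real S"
  proof -
    have "ennreal (sum r A) = (\<Sum>j\<in>A. ennreal (r j))"
      by (rule sum_ennreal[symmetric]) (use r in auto)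
    also have "\<dots> = sum q A" using r by (intro sum.cong) auto
    finally have "ennreal (sum r A) = sum q A" .
    then show ?thesis
      using le S r by (metis enn2real_ennreal enn2real_mono infinity_ennreal_def sum_nonneg)
  qed
  finally show ?thesis by (simp add: ennreal_leI)
qed

locale symmetric_weight = coset_transversal +
  fixes \<psi> :: "'a \<Rightarrow> real"
  assumes weight_nonneg: "\<gamma> \<in> carrier G \<Longrightarrow> 0 \<le> \<psi> \<gamma>"
    and weight_sym: "\<gamma> \<in> carrier G \<Longrightarrow> \<psi> (inv \<gamma>) = \<psi> \<gamma>"
begin

definition gw :: "'a list \<Rightarrow> ennreal" where
  "gw \<pi> = ennreal (walk_weight G \<psi> \<pi>)"

lemma gw_append:
  assumes "set (\<pi> @ u # \<rho>) \<subseteq> carrier G"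
  shows "gw (\<pi> @ u # \<rho>) = gw (\<pi> @ [u]) * gw (u # \<rho>)"
proof -
  have "0 \<le> walk_weight G \<psi> (\<pi> @ [u])" "0 \<le> walk_weight G \<psi> (u # \<rho>)"
    using assms by (auto intro!: walk_weight_nonneg weight_nonneg)
  then show ?thesis unfolding gw_def by (subst walk_weight_append) (rule ennreal_mult)
qed

lemma gw_Cons:
  assumes "set (u # v # \<rho>) \<subseteq> carrier G"
  shows "gw (u # v # \<rho>) = ennreal (\<psi> (inv u \<otimes> v)) * gw (v # \<rho>)"
  using gw_append[of "[u]" v \<rho>] assms by (simp add: gw_def walk_weight_Cons)

lemma gw_singleton [simp]: "gw [u] = 1"
  by (simp add: gw_def)

lemma gw_rev: "set \<pi> \<subseteq> carrier G \<Longrightarrow> gw (rev \<pi>) = gw \<pi>"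
  unfolding gw_def by (subst walk_weight_rev) (use weight_sym in auto)

section \<open>Half-space walks and the recursion on their spans\<close>

definition half_space :: "('a \<Rightarrow> int) \<Rightarrow> 'a list \<Rightarrow> bool" where
  "half_space h \<pi> \<longleftrightarrow> saw G \<pi> \<and> (\<forall>y\<in>set (tl \<pi>). h (hd \<pi>) < h y)"

text \<open>The truncation \<open>T\<close> limits the height above the start. What remains after a
  cut has a smaller truncation, so \<open>T\<close> carries the induction.\<close>

definition half_space_sum :: "('a \<Rightarrow> int) \<Rightarrow> nat \<Rightarrow> 'a \<Rightarrow> ennreal" where
  "half_space_sum h T v =
     nsum gw {\<pi>. half_space h \<pi> \<and> hd \<pi> = v \<and> (\<forall>y\<in>set \<pi>. h y \<le> h v + int T)}"

definition bridge_sum :: "('a \<Rightarrow> int) \<Rightarrow> nat \<Rightarrow> 'a \<Rightarrow> ennreal" where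
  "bridge_sum h j v = nsum gw {\<pi>. bridge G h \<pi> \<and> hd \<pi> = v \<and> h (last \<pi>) = h v + int j}"

lemma saw_appendD:
  assumes "saw G (\<pi> @ x # \<rho>)"
  shows "saw G (\<pi> @ [x])" "saw G (x # \<rho>)"
  using assms by (auto simp: saw_def)

text \<open>Cutting at the last visit to the maximal height leaves a bridge followed by a walk that stays
  strictly below its starting point, with strictly smaller span.\<close>

lemma half_space_cut:
  assumes \<pi>: "half_space h \<pi>" and ne: "\<pi> \<noteq> [hd \<pi>]" and T: "\<forall>y\<in>set \<pi>. h y \<le> h (hd \<pi>) + int T"
  obtains \<sigma> x \<rho> j where "\<pi> = \<sigma> @ x # \<rho>" "1 \<le> j" "j \<le> T" "bridge G h (\<sigma> @ [x])"
    "h x = h (hd \<pi>) + int j" "half_space (\<lambda>v. - h v) (x # \<rho>)"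
    "\<forall>y\<in>set (x # \<rho>). - h y \<le> - h x + int (j - 1)" "hd (\<sigma> @ [x]) = hd \<pi>"
proof -
  have saw: "saw G \<pi>" and up: "\<forall>y\<in>set (tl \<pi>). h (hd \<pi>) < h y"
    using \<pi> by (auto simp: half_space_def)
  then obtain v \<pi>' where v: "\<pi> = v # \<pi>'" by (cases \<pi>) (auto simp: saw_def)
  define M where "M = Max (h ` set \<pi>)"
  have M: "\<exists>x\<in>set \<pi>. h x = M" "\<And>y. y \<in> set \<pi> \<Longrightarrow> h y \<le> M"
    using Max_in[of "h ` set \<pi>"] Max_ge[of "h ` set \<pi>"] v unfolding M_def by fastforce+
  obtain \<sigma> x \<rho> where s: "\<pi> = \<sigma> @ x # \<rho>" "h x = M" "\<forall>y\<in>set \<rho>. h y \<noteq> M"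
    using split_list_last_prop[OF M(1)] by metis
  have lt: "h y < h x" if "y \<in> set \<rho>" for y
    using s M(2)[of y] that by fastforce
  have "\<pi>' \<noteq> []" using ne v by simp
  then have "h v < M" using up v M(2) by (cases \<pi>') fastforce+
  then have \<sigma>: "\<sigma> \<noteq> []" using s v by auto
  then have hd: "hd \<sigma> = v" "hd (\<sigma> @ [x]) = v" using s(1) v by (cases \<sigma>; simp)+
  define j where "j = nat (M - h v)"
  have j: "1 \<le> j" "M = h v + int j" using \<open>h v < M\<close> by (auto simp: j_def)
  have tl: "tl \<pi> = tl \<sigma> @ x # \<rho>" using s \<sigma> by simp
  show thesis
  proof (rule that[OF s(1) j(1)])
    show "j \<le> T" using T M(1) j(2) v by auto
    show "bridge G h (\<sigma> @ [x])"
    proof -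
      have "set (tl (\<sigma> @ [x])) \<subseteq> set (tl \<pi>)" using tl \<sigma> by auto
      moreover have "set (tl \<pi>) \<subseteq> set \<pi>" using v by auto
      ultimately show ?thesis
        unfolding bridge_iff using saw_appendD(1)[OF saw[unfolded s(1)]] s(2) up M(2) hd(2) v
        by (auto simp: subset_eq)
    qed
    show "h x = h (hd \<pi>) + int j" using s(2) j(2) v by simp
    show "half_space (\<lambda>v. - h v) (x # \<rho>)"
      using saw_appendD(2) saw s(1) lt by (auto simp: half_space_def)
    show "\<forall>y\<in>set (x # \<rho>). - h y \<le> - h x + int (j - 1)"
    proof
      fix y assume "y \<in> set (x # \<rho>)"
      \<comment> \<open>Strictness above the start \<open>v\<close> is the source of
        \<open>j - 1\<close>, and thus of strictly decreasing spans.\<close>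
      then have "h v < h y" using up tl v by auto
      then show "- h y \<le> - h x + int (j - 1)" using j s(2) by (simp add: of_nat_diff)
    qed
    show "hd (\<sigma> @ [x]) = hd \<pi>" using hd v by simp
  qed
qed

text \<open>The 1 is the one-vertex walk. Any other walk is a bridge of some span \<open>j\<close>
  followed by a half-space walk for \<open>- h\<close> of span at most \<open>j - 1\<close>. The
  bound \<open>M\<close> has to be uniform in the starting vertex, because the end of the bridge
  varies.\<close>

lemma half_space_sum_step:
  assumes v: "v \<in> carrier G"
    and q: "\<And>j. bridge_sum h j v \<le> q j"
    and M: "\<And>j u. j < T \<Longrightarrow> u \<in> carrier G \<Longrightarrow> half_space_sum (\<lambda>v. - h v) j u \<le> M j"
  shows "half_space_sum h T v \<le> 1 + (\<Sum>j = 1..T. q j * M (j - 1))"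
proof -
  define X where "X = {\<pi>. half_space h \<pi> \<and> hd \<pi> = v \<and> (\<forall>y\<in>set \<pi>. h y \<le> h v + int T)} - {[v]}"
  define C where "C j u = {\<pi>. half_space (\<lambda>v. - h v) \<pi> \<and> hd \<pi> = u \<and>
    (\<forall>y\<in>set \<pi>. - h y \<le> - h u + int (j - 1))}" for j u
  define B where "B j = {\<pi>. bridge G h \<pi> \<and> hd \<pi> = v \<and> h (last \<pi>) = h v + int j}" for j
  define D where "D j = {(\<beta>, \<rho>). \<beta> \<in> B j \<and> \<rho> \<in> C j (last \<beta>)}" for j
  \<comment> \<open>The cut vertex belongs to both pieces, so one copy is dropped when they are
    rejoined; weights count edges and therefore still multiply.\<close>
  have "\<exists>\<beta> \<rho> j. \<pi> = butlast \<beta> @ \<rho> \<and> j \<in> {1..T} \<and> (\<beta>, \<rho>) \<in> D j \<and> gw \<pi> = gw \<beta> * gw \<rho>"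
    if \<pi>: "\<pi> \<in> X" for \<pi>
  proof -
    have *: "half_space h \<pi>" "\<pi> \<noteq> [hd \<pi>]" "\<forall>y\<in>set \<pi>. h y \<le> h (hd \<pi>) + int T" "hd \<pi> = v"
      using \<pi> by (auto simp: X_def)
    obtain \<sigma> x \<rho> j where c: "\<pi> = \<sigma> @ x # \<rho>" "1 \<le> j" "j \<le> T" "bridge G h (\<sigma> @ [x])"
      "h x = h (hd \<pi>) + int j" "half_space (\<lambda>v. - h v) (x # \<rho>)"
      "\<forall>y\<in>set (x # \<rho>). - h y \<le> - h x + int (j - 1)" "hd (\<sigma> @ [x]) = hd \<pi>"
      by (rule half_space_cut[OF *(1-3)])
    have "set (\<sigma> @ x # \<rho>) \<subseteq> carrier G" using * c(1) by (auto simp: half_space_def saw_def)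
    then have "gw \<pi> = gw (\<sigma> @ [x]) * gw (x # \<rho>)" using gw_append c(1) by metis
    moreover have "\<sigma> @ [x] \<in> B j" using c(4,5,8) *(4) by (simp add: B_def)
    then have "(\<sigma> @ [x], x # \<rho>) \<in> D j" using c(6,7) unfolding D_def C_def by simp
    ultimately show ?thesis using c by (intro exI[of _ "\<sigma> @ [x]"] exI[of _ "x # \<rho>"] exI[of _ j]) auto
  qed
  then obtain \<beta> \<rho> j where f: "\<And>\<pi>. \<pi> \<in> X \<Longrightarrow> \<pi> = butlast (\<beta> \<pi>) @ \<rho> \<pi> \<and> j \<pi> \<in> {1..T} \<and>
      (\<beta> \<pi>, \<rho> \<pi>) \<in> D (j \<pi>) \<and> gw \<pi> = gw (\<beta> \<pi>) * gw (\<rho> \<pi>)"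
    by metis
  have "nsum gw X \<le> nsum (\<lambda>j. nsum (\<lambda>p. gw (fst p) * gw (snd p)) (D j)) {1..T}"
  proof (rule nsum_le_Sigma[where a = j and b = "\<lambda>\<pi>. (\<beta> \<pi>, \<rho> \<pi>)"])
    show "inj_on (\<lambda>\<pi>. (j \<pi>, \<beta> \<pi>, \<rho> \<pi>)) X"
      using f by (intro inj_on_inverseI[where g = "\<lambda>(j, \<beta>, \<rho>). butlast \<beta> @ \<rho>"]) auto
  qed (use f in auto)
  also have "\<dots> \<le> nsum (\<lambda>j. q j * M (j - 1)) {1..T}"
  proof (rule nsum_mono)
    fix j assume j: "j \<in> {1..T}"
    have "nsum (\<lambda>p. gw (fst p) * gw (snd p)) (D j) =
        nsum (\<lambda>(\<beta>, \<rho>). gw \<beta> * gw \<rho>) (Sigma (B j) (\<lambda>\<beta>. C j (last \<beta>)))"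
      by (simp add: D_def Sigma_def split_def) (rule arg_cong[where f = "nsum _"], auto)
    also have "\<dots> = nsum (\<lambda>\<beta>. gw \<beta> * nsum gw (C j (last \<beta>))) (B j)"
      by (simp add: nsum_Sigma nsum_cmult)
    also have "\<dots> \<le> nsum (\<lambda>\<beta>. M (j - 1) * gw \<beta>) (B j)"
    proof (rule nsum_mono)
      fix \<beta> assume "\<beta> \<in> B j"
      then have "last \<beta> \<in> carrier G" by (auto simp: B_def bridge_iff saw_def)
      then have "nsum gw (C j (last \<beta>)) \<le> M (j - 1)"
        using M[of "j - 1" "last \<beta>"] j by (auto simp: half_space_sum_def C_def)
      then show "gw \<beta> * nsum gw (C j (last \<beta>)) \<le> M (j - 1) * gw \<beta>"
        by (subst mult.commute) (intro mult_right_mono, auto)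
    qed
    also have "\<dots> = M (j - 1) * bridge_sum h j v"
      by (simp add: nsum_cmult bridge_sum_def B_def)
    also have "\<dots> \<le> q j * M (j - 1)"
      using q[of j] by (subst mult.commute) (intro mult_right_mono, auto)
    finally show "nsum (\<lambda>p. gw (fst p) * gw (snd p)) (D j) \<le> q j * M (j - 1)" .
  qed
  also have "\<dots> = (\<Sum>j = 1..T. q j * M (j - 1))" by (simp add: nsum_finite)
  finally have X: "nsum gw X \<le> (\<Sum>j = 1..T. q j * M (j - 1))" .
  have "half_space_sum h T v \<le> nsum gw ({[v]} \<union> X)"
    unfolding half_space_sum_def X_def by (rule nsum_subset) auto
  also have "\<dots> \<le> nsum gw {[v]} + nsum gw X" by (rule nsum_Un)
  also have "nsum gw {[v]} = 1" by (simp add: nsum_finite)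
  finally show ?thesis using X by (metis add_left_mono order_trans)
qed

text \<open>Cutting off a bridge reverses the direction, so \<open>h\<close> and \<open>- h\<close>
  are treated in one induction, each using the other at smaller truncations. Hence \<open>q\<close>
  has to dominate the bridges of both directions.\<close>

lemma half_space_sum_le_prod:
  assumes q: "\<And>j v. v \<in> carrier G \<Longrightarrow> bridge_sum h j v \<le> q j"
    and q': "\<And>j v. v \<in> carrier G \<Longrightarrow> bridge_sum (\<lambda>v. - h v) j v \<le> q j"
    and v: "v \<in> carrier G"
  shows "half_space_sum h T v \<le> (\<Prod>j = 1..T. 1 + q j)"
proof -
  have "half_space_sum h T v \<le> (\<Prod>j = 1..T. 1 + q j) \<and>
      half_space_sum (\<lambda>v. - h v) T v \<le> (\<Prod>j = 1..T. 1 + q j)"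
    if "v \<in> carrier G" for v
    using that
  proof (induction T arbitrary: v rule: less_induct)
    case (less T)
    have "half_space_sum h T v \<le> 1 + (\<Sum>j = 1..T. q j * (\<Prod>i = 1..j - 1. 1 + q i))"
      using less q by (intro half_space_sum_step) auto
    moreover have "half_space_sum (\<lambda>v. - h v) T v \<le> 1 + (\<Sum>j = 1..T. q j * (\<Prod>i = 1..j - 1. 1 + q i))"
      using less q' by (intro half_space_sum_step) auto
    ultimately show ?case by (simp only: prod_Suc_telescope)
  qed
  then show ?thesis using v by blast
qed

text \<open>The new edge has a fixed positive weight, so prepending it costs a constant. The gain is
  that a weak inequality at the start \<open>v\<close> becomes a strict one at
  \<open>y\<close>.\<close>

lemma nsum_prepend:
  assumes y: "y \<in> carrier G" and v: "v \<in> carrier G" and pos: "0 < \<psi> (inv y \<otimes> v)"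
    and P: "\<And>\<pi>. P \<pi> \<Longrightarrow> hd \<pi> = v \<Longrightarrow> \<pi> \<noteq> [] \<and> set \<pi> \<subseteq> carrier G \<and> Q (y # \<pi>)"
  shows "nsum gw {\<pi>. P \<pi> \<and> hd \<pi> = v} \<le>
    ennreal (1 / \<psi> (inv y \<otimes> v)) * nsum gw {\<pi>. Q \<pi> \<and> hd \<pi> = y}"
  unfolding nsum_cmult[symmetric]
proof (rule nsum_le_inj[where a = "(#) y"])
  fix \<pi> assume "\<pi> \<in> {\<pi>. P \<pi> \<and> hd \<pi> = v}"
  then have \<pi>: "P \<pi>" "hd \<pi> = v" by auto
  then obtain \<rho> where \<rho>: "\<pi> = v # \<rho>" using P[OF \<pi>] by (cases \<pi>) auto
  show "y # \<pi> \<in> {\<pi>. Q \<pi> \<and> hd \<pi> = y}" using P[OF \<pi>] by simp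
  have "gw (y # \<pi>) = ennreal (\<psi> (inv y \<otimes> v)) * gw \<pi>"
    using P[OF \<pi>] y unfolding \<rho> by (intro gw_Cons) auto
  then have "ennreal (1 / \<psi> (inv y \<otimes> v)) * gw (y # \<pi>) =
      (ennreal (1 / \<psi> (inv y \<otimes> v)) * ennreal (\<psi> (inv y \<otimes> v))) * gw \<pi>"
    by (simp only: mult.assoc)
  also have "\<dots> = gw \<pi>" using pos by (simp add: ennreal_mult[symmetric])
  finally show "gw \<pi> \<le> ennreal (1 / \<psi> (inv y \<otimes> v)) * gw (y # \<pi>)" by simp
qed simp

text \<open>Reversal preserves weight and turns the fixed start into a fixed end, to which
  \<open>nsum_walks_to\<close> applies.\<close>

lemma nsum_reversed:
  assumes "invariant_walks P" "v \<in> carrier G"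
  shows "nsum gw {\<pi>. rev \<pi> \<in> P \<and> hd \<pi> = v} \<le> (\<Sum>r\<in>R. nsum gw {\<pi>\<in>P. hd \<pi> = r})"
proof -
  have "nsum gw {\<pi>. rev \<pi> \<in> P \<and> hd \<pi> = v} \<le> nsum gw {\<pi>\<in>P. last \<pi> = v}"
  proof (rule nsum_le_inj[where a = rev])
    fix \<pi> assume "\<pi> \<in> {\<pi>. rev \<pi> \<in> P \<and> hd \<pi> = v}"
    then have \<pi>: "rev \<pi> \<in> P" "hd \<pi> = v" by auto
    then have "\<pi> \<noteq> []" "set \<pi> \<subseteq> carrier G"
      using assms(1) by (force simp: invariant_walks_def)+
    then show "rev \<pi> \<in> {\<pi> \<in> P. last \<pi> = v}" "gw \<pi> \<le> gw (rev \<pi>)"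
      using \<pi> by (auto simp: last_rev gw_rev)
  qed simp
  also have "\<dots> \<le> (\<Sum>r\<in>R. nsum gw {\<pi>\<in>P. hd \<pi> = r})"
    unfolding gw_def by (rule nsum_walks_to) fact+
  finally show ?thesis .
qed

lemma bridge_sum_le_rep:
  assumes h: "invariant_height h" and v: "v \<in> carrier G"
  shows "bridge_sum h j v \<le> bridge_sum h j (rep v)"
proof -
  define P where "P = {\<pi>. bridge G h \<pi> \<and> h (last \<pi>) = h (hd \<pi>) + int j}"
  have "invariant_walks P"
  proof -
    have "h (\<alpha> \<otimes> last \<pi>) = h (\<alpha> \<otimes> hd \<pi>) + int j"
      if "\<alpha> \<in> H" "bridge G h \<pi>" "h (last \<pi>) = h (hd \<pi>) + int j" for \<alpha> \<pi>
    proof -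
      have "hd \<pi> \<in> carrier G" "last \<pi> \<in> carrier G"
        using that(2) by (auto simp: bridge_iff saw_def)
      then show ?thesis using invariant_heightD[OF h that(1), of "hd \<pi>" "last \<pi>"] that(3) by simp
    qed
    moreover have "\<pi> \<noteq> [] \<and> set \<pi> \<subseteq> carrier G" if "bridge G h \<pi>" for \<pi>
      using that by (auto simp: bridge_iff saw_def)
    ultimately show ?thesis
      unfolding invariant_walks_def P_def using bridge_translate[OF h]
      by (auto simp: hd_map last_map)
  qed
  from nsum_walks_from[OF this v, of \<psi>] show ?thesis
    unfolding bridge_sum_def P_def gw_def by (simp add: conj_ac cong: conj_cong)
qed

text \<open>A bridge determines its span, so the families are disjoint. Convergence of the bridge
  series thus makes the sum over spans finite.\<close>

lemma sum_bridge_sum_le: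
  "(\<Sum>j = 1..T. bridge_sum h j v) \<le> nsum gw {\<pi>. bridge G h \<pi> \<and> hd \<pi> = v}"
proof -
  let ?X = "\<lambda>j. {\<pi>. bridge G h \<pi> \<and> hd \<pi> = v \<and> h (last \<pi>) = h v + int j}"
  have "(\<Sum>j = 1..T. bridge_sum h j v) = nsum (\<lambda>(j, \<pi>). gw \<pi>) (Sigma {1..T} ?X)"
    by (simp add: nsum_Sigma bridge_sum_def nsum_finite)
  also have "\<dots> \<le> nsum gw {\<pi>. bridge G h \<pi> \<and> hd \<pi> = v}"
    by (rule nsum_le_inj[where a = snd]) (auto simp: inj_on_def)
  finally show ?thesis .
qed

text \<open>A reversed bridge for \<open>- h\<close> may revisit its minimal height; a down-step prepended to it
  restores the strict inequality of a bridge for \<open>h\<close>.\<close>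

lemma downward_bridges_finite:
  assumes h: "invariant_height h"
    and fin: "\<And>v. v \<in> carrier G \<Longrightarrow> nsum gw {\<pi>. bridge G h \<pi> \<and> hd \<pi> = v} < \<infinity>"
    and down: "\<And>v. v \<in> carrier G \<Longrightarrow> \<exists>y\<in>carrier G. h y < h v \<and> 0 < \<psi> (inv y \<otimes> v)"
    and v: "v \<in> carrier G"
  shows "nsum gw {\<pi>. bridge G (\<lambda>v. - h v) \<pi> \<and> hd \<pi> = v} < \<infinity>"
proof -
  \<comment> \<open>Elements of \<open>P\<close> run upwards: a reversed bridge for
    \<open>- h\<close> starts at a lowest vertex, not necessarily the only one, and ends at its
    unique highest vertex.\<close>
  define P where "P = {\<pi>. bridge G (\<lambda>v. - h v) (rev \<pi>)}"
  have P: "invariant_walks P"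
    unfolding invariant_walks_def
  proof (intro conjI ballI)
    fix \<alpha> \<pi> assume "\<alpha> \<in> H" "\<pi> \<in> P"
    then have "bridge G (\<lambda>v. - h v) (map ((\<otimes>) \<alpha>) (rev \<pi>))"
      unfolding P_def by (intro bridge_translate invariant_height_uminus h) auto
    then show "map ((\<otimes>) \<alpha>) \<pi> \<in> P" by (simp add: P_def rev_map)
  qed (auto simp: P_def bridge_iff saw_def)
  have "nsum gw {\<pi>\<in>P. hd \<pi> = r} < \<infinity>" if "r \<in> R" for r
  proof -
    have r: "r \<in> carrier G" using that R_carrier by auto
    obtain y where y: "y \<in> carrier G" "h y < h r" "0 < \<psi> (inv y \<otimes> r)" using down[OF r] by blast
    have "nsum gw {\<pi>. \<pi> \<in> P \<and> hd \<pi> = r} \<le>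
        ennreal (1 / \<psi> (inv y \<otimes> r)) * nsum gw {\<pi>. bridge G h \<pi> \<and> hd \<pi> = y}"
    proof (rule nsum_prepend[OF y(1) r y(3)])
      fix \<pi> assume \<pi>: "\<pi> \<in> P" "hd \<pi> = r"
      then have ne: "\<pi> \<noteq> []" "set \<pi> \<subseteq> carrier G" "distinct \<pi>"
        by (auto simp: P_def bridge_iff saw_def)
      obtain u \<tau> where u: "rev \<pi> = u # \<tau>" using ne by (cases "rev \<pi>") auto
      then have \<pi>_eq: "set \<pi> = insert u (set \<tau>)" "last \<pi> = u" "last (u # \<tau>) = r"
        using \<pi>(2) ne(1) by (metis set_rev list.simps(15), metis hd_rev list.sel(1), metis last_rev)
      have \<tau>: "h z < h u \<and> h r \<le> h z" if "z \<in> set \<tau>" for z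
        using \<pi>(1) that \<pi>_eq(3) unfolding P_def bridge_iff by (auto simp: u)
      have "h r \<le> h u" using \<tau> \<pi>_eq(3) by (cases \<tau>) (auto simp: less_imp_le split: if_splits)
      then have *: "h r \<le> h z \<and> h z \<le> h (last \<pi>)" if "z \<in> set \<pi>" for z
        using \<tau> \<pi>_eq that by (auto simp: less_imp_le)
      have "y \<notin> set \<pi>" using * y(2) by fastforce
      then have "bridge G h (y # \<pi>)"
        using ne * y by (fastforce simp: bridge_iff saw_def)
      then show "\<pi> \<noteq> [] \<and> set \<pi> \<subseteq> carrier G \<and> bridge G h (y # \<pi>)" using ne by simp
    qed
    also have "\<dots> < \<infinity>" using fin[OF y(1)] by (simp add: ennreal_mult_less_top)
    finally show ?thesis by simp
  qed
  then have "(\<Sum>r\<in>R. nsum gw {\<pi>\<in>P. hd \<pi> = r}) < \<infinity>" using R_finite by simp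
  with nsum_reversed[OF P v] show ?thesis by (simp add: P_def le_less_trans)
qed

text \<open>The bound is uniform in \<open>v\<close> because \<open>q\<close> sums over all
  representatives and both directions, with total at most the finite number \<open>S\<close>.
  Uniformity matters later, where a half-space walk starts at the variable end of another
  walk.\<close>

lemma half_space_finite:
  assumes h: "invariant_height h"
    and fin: "\<And>v. v \<in> carrier G \<Longrightarrow> nsum gw {\<pi>. bridge G h \<pi> \<and> hd \<pi> = v} < \<infinity>"
    and down: "\<And>v. v \<in> carrier G \<Longrightarrow> \<exists>y\<in>carrier G. h y < h v \<and> 0 < \<psi> (inv y \<otimes> v)"
  shows "\<exists>E<\<infinity>. \<forall>v\<in>carrier G. nsum gw {\<pi>. half_space h \<pi> \<and> hd \<pi> = v} \<le> E"
proof -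
  define q where "q j = (\<Sum>r\<in>R. bridge_sum h j r + bridge_sum (\<lambda>v. - h v) j r)" for j
  define S where "S = (\<Sum>r\<in>R. nsum gw {\<pi>. bridge G h \<pi> \<and> hd \<pi> = r} +
    nsum gw {\<pi>. bridge G (\<lambda>v. - h v) \<pi> \<and> hd \<pi> = r})"
  have S: "S < \<infinity>"
    unfolding S_def using R_finite R_carrier fin downward_bridges_finite[OF h fin down] by auto
  have sum_q: "sum q {1..T} \<le> S" for T
  proof -
    have "sum q {1..T} = (\<Sum>r\<in>R. (\<Sum>j = 1..T. bridge_sum h j r) + (\<Sum>j = 1..T. bridge_sum (\<lambda>v. - h v) j r))"
      unfolding q_def by (subst sum.swap) (simp add: sum.distrib)
    also have "\<dots> \<le> S"
      unfolding S_def by (intro sum_mono add_mono sum_bridge_sum_le)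
    finally show ?thesis .
  qed
  have le_q: "bridge_sum g j v \<le> q j"
    if v: "v \<in> carrier G" and g: "g = h \<or> g = (\<lambda>v. - h v)" for g j v
  proof -
    have "bridge_sum g j v \<le> bridge_sum g j (rep v)"
      using v g h invariant_height_uminus[OF h] by (intro bridge_sum_le_rep) auto
    also have "\<dots> \<le> bridge_sum h j (rep v) + bridge_sum (\<lambda>v. - h v) j (rep v)"
      using g by (auto simp: le_iff_add ac_simps)
    also have "\<dots> \<le> q j"
      unfolding q_def using rep_shift(1)[OF v] R_finite by (intro member_le_sum) auto
    finally show ?thesis .
  qed
  let ?E = "ennreal (exp (enn2real S))"
  have "nsum gw {\<pi>. half_space h \<pi> \<and> hd \<pi> = v} \<le> ?E" if v: "v \<in> carrier G" for v
  proof (rule nsum_incseq[where A = "\<lambda>T. {\<pi>. half_space h \<pi> \<and> hd \<pi> = v \<and> (\<forall>y\<in>set \<pi>. h y \<le> h v + int T)}"])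
    fix T
    have "half_space_sum h T v \<le> (\<Prod>j = 1..T. 1 + q j)"
      using le_q v by (intro half_space_sum_le_prod) auto
    also have "\<dots> \<le> ?E" by (rule ennreal_prod_le_exp[OF _ sum_q S]) simp
    finally show "nsum gw {\<pi>. half_space h \<pi> \<and> hd \<pi> = v \<and> (\<forall>y\<in>set \<pi>. h y \<le> h v + int T)} \<le> ?E"
      by (simp add: half_space_sum_def)
  next
    show "incseq (\<lambda>T. {\<pi>. half_space h \<pi> \<and> hd \<pi> = v \<and> (\<forall>y\<in>set \<pi>. h y \<le> h v + int T)})"
      by (auto simp: incseq_def intro: order_trans)
    show "{\<pi>. half_space h \<pi> \<and> hd \<pi> = v} \<subseteq>
        (\<Union>T. {\<pi>. half_space h \<pi> \<and> hd \<pi> = v \<and> (\<forall>y\<in>set \<pi>. h y \<le> h v + int T)})"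
    proof
      fix \<pi> assume "\<pi> \<in> {\<pi>. half_space h \<pi> \<and> hd \<pi> = v}"
      moreover have "h y \<le> h v + int (nat (Max (h ` set \<pi>) - h v))" if "y \<in> set \<pi>" for y
      proof -
        have "h y \<le> Max (h ` set \<pi>)" using that by (intro Max_ge) auto
        then show ?thesis by linarith
      qed
      ultimately show "\<pi> \<in> (\<Union>T. {\<pi>. half_space h \<pi> \<and> hd \<pi> = v \<and> (\<forall>y\<in>set \<pi>. h y \<le> h v + int T)})"
        by blast
    qed
  qed
  then show ?thesis by (intro exI[of _ ?E]) simp
qed

text \<open>The piece after the last lowest vertex \<open>x\<close> rises strictly above
  \<open>x\<close>. The piece before it, read backwards, also starts at \<open>x\<close> but may
  return to that height, so it only lies in \<open>P\<close>; a down-step prepended to it gives a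
  half-space walk. Its far end is the fixed vertex \<open>v\<close>, hence the passage through
  \<open>nsum_reversed\<close>.\<close>

lemma saw_sum_finite:
  assumes h: "invariant_height h"
    and fin: "\<And>v. v \<in> carrier G \<Longrightarrow> nsum gw {\<pi>. bridge G h \<pi> \<and> hd \<pi> = v} < \<infinity>"
    and down: "\<And>v. v \<in> carrier G \<Longrightarrow> \<exists>y\<in>carrier G. h y < h v \<and> 0 < \<psi> (inv y \<otimes> v)"
    and v: "v \<in> carrier G"
  shows "nsum gw {\<pi>. saw G \<pi> \<and> hd \<pi> = v} < \<infinity>"
proof -
  obtain E where E: "E < \<infinity>"
    "\<And>v. v \<in> carrier G \<Longrightarrow> nsum gw {\<pi>. half_space h \<pi> \<and> hd \<pi> = v} \<le> E"
    using half_space_finite[OF h fin down] by auto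
  define P where "P = {\<pi>. saw G \<pi> \<and> (\<forall>y\<in>set \<pi>. h (hd \<pi>) \<le> h y)}"
  have P: "invariant_walks P"
  proof -
    have "h (\<alpha> \<otimes> hd \<pi>) \<le> h (\<alpha> \<otimes> y)" if "\<alpha> \<in> H" "\<pi> \<in> P" "y \<in> set \<pi>" for \<alpha> \<pi> y
    proof -
      have "hd \<pi> \<in> carrier G" "y \<in> carrier G" "h (hd \<pi>) \<le> h y"
        using that by (auto simp: P_def saw_def)
      then show ?thesis using invariant_heightD[OF h that(1), of "hd \<pi>" y] by simp
    qed
    then show ?thesis
      unfolding invariant_walks_def P_def using saw_translate H_carrier
      by (auto simp: saw_def hd_map)
  qed
  have fin_P: "nsum gw {\<pi>\<in>P. hd \<pi> = r} < \<infinity>" if "r \<in> R" for r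
  proof -
    have r: "r \<in> carrier G" using that R_carrier by auto
    obtain y where y: "y \<in> carrier G" "h y < h r" "0 < \<psi> (inv y \<otimes> r)" using down[OF r] by blast
    have "nsum gw {\<pi>. \<pi> \<in> P \<and> hd \<pi> = r} \<le>
        ennreal (1 / \<psi> (inv y \<otimes> r)) * nsum gw {\<pi>. half_space h \<pi> \<and> hd \<pi> = y}"
    proof (rule nsum_prepend[OF y(1) r y(3)])
      fix \<pi> assume \<pi>: "\<pi> \<in> P" "hd \<pi> = r"
      then show "\<pi> \<noteq> [] \<and> set \<pi> \<subseteq> carrier G \<and> half_space h (y # \<pi>)"
        using y by (fastforce simp: P_def half_space_def saw_def)
    qed
    also have "\<dots> < \<infinity>"
      using E(1) E(2)[OF y(1)] by (simp add: ennreal_mult_less_top) (meson le_less_trans)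
    finally show ?thesis by simp
  qed
  define I where "I = {\<pi>. rev \<pi> \<in> P \<and> hd \<pi> = v}"
  have "\<exists>\<beta> \<rho>. \<pi> = butlast \<beta> @ \<rho> \<and> \<beta> \<in> I \<and> half_space h \<rho> \<and> hd \<rho> = last \<beta> \<and> gw \<pi> = gw \<beta> * gw \<rho>"
    if \<pi>: "saw G \<pi>" "hd \<pi> = v" for \<pi>
  proof -
    define M where "M = Min (h ` set \<pi>)"
    have ne: "\<pi> \<noteq> []" using \<pi> by (simp add: saw_def)
    have M: "\<exists>x\<in>set \<pi>. h x = M" "\<And>y. y \<in> set \<pi> \<Longrightarrow> M \<le> h y"
      using Min_in[of "h ` set \<pi>"] Min_le[of "h ` set \<pi>"] ne unfolding M_def by fastforce+
    obtain \<sigma> x \<rho> where s: "\<pi> = \<sigma> @ x # \<rho>" "h x = M" "\<forall>y\<in>set \<rho>. h y \<noteq> M"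
      using split_list_last_prop[OF M(1)] by metis
    have "h x < h y" if "y \<in> set \<rho>" for y
      using s M(2)[of y] that by fastforce
    then have 1: "half_space h (x # \<rho>)"
      using saw_appendD(2) \<pi>(1) s(1) by (auto simp: half_space_def)
    have hd: "hd (\<sigma> @ [x]) = v" using s(1) \<pi>(2) by (cases \<sigma>) auto
    have "saw G (rev (\<sigma> @ [x]))" using \<pi>(1) s(1) by (auto simp: saw_def)
    then have 2: "\<sigma> @ [x] \<in> I" using hd M(2) s by (auto simp: I_def P_def)
    have "set (\<sigma> @ x # \<rho>) \<subseteq> carrier G" using \<pi>(1) s(1) by (auto simp: saw_def)
    then have "gw \<pi> = gw (\<sigma> @ [x]) * gw (x # \<rho>)" using gw_append s(1) by metis
    with 1 2 s(1) show ?thesis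
      by (intro exI[of _ "\<sigma> @ [x]"] exI[of _ "x # \<rho>"]) auto
  qed
  then obtain \<beta> \<rho> where f: "\<And>\<pi>. saw G \<pi> \<Longrightarrow> hd \<pi> = v \<Longrightarrow> \<pi> = butlast (\<beta> \<pi>) @ \<rho> \<pi> \<and> \<beta> \<pi> \<in> I \<and>
      half_space h (\<rho> \<pi>) \<and> hd (\<rho> \<pi>) = last (\<beta> \<pi>) \<and> gw \<pi> = gw (\<beta> \<pi>) * gw (\<rho> \<pi>)"
    by metis
  have "nsum gw {\<pi>. saw G \<pi> \<and> hd \<pi> = v} \<le>
      nsum (\<lambda>\<beta>. nsum (\<lambda>\<rho>. gw \<beta> * gw \<rho>) {\<rho>. half_space h \<rho> \<and> hd \<rho> = last \<beta>}) I"
  proof (rule nsum_le_Sigma[where a = \<beta> and b = \<rho>])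
    show "inj_on (\<lambda>\<pi>. (\<beta> \<pi>, \<rho> \<pi>)) {\<pi>. saw G \<pi> \<and> hd \<pi> = v}"
      using f by (intro inj_on_inverseI[where g = "\<lambda>(\<beta>, \<rho>). butlast \<beta> @ \<rho>"]) auto
  qed (use f in auto)
  also have "\<dots> \<le> nsum (\<lambda>\<beta>. E * gw \<beta>) I"
  proof (rule nsum_mono)
    fix \<beta> assume "\<beta> \<in> I"
    then have "\<beta> \<noteq> []" "set \<beta> \<subseteq> carrier G" by (auto simp: I_def P_def saw_def)
    then have "last \<beta> \<in> carrier G" by (metis last_in_set subsetD)
    then show "nsum (\<lambda>\<rho>. gw \<beta> * gw \<rho>) {\<rho>. half_space h \<rho> \<and> hd \<rho> = last \<beta>} \<le> E * gw \<beta>"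
      unfolding nsum_cmult by (subst mult.commute) (intro mult_right_mono E, auto)
  qed
  also have "\<dots> = E * nsum gw I" by (rule nsum_cmult)
  also have "\<dots> < \<infinity>"
  proof -
    have "nsum gw I \<le> (\<Sum>r\<in>R. nsum gw {\<pi>\<in>P. hd \<pi> = r})"
      unfolding I_def by (rule nsum_reversed[OF P v])
    also have "\<dots> < \<infinity>" using fin_P R_finite by simp
    finally show ?thesis using E(1) by (simp add: ennreal_mult_less_top)
  qed
  finally show ?thesis .
qed

end

section \<open>Growth rates and radii of convergence\<close>

text \<open>\<open>x powr t\<close> increases or decreases in \<open>t\<close> according to the
  position of \<open>x\<close> relative to 1; \<open>min\<close> and \<open>max\<close> cover both
  cases. So the tilt varies by a bounded factor within one window.\<close>

lemma powr_window:
  fixes x :: real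
  assumes "0 < x" "0 \<le> t" "t \<le> c"
  shows "min 1 (x powr c) \<le> x powr t" "x powr t \<le> max 1 (x powr c)"
proof -
  have "(1 \<le> x powr t \<and> x powr t \<le> x powr c) \<or> (x powr c \<le> x powr t \<and> x powr t \<le> 1)"
  proof (cases "1 \<le> x")
    case True
    then show ?thesis using assms by (simp add: ge_one_powr_ge_zero powr_mono)
  next
    case False
    then show ?thesis using assms powr_mono'[of 0 t x] powr_mono'[of t c x] by simp
  qed
  then show "min 1 (x powr c) \<le> x powr t" "x powr t \<le> max 1 (x powr c)" by auto
qed

lemma nsum_geometric_less_top:
  fixes r :: real
  assumes "0 \<le> r" "r < 1" "0 \<le> K"
  shows "nsum (\<lambda>n. ennreal (K * r ^ n)) UNIV < \<infinity>"
proof -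
  have "summable (\<lambda>n. K * r ^ n)" using assms by (intro summable_mult summable_geometric) auto
  moreover have "0 \<le> K * r ^ n" for n using assms by simp
  ultimately have "(\<Sum>n. ennreal (K * r ^ n)) \<noteq> top_class.top"
    by (rule ennreal_suminf_neq_top)
  then show ?thesis unfolding nsum_def nn_integral_count_space_nat by (simp add: less_top)
qed

lemma limsup_root_nonneg:
  fixes t :: "nat \<Rightarrow> real"
  assumes "\<And>m. 0 \<le> t m"
  shows "0 \<le> limsup (\<lambda>m. ereal (root m (t m)))"
proof (rule le_Limsup)
  \<comment> \<open>\<open>root 0\<close> is 0 by convention, hence the separate case.\<close>
  have "0 \<le> root m (t m)" for m using assms by (cases "m = 0") simp_all
  then show "\<forall>\<^sub>F m in sequentially. 0 \<le> ereal (root m (t m))" by simp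
qed simp

lemma limsup_root_le:
  fixes t :: "nat \<Rightarrow> real"
  assumes "0 < y" "0 \<le> K" "\<And>m. t m \<le> K * y ^ m"
  shows "limsup (\<lambda>m. ereal (root m (t m))) \<le> ereal y"
proof -
  \<comment> \<open>\<open>K + 1\<close> is positive even if \<open>K\<close> is 0, so its roots
    tend to 1.\<close>
  have "(\<lambda>m. root m (K + 1) * y) \<longlonglongrightarrow> 1 * y"
    using assms by (intro tendsto_mult LIMSEQ_root_const tendsto_const) auto
  then have lim: "limsup (\<lambda>m. ereal (root m (K + 1) * y)) = ereal y"
    by (intro lim_imp_Limsup) auto
  have "root m (t m) \<le> root m (K + 1) * y" if "0 < m" for m
  proof -
    have "t m \<le> (K + 1) * y ^ m"
      using assms(3)[of m] assms(1) by (simp add: distrib_right add_increasing2)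
    then have "root m (t m) \<le> root m ((K + 1) * y ^ m)" using that by simp
    also have "\<dots> = root m (K + 1) * y"
      using that assms(1) by (simp add: real_root_mult real_root_power_cancel)
    finally show ?thesis .
  qed
  then have "limsup (\<lambda>m. ereal (root m (t m))) \<le> limsup (\<lambda>m. ereal (root m (K + 1) * y))"
    by (intro Limsup_mono eventually_sequentiallyI[of 1]) auto
  then show ?thesis using lim by simp
qed

context group
begin

abbreviation ew :: "('a \<Rightarrow> real) \<Rightarrow> 'a list \<Rightarrow> ennreal" where
  "ew \<psi> \<equiv> \<lambda>\<pi>. ennreal (walk_weight G \<psi> \<pi>)"

text \<open>The family \<open>Q\<close> is a parameter so that one set of estimates serves
  self-avoiding walks and bridges.\<close>

definition window :: "('a \<Rightarrow> real) \<Rightarrow> 'a list set \<Rightarrow> nat \<Rightarrow> real \<Rightarrow> 'a list set" where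
  "window \<l> Q m c = {\<pi>\<in>Q. real m \<le> walk_length G \<l> \<pi> \<and> walk_length G \<l> \<pi> < real m + c}"

lemma saws_eq_window: "saws G \<l> m c = window \<l> {\<pi>. saw G \<pi> \<and> hd \<pi> = \<one>} m c"
  by (auto simp: saws_def window_def saw_def hd_conv_nth)

lemma bridges_eq_window: "bridges G h \<l> m c v = window \<l> {\<pi>. bridge G h \<pi> \<and> hd \<pi> = v} m c"
  by (auto simp: bridges_def window_def bridge_def saw_def hd_conv_nth)

definition tilt :: "real \<Rightarrow> ('a \<Rightarrow> real) \<Rightarrow> ('a \<Rightarrow> real) \<Rightarrow> 'a \<Rightarrow> real" where
  "tilt x \<l> \<phi> = (\<lambda>\<gamma>. \<phi> \<gamma> * x powr \<l> \<gamma>)"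

lemma weight_functionsD:
  assumes "\<phi> \<in> weight_functions G" "\<gamma> \<in> carrier G"
  shows "0 \<le> \<phi> \<gamma>" "\<phi> (inv \<gamma>) = \<phi> \<gamma>"
  using assms by (auto simp: weight_functions_def)

lemma ew_tilt:
  assumes "0 < x"
  shows "ew (tilt x \<l> \<phi>) \<pi> = ennreal (walk_weight G \<phi> \<pi> * x powr walk_length G \<l> \<pi>)"
  unfolding tilt_def walk_weight_tilt[OF assms] ..

text \<open>An exponential Markov inequality: on the window the tilting factor is at least
  \<open>x ^ m * min 1 (x powr c)\<close>, so dividing the tilted sum by this bounds the untilted
  one.\<close>

lemma nsum_window_le:
  assumes \<phi>: "\<And>\<gamma>. \<gamma> \<in> carrier G \<Longrightarrow> 0 \<le> \<phi> \<gamma>" and Q: "\<And>\<pi>. \<pi> \<in> Q \<Longrightarrow> set \<pi> \<subseteq> carrier G"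
    and x: "0 < x"
  shows "nsum (ew \<phi>) (window \<l> Q m c) \<le>
    ennreal ((1 / x) ^ m / min 1 (x powr c)) * nsum (ew (tilt x \<l> \<phi>)) Q"
proof -
  have "nsum (ew \<phi>) (window \<l> Q m c) \<le>
      nsum (\<lambda>\<pi>. ennreal ((1 / x) ^ m / min 1 (x powr c)) * ew (tilt x \<l> \<phi>) \<pi>) Q"
  proof (rule nsum_le_inj[where a = id])
    fix \<pi> assume \<pi>: "\<pi> \<in> window \<l> Q m c"
    define w t where "w = walk_weight G \<phi> \<pi>" and "t = walk_length G \<l> \<pi>"
    have w: "0 \<le> w" unfolding w_def using \<pi> Q \<phi> by (intro walk_weight_nonneg) (auto simp: window_def)
    have t: "real m \<le> t" "t < real m + c" using \<pi> by (auto simp: window_def t_def)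
    have "min 1 (x powr c) * x ^ m \<le> x powr (t - real m) * x powr real m"
      using t x by (simp add: powr_window(1) powr_realpow)
    also have "\<dots> = x powr t" by (simp add: powr_add[symmetric])
    finally have "w * (min 1 (x powr c) * x ^ m) \<le> w * x powr t" using w by (rule mult_left_mono)
    moreover have "0 < min 1 (x powr c)" using x by simp
    ultimately have "w \<le> (1 / x) ^ m / min 1 (x powr c) * (w * x powr t)"
      using x by (simp add: field_simps power_divide del: min_less_iff_conj)
    then have "ennreal w \<le> ennreal ((1 / x) ^ m / min 1 (x powr c)) * ennreal (w * x powr t)"
      using w x by (subst ennreal_mult[symmetric]) (auto intro!: ennreal_leI)
    then show "ew \<phi> \<pi> \<le> ennreal ((1 / x) ^ m / min 1 (x powr c)) * ew (tilt x \<l> \<phi>) (id \<pi>)"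
      using ew_tilt[OF x] by (simp add: w_def t_def)
  qed (auto simp: window_def)
  then show ?thesis by (simp add: nsum_cmult)
qed

text \<open>Each walk is assigned to the window at the integer part of its length, which contains it
  because \<open>1 \<le> c\<close>. The windows then contribute at most a geometric series of ratio
  \<open>x * y\<close>.\<close>

lemma nsum_tilt_finite:
  assumes \<phi>: "\<And>\<gamma>. \<gamma> \<in> carrier G \<Longrightarrow> 0 \<le> \<phi> \<gamma>" and Q: "\<And>\<pi>. \<pi> \<in> Q \<Longrightarrow> set \<pi> \<subseteq> carrier G"
    and \<l>: "\<And>\<gamma>. \<gamma> \<in> carrier G \<Longrightarrow> 0 \<le> \<l> \<gamma>"
    and xy: "0 < x" "0 < y" "x * y < 1" and c: "1 \<le> c"
    and fin: "\<And>m. nsum (ew \<phi>) (window \<l> Q m c) < \<infinity>"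
    and ev: "\<forall>\<^sub>F m in sequentially. nsum (ew \<phi>) (window \<l> Q m c) \<le> ennreal (y ^ m)"
  shows "nsum (ew (tilt x \<l> \<phi>)) Q < \<infinity>"
proof -
  define t where "t m = nsum (ew \<phi>) (window \<l> Q m c)" for m
  define M where "M = max 1 (x powr c)"
  obtain N where N: "\<And>m. N \<le> m \<Longrightarrow> t m \<le> ennreal (y ^ m)"
    using ev unfolding t_def eventually_sequentially by blast
  \<comment> \<open>\<open>D\<close> absorbs the finitely many windows before \<open>N\<close>,
    whose weights are finite but not yet controlled by \<open>y ^ m\<close>.\<close>
  define D where "D = 1 + (\<Sum>m<N. enn2real (t m) / y ^ m)"
  have D: "1 \<le> D" using xy unfolding D_def by (simp add: sum_nonneg)
  have t_le: "t m \<le> ennreal (D * y ^ m)" for m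
  proof (cases "m < N")
    case True
    have "enn2real (t m) / y ^ m \<le> (\<Sum>m<N. enn2real (t m) / y ^ m)"
      using True xy by (intro member_le_sum) auto
    then have "enn2real (t m) / y ^ m \<le> D" unfolding D_def by simp
    then have "enn2real (t m) \<le> D * y ^ m" using xy by (simp add: divide_le_eq)
    moreover have "t m = ennreal (enn2real (t m))" using fin[of m] by (simp add: t_def less_top)
    ultimately show ?thesis by (metis ennreal_leI)
  next
    case False
    then have "t m \<le> ennreal (y ^ m)" using N by simp
    also have "\<dots> \<le> ennreal (D * y ^ m)" using D xy by (intro ennreal_leI) simp
    finally show ?thesis .
  qed
  have "nsum (ew (tilt x \<l> \<phi>)) Q \<le>
      nsum (\<lambda>m. nsum (\<lambda>\<pi>. ennreal (M * x ^ m) * ew \<phi> \<pi>) (window \<l> Q m c)) UNIV"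
  proof (rule nsum_le_Sigma[where a = "\<lambda>\<pi>. nat \<lfloor>walk_length G \<l> \<pi>\<rfloor>" and b = id])
    fix \<pi> assume \<pi>: "\<pi> \<in> Q"
    define w t m where "w = walk_weight G \<phi> \<pi>" and "t = walk_length G \<l> \<pi>" and "m = nat \<lfloor>t\<rfloor>"
    have w: "0 \<le> w" unfolding w_def using \<pi> Q \<phi> by (intro walk_weight_nonneg) auto
    have "0 \<le> t" unfolding t_def using walk_length_ge[of 0 \<l> \<pi>] \<l> Q[OF \<pi>] by simp
    then have m: "real m \<le> t" "t < real m + 1" unfolding m_def by linarith+
    then show "id \<pi> \<in> window \<l> Q (nat \<lfloor>walk_length G \<l> \<pi>\<rfloor>) c"
      using \<pi> c by (auto simp: window_def simp flip: t_def m_def)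
    have "x powr t = x powr (t - real m) * x ^ m"
      using xy by (simp add: powr_realpow[symmetric] powr_add[symmetric])
    also have "\<dots> \<le> M * x ^ m"
      using m c xy unfolding M_def by (intro mult_right_mono powr_window(2)) auto
    finally have "w * x powr t \<le> (M * x ^ m) * w"
      using w by (subst mult.commute) (rule mult_right_mono)
    moreover have "0 \<le> M * x ^ m" using xy by (simp add: M_def)
    ultimately have "ennreal (w * x powr t) \<le> ennreal (M * x ^ m) * ennreal w"
      using w by (subst ennreal_mult[symmetric]) (auto intro!: ennreal_leI)
    then show "ew (tilt x \<l> \<phi>) \<pi> \<le> ennreal (M * x ^ nat \<lfloor>walk_length G \<l> \<pi>\<rfloor>) * ew \<phi> (id \<pi>)"
      using ew_tilt[OF xy(1)] by (simp add: w_def t_def m_def)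
  qed (auto simp: inj_on_def)
  also have "\<dots> = nsum (\<lambda>m. ennreal (M * x ^ m) * t m) UNIV"
    by (simp add: nsum_cmult t_def)
  also have "\<dots> \<le> nsum (\<lambda>m. ennreal (M * D * (x * y) ^ m)) UNIV"
  proof (rule nsum_mono)
    fix m
    have "ennreal (M * x ^ m) * t m \<le> ennreal (M * x ^ m) * ennreal (D * y ^ m)"
      by (intro mult_left_mono t_le) simp
    also have "\<dots> = ennreal (M * x ^ m * (D * y ^ m))"
      using xy D by (intro ennreal_mult[symmetric]) (auto simp: M_def)
    also have "M * x ^ m * (D * y ^ m) = M * D * (x * y) ^ m" by (simp add: power_mult_distrib)
    finally show "ennreal (M * x ^ m) * t m \<le> ennreal (M * D * (x * y) ^ m)" .
  qed
  also have "\<dots> < \<infinity>" using xy D by (intro nsum_geometric_less_top) (auto simp: M_def)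
  finally show ?thesis .
qed

text \<open>Without self-avoidance the increments are free, and the sum over walks with
  \<open>n\<close> steps factorises.\<close>

lemma nsum_walks_le_power:
  assumes \<psi>: "\<And>\<gamma>. \<gamma> \<in> carrier G \<Longrightarrow> 0 \<le> \<psi> \<gamma>" and v: "v \<in> carrier G"
  shows "nsum (ew \<psi>) {\<pi>. set \<pi> \<subseteq> carrier G \<and> hd \<pi> = v \<and> length \<pi> = Suc n} \<le>
    nsum (\<lambda>\<gamma>. ennreal (\<psi> \<gamma>)) (carrier G) ^ n"
  using v
proof (induction n arbitrary: v)
  case 0
  have "nsum (ew \<psi>) {\<pi>. set \<pi> \<subseteq> carrier G \<and> hd \<pi> = v \<and> length \<pi> = Suc 0} \<le> nsum (ew \<psi>) {[v]}"
    by (rule nsum_subset) (auto simp: length_Suc_conv)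
  then show ?case by (simp add: nsum_finite)
next
  case (Suc n)
  define S where "S = nsum (\<lambda>\<gamma>. ennreal (\<psi> \<gamma>)) (carrier G)"
  have "nsum (ew \<psi>) {\<pi>. set \<pi> \<subseteq> carrier G \<and> hd \<pi> = v \<and> length \<pi> = Suc (Suc n)} \<le>
      nsum (\<lambda>u. nsum (\<lambda>\<rho>. ennreal (\<psi> (inv v \<otimes> u)) * ew \<psi> \<rho>)
        {\<pi>. set \<pi> \<subseteq> carrier G \<and> hd \<pi> = u \<and> length \<pi> = Suc n}) (carrier G)"
  proof (rule nsum_le_Sigma[where a = "\<lambda>\<pi>. hd (tl \<pi>)" and b = tl])
    show "inj_on (\<lambda>\<pi>. (hd (tl \<pi>), tl \<pi>)) {\<pi>. set \<pi> \<subseteq> carrier G \<and> hd \<pi> = v \<and> length \<pi> = Suc (Suc n)}"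
      by (intro inj_on_inverseI[where g = "\<lambda>(_, \<rho>). v # \<rho>"]) (auto simp: length_Suc_conv)
    fix \<pi> assume "\<pi> \<in> {\<pi>. set \<pi> \<subseteq> carrier G \<and> hd \<pi> = v \<and> length \<pi> = Suc (Suc n)}"
    then obtain u \<rho> where \<pi>: "\<pi> = v # u # \<rho>" "set (u # \<rho>) \<subseteq> carrier G" "length \<rho> = n"
      by (auto simp: length_Suc_conv)
    then show "hd (tl \<pi>) \<in> carrier G"
      "tl \<pi> \<in> {\<pi>'. set \<pi>' \<subseteq> carrier G \<and> hd \<pi>' = hd (tl \<pi>) \<and> length \<pi>' = Suc n}" by auto
    have "0 \<le> \<psi> (inv v \<otimes> u)" "0 \<le> walk_weight G \<psi> (u # \<rho>)"
      using \<pi> Suc.prems by (auto intro!: \<psi> walk_weight_nonneg)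
    then show "ew \<psi> \<pi> \<le> ennreal (\<psi> (inv v \<otimes> hd (tl \<pi>))) * ew \<psi> (tl \<pi>)"
      using \<pi>(1) by (simp add: walk_weight_Cons ennreal_mult)
  qed
  also have "\<dots> \<le> nsum (\<lambda>u. S ^ n * ennreal (\<psi> (inv v \<otimes> u))) (carrier G)"
    using Suc.IH unfolding S_def
    by (intro nsum_mono) (subst nsum_cmult, subst mult.commute, rule mult_right_mono, auto)
  also have "\<dots> = S ^ n * nsum (\<lambda>u. ennreal (\<psi> (inv v \<otimes> u))) (carrier G)"
    by (rule nsum_cmult)
  also have "\<dots> \<le> S ^ n * S"
    unfolding S_def using Suc.prems
    by (intro mult_left_mono nsum_le_inj[where a = "\<lambda>u. inv v \<otimes> u"]) (auto intro!: inj_onI)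
  finally show ?case by (simp add: S_def mult.commute)
qed

text \<open>For \<open>x \<le> 1\<close> the lower bound \<open>a\<close> on lengths gives
  \<open>x powr \<l> \<gamma> \<le> x powr a\<close>. A small \<open>x\<close> brings the total
  tilted step weight below 1/2, and walks with \<open>n\<close> steps then weigh at most
  \<open>(1 / 2) ^ n\<close>.\<close>

lemma nsum_saws_tilt_finite:
  assumes \<phi>: "\<And>\<gamma>. \<gamma> \<in> carrier G \<Longrightarrow> 0 \<le> \<phi> \<gamma>" "\<phi> summable_on carrier G"
    and \<l>: "0 < a" "\<And>\<gamma>. \<gamma> \<in> carrier G \<Longrightarrow> a \<le> \<l> \<gamma>"
  shows "\<exists>x>0. \<forall>v\<in>carrier G. nsum (ew (tilt x \<l> \<phi>)) {\<pi>. saw G \<pi> \<and> hd \<pi> = v} < \<infinity>"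
proof -
  define s where "s = infsum \<phi> (carrier G)"
  have "0 \<le> s" unfolding s_def using \<phi> by (intro infsum_nonneg)
  \<comment> \<open>Chosen so that \<open>x powr a = 1 / (2 * (1 + s))\<close>; \<open>1 + s\<close>
    in place of \<open>s\<close> avoids division by 0 and ensures \<open>x \<le> 1\<close>.\<close>
  define x where "x = (1 / (2 * (1 + s))) powr (1 / a)"
  have x: "0 < x" using \<open>0 \<le> s\<close> by (simp add: x_def)
  have "x powr a = 1 / (2 * (1 + s))"
    using \<l>(1) \<open>0 \<le> s\<close> by (simp add: x_def powr_powr)
  then have "2 * (x powr a * s) = 1 - 2 * x powr a" using \<open>0 \<le> s\<close> by (simp add: field_simps)
  then have xs: "x powr a * s \<le> 1 / 2" using powr_ge_zero[of x a] by linarith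
  have "x \<le> 1" unfolding x_def using \<l>(1) \<open>0 \<le> s\<close> by (intro powr_le1) (auto simp: field_simps)
  let ?\<psi> = "tilt x \<l> \<phi>"
  have \<psi>: "0 \<le> ?\<psi> \<gamma>" "?\<psi> \<gamma> \<le> x powr a * \<phi> \<gamma>" if "\<gamma> \<in> carrier G" for \<gamma>
    using \<phi>(1)[OF that] \<l>(2)[OF that] x \<open>x \<le> 1\<close> unfolding tilt_def
    by (auto simp: mult.commute intro!: mult_left_mono powr_mono')
  have "nsum (\<lambda>\<gamma>. ennreal (?\<psi> \<gamma>)) (carrier G) \<le>
      nsum (\<lambda>\<gamma>. ennreal (x powr a) * ennreal (\<phi> \<gamma>)) (carrier G)"
    using \<psi> \<phi>(1) by (intro nsum_mono) (simp add: ennreal_mult[symmetric] ennreal_leI)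
  also have "\<dots> = ennreal (x powr a) * ennreal s"
    using \<phi> by (simp add: nsum_cmult nsum_summable s_def)
  also have "\<dots> = ennreal (x powr a * s)"
    by (rule ennreal_mult[symmetric]) (use \<open>0 \<le> s\<close> in auto)
  also have "\<dots> \<le> ennreal (1 / 2)" by (rule ennreal_leI[OF xs])
  finally have half: "nsum (\<lambda>\<gamma>. ennreal (?\<psi> \<gamma>)) (carrier G) \<le> ennreal (1 / 2)" .
  have pow: "nsum (\<lambda>\<gamma>. ennreal (?\<psi> \<gamma>)) (carrier G) ^ n \<le> ennreal (1 * (1 / 2) ^ n)" for n
  proof -
    have "nsum (\<lambda>\<gamma>. ennreal (?\<psi> \<gamma>)) (carrier G) ^ n \<le> ennreal (1 / 2) ^ n"
      by (rule power_mono[OF half]) simp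
    also have "\<dots> = ennreal ((1 / 2) ^ n)" by (rule ennreal_power) simp
    finally show ?thesis by simp
  qed
  have "nsum (ew ?\<psi>) {\<pi>. saw G \<pi> \<and> hd \<pi> = v} < \<infinity>" if v: "v \<in> carrier G" for v
  proof -
    have "nsum (ew ?\<psi>) {\<pi>. saw G \<pi> \<and> hd \<pi> = v} \<le>
        nsum (\<lambda>n. nsum (ew ?\<psi>) {\<pi>. set \<pi> \<subseteq> carrier G \<and> hd \<pi> = v \<and> length \<pi> = Suc n}) UNIV"
      by (rule nsum_le_Sigma[where a = "\<lambda>\<pi>. length \<pi> - 1" and b = id])
         (auto simp: saw_def inj_on_def)
    also have "\<dots> \<le> nsum (\<lambda>n. ennreal (1 * (1 / 2) ^ n)) UNIV"
      using nsum_walks_le_power[OF \<psi>(1) v] pow by (intro nsum_mono) (meson order_trans)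
    also have "\<dots> < \<infinity>" by (rule nsum_geometric_less_top) auto
    finally show ?thesis .
  qed
  then show ?thesis using x by blast
qed

lemma length_functionsD:
  assumes "\<l> \<in> length_functions G"
  shows "\<exists>a>0. \<forall>\<gamma>\<in>carrier G. a \<le> \<l> \<gamma>"
proof (intro exI conjI ballI)
  show "0 < (INF \<gamma>\<in>carrier G. \<l> \<gamma>)" using assms by (simp add: length_functions_def)
  fix \<gamma> assume "\<gamma> \<in> carrier G"
  moreover have "bdd_below (\<l> ` carrier G)"
    using assms by (auto simp: length_functions_def intro!: bdd_belowI[of _ 0] less_imp_le)
  ultimately show "(INF \<gamma>\<in>carrier G. \<l> \<gamma>) \<le> \<l> \<gamma>" by (intro cINF_lower)
qed

lemma total_weight_ennreal:
  assumes "\<phi> \<in> weight_functions G" "\<And>\<pi>. \<pi> \<in> P \<Longrightarrow> set \<pi> \<subseteq> carrier G"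
    and "nsum (ew \<phi>) P < \<infinity>"
  shows "ennreal (total_weight G \<phi> P) = nsum (ew \<phi>) P"
  unfolding total_weight_def using assms weight_functionsD(1)
  by (intro nsum_infsum walk_weight_nonneg) auto

lemma total_weight_nonneg:
  assumes "\<phi> \<in> weight_functions G" "\<And>\<pi>. \<pi> \<in> P \<Longrightarrow> set \<pi> \<subseteq> carrier G"
  shows "0 \<le> total_weight G \<phi> P"
  unfolding total_weight_def using assms weight_functionsD(1)
  by (intro infsum_nonneg walk_weight_nonneg) auto

end

section \<open>Growth rates of window sums and the connective constant\<close>

locale weighted_saws = group G for G :: "('a, 'b) monoid_scheme" (structure) +
  fixes \<phi> \<l> :: "'a \<Rightarrow> real"
  assumes \<phi>: "\<phi> \<in> weight_functions G" and \<l>: "\<l> \<in> length_functions G"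
begin

lemma exists_finite_tilt:
  "\<exists>x>0. \<forall>v\<in>carrier G. nsum (ew (tilt x \<l> \<phi>)) {\<pi>. saw G \<pi> \<and> hd \<pi> = v} < \<infinity>"
  using \<phi> length_functionsD[OF \<l>] nsum_saws_tilt_finite unfolding weight_functions_def by blast

text \<open>A single convergent tilt bounds every window, so the real sums over windows are
  genuine.\<close>

lemma nsum_window_finite:
  assumes "Q \<subseteq> {\<pi>. saw G \<pi> \<and> hd \<pi> = v}" "v \<in> carrier G"
  shows "nsum (ew \<phi>) (window \<l> Q m c) < \<infinity>"
proof -
  obtain x where x: "0 < x" "nsum (ew (tilt x \<l> \<phi>)) {\<pi>. saw G \<pi> \<and> hd \<pi> = v} < \<infinity>"
    using exists_finite_tilt assms(2) by blast
  have "nsum (ew \<phi>) (window \<l> Q m c) \<le>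
      ennreal ((1 / x) ^ m / min 1 (x powr c)) * nsum (ew (tilt x \<l> \<phi>)) Q"
    using assms(1) weight_functionsD(1)[OF \<phi>] x(1) by (intro nsum_window_le) (auto simp: saw_def)
  also have "\<dots> \<le> ennreal ((1 / x) ^ m / min 1 (x powr c)) *
      nsum (ew (tilt x \<l> \<phi>)) {\<pi>. saw G \<pi> \<and> hd \<pi> = v}"
    by (intro mult_left_mono nsum_subset assms(1)) simp
  also have "\<dots> < \<infinity>" using x(2) by (simp add: ennreal_mult_less_top)
  finally show ?thesis .
qed

lemma total_weight_window:
  assumes "Q \<subseteq> {\<pi>. saw G \<pi> \<and> hd \<pi> = v}" "v \<in> carrier G"
  shows "ennreal (total_weight G \<phi> (window \<l> Q m c)) = nsum (ew \<phi>) (window \<l> Q m c)"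
    and "0 \<le> total_weight G \<phi> (window \<l> Q m c)"
proof -
  have "set \<pi> \<subseteq> carrier G" if "\<pi> \<in> window \<l> Q m c" for \<pi>
    using that assms(1) by (auto simp: window_def saw_def)
  then show "ennreal (total_weight G \<phi> (window \<l> Q m c)) = nsum (ew \<phi>) (window \<l> Q m c)"
    and "0 \<le> total_weight G \<phi> (window \<l> Q m c)"
    using nsum_window_finite[OF assms] \<phi> by (auto intro!: total_weight_ennreal total_weight_nonneg)
qed

text \<open>One half of the Cauchy-Hadamard relation: convergence at \<open>x\<close> bounds the
  growth rate by \<open>1 / x\<close>, whatever the width. The other half is
  \<open>tilt_finite_of_growth\<close>.\<close>

lemma growth_le:
  assumes Q: "Q \<subseteq> {\<pi>. saw G \<pi> \<and> hd \<pi> = v}" "v \<in> carrier G"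
    and x: "0 < x" and fin: "nsum (ew (tilt x \<l> \<phi>)) Q < \<infinity>"
  shows "limsup (\<lambda>m. ereal (root m (total_weight G \<phi> (window \<l> Q m c)))) \<le> ereal (1 / x)"
proof (rule limsup_root_le)
  define Z where "Z = enn2real (nsum (ew (tilt x \<l> \<phi>)) Q)"
  show "0 < 1 / x" "0 \<le> Z / min 1 (x powr c)" using x by (simp_all add: Z_def)
  fix m
  have "nsum (ew \<phi>) (window \<l> Q m c) \<le>
      ennreal ((1 / x) ^ m / min 1 (x powr c)) * nsum (ew (tilt x \<l> \<phi>)) Q"
    using Q(1) weight_functionsD(1)[OF \<phi>] x by (intro nsum_window_le) (auto simp: saw_def)
  also have "nsum (ew (tilt x \<l> \<phi>)) Q = ennreal Z" using fin by (simp add: Z_def less_top)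
  also have "ennreal ((1 / x) ^ m / min 1 (x powr c)) * ennreal Z =
      ennreal (Z / min 1 (x powr c) * (1 / x) ^ m)"
    using x by (subst ennreal_mult[symmetric]) (auto simp: Z_def mult.commute)
  finally show "total_weight G \<phi> (window \<l> Q m c) \<le> Z / min 1 (x powr c) * (1 / x) ^ m"
    using x unfolding total_weight_window(1)[OF Q, symmetric]
    by (subst (asm) ennreal_le_iff) (auto simp: Z_def)
qed

lemma tilt_finite_of_growth:
  assumes Q: "Q \<subseteq> {\<pi>. saw G \<pi> \<and> hd \<pi> = v}" "v \<in> carrier G"
    and x: "0 < x" and y: "0 < y" "x * y < 1" and c: "1 \<le> c"
    and ev: "\<forall>\<^sub>F m in sequentially. total_weight G \<phi> (window \<l> Q m c) \<le> y ^ m"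
  shows "nsum (ew (tilt x \<l> \<phi>)) Q < \<infinity>"
proof (rule nsum_tilt_finite[where y = y and c = c])
  show "\<forall>\<^sub>F m in sequentially. nsum (ew \<phi>) (window \<l> Q m c) \<le> ennreal (y ^ m)"
    using ev by eventually_elim (simp add: total_weight_window(1)[OF Q, symmetric] ennreal_leI)
  show "set \<pi> \<subseteq> carrier G" if "\<pi> \<in> Q" for \<pi> using that Q by (auto simp: saw_def)
  show "0 \<le> \<l> \<gamma>" if "\<gamma> \<in> carrier G" for \<gamma>
    using that \<l> by (auto simp: length_functions_def intro: less_imp_le)
  show "nsum (ew \<phi>) (window \<l> Q m c) < \<infinity>" for m by (rule nsum_window_finite[OF Q])
  show "0 \<le> \<phi> \<gamma>" if "\<gamma> \<in> carrier G" for \<gamma> using weight_functionsD(1)[OF \<phi> that] .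
qed fact+

text \<open>Widths are compared through the series: a rate below \<open>y\<close> at width
  \<open>c\<close> forces convergence at \<open>1 / z\<close>, and this bounds the rate at every
  width \<open>d\<close> by \<open>z\<close>. The gap between \<open>y\<close> and \<open>z\<close>
  makes the ratio of the geometric series less than 1.\<close>

lemma growth_window_le:
  assumes Q: "Q \<subseteq> {\<pi>. saw G \<pi> \<and> hd \<pi> = v}" "v \<in> carrier G" and c: "1 \<le> c"
  shows "limsup (\<lambda>m. ereal (root m (total_weight G \<phi> (window \<l> Q m d)))) \<le>
    limsup (\<lambda>m. ereal (root m (total_weight G \<phi> (window \<l> Q m c))))" (is "?L d \<le> ?L c")
proof (rule ccontr)
  assume "\<not> ?L d \<le> ?L c"
  then have "?L c < ?L d" by (rule not_le_imp_less)
  then obtain z where z: "?L c < ereal z" "ereal z < ?L d" using ereal_dense2 by blast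
  obtain y where y: "?L c < ereal y" "ereal y < ereal z" using ereal_dense2[OF z(1)] by blast
  have "0 \<le> ?L c" by (rule limsup_root_nonneg) (rule total_weight_window(2)[OF Q])
  then have "ereal 0 < ereal y" using y(1) unfolding zero_ereal_def by (rule le_less_trans)
  then have yz: "?L c < ereal y" "y < z" "ereal z < ?L d" "0 < y" using y z by simp_all
  have "\<forall>\<^sub>F m in sequentially. ereal (root m (total_weight G \<phi> (window \<l> Q m c))) < ereal y"
    by (rule Limsup_lessD) fact
  moreover have "\<forall>\<^sub>F m in sequentially. 0 < m" by (rule eventually_gt_at_top)
  ultimately have "\<forall>\<^sub>F m in sequentially. total_weight G \<phi> (window \<l> Q m c) \<le> y ^ m"
  proof eventually_elim
    case (elim m)
    then have "root m (total_weight G \<phi> (window \<l> Q m c)) ^ m \<le> y ^ m"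
      using total_weight_window(2)[OF Q] by (intro power_mono) auto
    then show ?case using elim total_weight_window(2)[OF Q] by simp
  qed
  then have "nsum (ew (tilt (1 / z) \<l> \<phi>)) Q < \<infinity>"
    using yz c by (intro tilt_finite_of_growth[OF Q, of _ y c]) auto
  then have "?L d \<le> ereal (1 / (1 / z))" using yz by (intro growth_le[OF Q]) auto
  then have "?L d \<le> ereal z" by simp
  then show False using yz(3) by (meson leD)
qed

text \<open>One convergent tilt makes the limsup finite, and \<open>growth_window_le\<close> in both
  directions makes it the same for all widths at least 1. So the description has a witness, and it
  is unique because two values attained for all large \<open>c\<close> coincide.\<close>

lemma connective_constant_limsup:
  assumes "1 \<le> c"
  shows "limsup (\<lambda>m. ereal (root m (total_weight G \<phi> (saws G \<l> m c)))) =
    ereal (connective_constant G \<phi> \<l>)" (is "?L c = _")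
proof -
  let ?Q = "{\<pi>. saw G \<pi> \<and> hd \<pi> = \<one>}"
  have Q: "?Q \<subseteq> {\<pi>. saw G \<pi> \<and> hd \<pi> = \<one>}" "\<one> \<in> carrier G" by auto
  obtain x where x: "0 < x" "nsum (ew (tilt x \<l> \<phi>)) ?Q < \<infinity>"
    using exists_finite_tilt by blast
  have "?L 1 \<le> ereal (1 / x)"
    unfolding saws_eq_window using growth_le[OF Q x] .
  moreover have "0 \<le> ?L 1"
    unfolding saws_eq_window by (rule limsup_root_nonneg) (rule total_weight_window(2)[OF Q])
  ultimately obtain \<mu> where \<mu>: "?L 1 = ereal \<mu>" by (cases "?L 1") auto
  have L: "?L c = ereal \<mu>" if "1 \<le> c" for c
    using growth_window_le[OF Q that, of 1] growth_window_le[OF Q order_refl, of c] \<mu>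
    unfolding saws_eq_window by (metis antisym)
  have "connective_constant G \<phi> \<l> = \<mu>"
    unfolding connective_constant_def
  proof (rule the_equality)
    show ev: "\<forall>\<^sub>F c in at_top. ?L c = ereal \<mu>"
      using eventually_ge_at_top[of 1] by eventually_elim (rule L)
    fix \<mu>' assume "\<forall>\<^sub>F c in at_top. ?L c = ereal \<mu>'"
    with ev have "\<forall>\<^sub>F c :: real in at_top. \<mu>' = \<mu>" by eventually_elim simp
    then show "\<mu>' = \<mu>" by simp
  qed
  then show ?thesis using L assms by simp
qed

end

lemma connective_constant_mono:
  assumes "weighted_saws G \<nu> \<l>" "weighted_saws G \<phi> \<l>"
    and le: "\<And>\<gamma>. \<gamma> \<in> carrier G \<Longrightarrow> \<nu> \<gamma> \<le> \<phi> \<gamma>"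
  shows "connective_constant G \<nu> \<l> \<le> connective_constant G \<phi> \<l>"
proof -
  interpret n: weighted_saws G \<nu> \<l> by fact
  interpret f: weighted_saws G \<phi> \<l> by fact
  let ?Q = "{\<pi>. saw G \<pi> \<and> hd \<pi> = \<one>\<^bsub>G\<^esub>}"
  have Q: "?Q \<subseteq> {\<pi>. saw G \<pi> \<and> hd \<pi> = \<one>\<^bsub>G\<^esub>}" "\<one>\<^bsub>G\<^esub> \<in> carrier G" by auto
  have "total_weight G \<nu> (saws G \<l> m 1) \<le> total_weight G \<phi> (saws G \<l> m 1)" for m
  proof -
    have "nsum (n.ew \<nu>) (saws G \<l> m 1) \<le> nsum (n.ew \<phi>) (saws G \<l> m 1)"
      using n.weight_functionsD(1)[OF n.\<phi>] le
      by (intro nsum_mono ennreal_leI n.walk_weight_mono) (auto simp: saws_def saw_def)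
    then have "ennreal (total_weight G \<nu> (saws G \<l> m 1)) \<le> ennreal (total_weight G \<phi> (saws G \<l> m 1))"
      unfolding n.saws_eq_window n.total_weight_window(1)[OF Q] f.total_weight_window(1)[OF Q] .
    moreover have "0 \<le> total_weight G \<phi> (saws G \<l> m 1)"
      unfolding n.saws_eq_window by (rule f.total_weight_window(2)[OF Q])
    ultimately show ?thesis by simp
  qed
  then have "limsup (\<lambda>m. ereal (root m (total_weight G \<nu> (saws G \<l> m 1)))) \<le>
      limsup (\<lambda>m. ereal (root m (total_weight G \<phi> (saws G \<l> m 1))))"
    by (intro Limsup_mono eventually_sequentiallyI[of 1]) simp
  then show ?thesis
    using n.connective_constant_limsup f.connective_constant_limsup by simp
qed

section \<open>Concatenation of bridges\<close>

text \<open>A single good value \<open>a n\<close>, iterated, already bounds all of \<open>b\<close>, so no subadditive limit theorem is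
  needed.\<close>

lemma root_lower_bound:
  fixes a b :: "nat \<Rightarrow> real"
  assumes b: "\<And>m. 0 < b m" and \<delta>: "0 < \<delta>"
    and rec: "\<And>m n. \<delta> * b m * a n \<le> b (m + n + k)"
    and z: "0 < z" "z < y" and freq: "\<exists>\<^sub>F n in sequentially. y ^ n < a n"
  shows "\<exists>C>0. \<forall>m. C * z ^ m \<le> b m"
proof -
  have yz: "1 < y / z" using z by simp
  \<comment> \<open>The drop from \<open>y\<close> to \<open>z\<close> pays for the loss
    \<open>\<delta>\<close> and the extra length \<open>k\<close> once \<open>n\<close> is
    large.\<close>
  obtain N where N: "z ^ k / \<delta> < (y / z) ^ N" using real_arch_pow[OF yz] by blast
  have "z ^ k / \<delta> \<le> (y / z) ^ n" if "N \<le> n" for n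
    using less_le_trans[OF N power_increasing[OF that less_imp_le[OF yz]]] by (rule less_imp_le)
  then have "\<forall>\<^sub>F n in sequentially. z ^ k / \<delta> \<le> (y / z) ^ n"
    by (rule eventually_sequentiallyI)
  with eventually_gt_at_top[of 0] have "\<forall>\<^sub>F n in sequentially. 0 < n \<and> z ^ k / \<delta> \<le> (y / z) ^ n"
    by eventually_elim simp
  from frequently_ex[OF frequently_eventually_conj[OF freq this]]
  obtain n where n: "y ^ n < a n" "0 < n" "z ^ k / \<delta> \<le> (y / z) ^ n" by blast
  have "z ^ (n + k) \<le> \<delta> * y ^ n"
    using n(3) z \<delta> by (simp add: field_simps power_add power_divide)
  also have "\<dots> \<le> \<delta> * a n" using n(1) \<delta> by simp
  finally have za: "z ^ (n + k) \<le> \<delta> * a n" .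
  define M where "M = n + k"
  have M: "0 < M" using n(2) by (simp add: M_def)
  have step: "z ^ M * b m \<le> b (m + M)" for m
  proof -
    have "z ^ M * b m \<le> \<delta> * a n * b m"
      using za b[of m] unfolding M_def by (intro mult_right_mono) auto
    also have "\<dots> \<le> b (m + M)" using rec[of m n] by (simp add: M_def ac_simps)
    finally show ?thesis .
  qed
  \<comment> \<open>The induction advances by \<open>M\<close>, so its base cases are the
    \<open>M\<close> smallest indices; \<open>C\<close> is the worst ratio among them.\<close>
  define C where "C = Min ((\<lambda>r. b r / z ^ r) ` {..<M})"
  have fin: "finite ((\<lambda>r. b r / z ^ r) ` {..<M})" "(\<lambda>r. b r / z ^ r) ` {..<M} \<noteq> {}"
    using M by auto
  have "0 < C" unfolding C_def using fin b z by (subst Min_gr_iff) auto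
  moreover have "C * z ^ m \<le> b m" for m
  proof (induction m rule: less_induct)
    case (less m)
    show ?case
    proof (cases "m < M")
      case True
      then have "C \<le> b m / z ^ m" unfolding C_def using fin by (intro Min_le) auto
      then show ?thesis using z by (simp add: le_divide_eq)
    next
      case False
      then obtain m' where m': "m = m' + M" by (metis add.commute le_Suc_ex not_less)
      have "C * z ^ m = z ^ M * (C * z ^ m')" by (simp add: m' power_add ac_simps)
      also have "\<dots> \<le> z ^ M * b m'" using less[of m'] m' M z by (intro mult_left_mono) auto
      also have "\<dots> \<le> b m" using step m' by simp
      finally show ?thesis .
    qed
  qed
  ultimately show ?thesis by blast
qed

context group
begin

lemma walk_weight_concat:
  assumes "p \<noteq> []" "q \<noteq> []" "last p = hd q"
  shows "walk_weight G \<psi> (p @ tl q) = walk_weight G \<psi> p * walk_weight G \<psi> q"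
proof -
  obtain u p' where p: "p = p' @ [u]" using assms(1) by (cases p rule: rev_cases) auto
  then have q: "q = u # tl q" using assms by (cases q) auto
  show ?thesis using walk_weight_append[of \<psi> p' u "tl q"] p q by simp
qed

lemma walk_length_concat:
  assumes "p \<noteq> []" "q \<noteq> []" "last p = hd q"
  shows "walk_length G \<l> (p @ tl q) = walk_length G \<l> p + walk_length G \<l> q"
proof -
  obtain u p' where p: "p = p' @ [u]" using assms(1) by (cases p rule: rev_cases) auto
  then have q: "q = u # tl q" using assms by (cases q) auto
  show ?thesis using walk_length_append[of \<l> p' u "tl q"] p q by simp
qed

lemma bridgeD:
  assumes "bridge G h \<pi>"
  shows "\<pi> \<noteq> []" "set \<pi> \<subseteq> carrier G" "distinct \<pi>" "hd \<pi> \<in> carrier G" "last \<pi> \<in> carrier G"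
    "\<And>y. y \<in> set \<pi> \<Longrightarrow> h y \<le> h (last \<pi>)"
proof -
  show *: "\<pi> \<noteq> []" "set \<pi> \<subseteq> carrier G" "distinct \<pi>"
    using assms by (auto simp: bridge_iff saw_def)
  then show "hd \<pi> \<in> carrier G" "last \<pi> \<in> carrier G" by auto
  obtain u \<tau> where \<pi>: "\<pi> = u # \<tau>" using *(1) by (cases \<pi>) auto
  have \<tau>: "h u < h y \<and> h y \<le> h (last \<pi>)" if "y \<in> set \<tau>" for y
    using assms that \<pi> by (simp add: bridge_iff)
  have "h u \<le> h (last \<pi>)"
  proof (cases "\<tau> = []")
    case False
    then show ?thesis using \<tau>[of "last \<tau>"] \<pi> by simp
  qed (simp add: \<pi>)
  then show "h y \<le> h (last \<pi>)" if "y \<in> set \<pi>" for y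
    using that \<tau> \<pi> by auto
qed

text \<open>All vertices after the joint lie strictly above \<open>last p\<close>, a highest vertex
  of \<open>p\<close>. The two pieces are therefore disjoint, and self-avoidance is
  automatic.\<close>

lemma bridge_concat:
  assumes p: "bridge G h p" and q: "bridge G h q" and eq: "last p = hd q"
  shows "bridge G h (p @ tl q)" "hd (p @ tl q) = hd p" "last (p @ tl q) = last q"
proof -
  note P = bridgeD[OF p] and Q = bridgeD[OF q]
  obtain w q' where q': "q = w # q'" using Q(1) by (cases q) auto
  have up: "h (last p) < h y \<and> h y \<le> h (last q)" if "y \<in> set (tl q)" for y
    using q that eq unfolding bridge_iff by auto
  show last: "last (p @ tl q) = last q" using q' eq by auto
  show hd: "hd (p @ tl q) = hd p" using P(1) by simp
  have "h (last p) \<le> h (last q)" using Q(6)[of "hd q"] Q(1) eq by simp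
  have "set (tl q) \<inter> set p = {}" using up P(6) by fastforce
  moreover have "set (tl q) \<subseteq> carrier G" "distinct (tl q)" using Q(2,3) q' by auto
  ultimately have "saw G (p @ tl q)" using P by (auto simp: saw_def)
  moreover have "h (hd p) < h y \<and> h y \<le> h (last q)" if "y \<in> set (tl p @ tl q)" for y
    using that up P(6)[of "hd p"] P(1) p \<open>h (last p) \<le> h (last q)\<close> unfolding bridge_iff
    by (fastforce)
  ultimately show "bridge G h (p @ tl q)"
    unfolding bridge_iff last hd using P(1) by simp
qed

text \<open>Each further vertex adds at least \<open>a\<close> to the length, so few prefixes fall
  into one window. This counts the possible positions of the joint when a concatenation is
  undone.\<close>

lemma card_prefixes_le:
  assumes \<l>: "0 < a" "\<And>\<gamma>. \<gamma> \<in> carrier G \<Longrightarrow> a \<le> \<l> \<gamma>" and \<rho>: "set \<rho> \<subseteq> carrier G"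
  shows "card {i. 1 \<le> i \<and> i \<le> length \<rho> \<and> m \<le> walk_length G \<l> (take i \<rho>) \<and>
    walk_length G \<l> (take i \<rho>) < m + c} \<le> nat \<lceil>c / a\<rceil> + 1" (is "card ?I \<le> _")
proof (cases "?I = {}")
  case False
  have fin: "finite ?I" by (rule finite_subset[of _ "{..length \<rho>}"]) auto
  define i0 where "i0 = Min ?I"
  have i0: "i0 \<in> ?I" using Min_in[OF fin False] by (simp add: i0_def)
  have "i \<le> i0 + nat \<lceil>c / a\<rceil>" if i: "i \<in> ?I" for i
  proof -
    have le: "i0 \<le> i" unfolding i0_def using fin i by (intro Min_le) auto
    \<comment> \<open>The segment between the ends of the two prefixes; starting at index
      \<open>i0 - 1\<close> it shares the joint and has \<open>i - i0\<close> steps.\<close>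
    let ?q = "drop (i0 - 1) (take i \<rho>)"
    have ne: "take i0 \<rho> \<noteq> []" "?q \<noteq> []" using i0 i le by auto
    have "take i \<rho> = take i0 \<rho> @ tl ?q"
      using le i0 i by (metis (no_types, lifting) Suc_diff_1 append_take_drop_id drop_Suc less_eq_Suc_le mem_Collect_eq min.absorb1 One_nat_def take_take tl_drop)
    moreover have "last (take i0 \<rho>) = \<rho> ! (i0 - 1)" "hd ?q = \<rho> ! (i0 - 1)"
      using i0 i le by (subst last_conv_nth, auto, subst hd_drop_conv_nth, auto)
    ultimately have "walk_length G \<l> (take i \<rho>) = walk_length G \<l> (take i0 \<rho>) + walk_length G \<l> ?q"
      using walk_length_concat[OF ne] by metis
    moreover have "a * real (length ?q - 1) \<le> walk_length G \<l> ?q"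
      using \<rho> by (intro walk_length_ge \<l>) (auto dest: in_set_dropD in_set_takeD)
    moreover have "length ?q - 1 = i - i0" using i0 i le by auto
    ultimately have "a * real (i - i0) < c" using i0 i by auto
    then have "real (i - i0) < c / a" using \<l>(1) by (simp add: field_simps)
    then have "i - i0 \<le> nat \<lceil>c / a\<rceil>" by linarith
    then show ?thesis by simp
  qed
  then have "?I \<subseteq> {i0..i0 + nat \<lceil>c / a\<rceil>}"
    unfolding i0_def using fin by (auto intro: Min_le)
  then have "card ?I \<le> card {i0..i0 + nat \<lceil>c / a\<rceil>}" by (intro card_mono) auto
  then show ?thesis by simp
next
  case True
  show ?thesis unfolding True by simp
qed

end

text \<open>Invariance under \<open>H\<close> leaves only the finitely many vertices of
  \<open>R\<close>, and monotonicity allows the maximum of their bounds.\<close>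

lemma (in coset_transversal) uniform_bound:
  assumes ex: "\<And>v. v \<in> carrier G \<Longrightarrow> \<exists>N. P v N"
    and mono: "\<And>v N M. P v N \<Longrightarrow> N \<le> M \<Longrightarrow> P v M"
    and inv: "\<And>\<alpha> v N. \<alpha> \<in> H \<Longrightarrow> v \<in> carrier G \<Longrightarrow> P v N \<Longrightarrow> P (\<alpha> \<otimes> v) N"
  shows "\<exists>N :: nat. \<forall>v\<in>carrier G. P v N"
proof -
  obtain N where N: "\<And>v. v \<in> carrier G \<Longrightarrow> P v (N v)" using ex by metis
  have "P v (Max (N ` R))" if v: "v \<in> carrier G" for v
  proof -
    obtain \<alpha> r where r: "\<alpha> \<in> H" "r \<in> R" "v = \<alpha> \<otimes> r" using R_cover[OF v] by blast
    then have "r \<in> carrier G" using R_carrier by blast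
    moreover have "N r \<le> Max (N ` R)" using r(2) R_finite by (intro Max_ge) auto
    ultimately show ?thesis using mono N inv r by blast
  qed
  then show ?thesis by blast
qed

lemma inverse_Suc_mono: "N \<le> M \<Longrightarrow> 1 / real (Suc M) \<le> 1 / real (Suc N)"
  by (rule divide_left_mono) simp_all

section \<open>Connecting bridges of uniformly bounded cost\<close>

locale weighted_bridges = coset_transversal G H R + weighted_saws G \<phi> \<l>
  for G :: "('a, 'b) monoid_scheme" (structure) and H R \<phi> \<l> +
  fixes h :: "'a \<Rightarrow> int"
  assumes h: "invariant_height h"
    and down: "\<And>v. v \<in> carrier G \<Longrightarrow> \<exists>u. weight_adj G \<phi> v u \<and> h u < h v"
    and up: "\<And>v. v \<in> carrier G \<Longrightarrow> \<exists>w. weight_adj G \<phi> v w \<and> h v < h w"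
begin

lemma weight_adj_iff:
  "weight_adj G \<phi> u v \<longleftrightarrow> u \<in> carrier G \<and> v \<in> carrier G \<and> 0 < \<phi> (inv u \<otimes> v)"
  by (auto simp: weight_adj_def weight_support_def)

lemma weight_adj_sym: "weight_adj G \<phi> u v \<Longrightarrow> weight_adj G \<phi> v u"
  using weight_functionsD(2)[OF \<phi>, of "inv u \<otimes> v"]
  by (auto simp: weight_adj_iff inv_mult_group)

lemma weight_adj_translate:
  assumes "\<alpha> \<in> carrier G" "weight_adj G \<phi> u v"
  shows "weight_adj G \<phi> (\<alpha> \<otimes> u) (\<alpha> \<otimes> v)"
  using assms steps_translate[of \<alpha> "[u, v]"] by (simp add: weight_adj_iff)

text \<open>A relation restricted to \<open>S\<close>, so that paths confined to a height range are
  expressed by its reflexive transitive closure.\<close>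

definition edges :: "'a set \<Rightarrow> ('a \<times> 'a) set" where
  "edges S = {(u, v). u \<in> S \<and> v \<in> S \<and> weight_adj G \<phi> u v}"

lemma edges_rtrancl_mono: "S \<subseteq> T \<Longrightarrow> (u, v) \<in> (edges S)\<^sup>* \<Longrightarrow> (u, v) \<in> (edges T)\<^sup>*"
  by (erule rtrancl_mono[THEN subsetD, rotated]) (auto simp: edges_def)

lemma edges_rtrancl_in: "(u, v) \<in> (edges S)\<^sup>* \<Longrightarrow> v = u \<or> v \<in> S"
  by (erule rtranclE) (auto simp: edges_def)

lemma edges_translate:
  assumes "(u, v) \<in> (edges S)\<^sup>*" "\<alpha> \<in> carrier G" "\<And>w. w \<in> S \<Longrightarrow> \<alpha> \<otimes> w \<in> T"
  shows "(\<alpha> \<otimes> u, \<alpha> \<otimes> v) \<in> (edges T)\<^sup>*"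
  using assms(1)
proof (induction rule: rtrancl_induct)
  case (step v w)
  then have "(\<alpha> \<otimes> v, \<alpha> \<otimes> w) \<in> edges T"
    using assms(2,3) weight_adj_translate by (auto simp: edges_def)
  with step show ?case by simp
qed simp

text \<open>Loop erasure along the path: if the next vertex was visited before, the walk is cut back
  to that visit, otherwise the vertex is appended. Neither leaves \<open>S\<close> nor creates new
  steps of zero weight.\<close>

lemma loop_erased_path:
  assumes "(u, v) \<in> (edges S)\<^sup>*" "u \<in> S"
  shows "\<exists>\<pi>. \<pi> \<noteq> [] \<and> distinct \<pi> \<and> set \<pi> \<subseteq> S \<and> hd \<pi> = u \<and> last \<pi> = v \<and> (\<forall>s\<in>set (steps \<pi>). 0 < \<phi> s)"
  using assms(1)
proof (induction rule: rtrancl_induct)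
  case base
  then show ?case using assms(2) by (intro exI[of _ "[u]"]) simp
next
  case (step v w)
  then obtain \<pi> where \<pi>: "\<pi> \<noteq> []" "distinct \<pi>" "set \<pi> \<subseteq> S" "hd \<pi> = u" "last \<pi> = v"
    "\<forall>s\<in>set (steps \<pi>). 0 < \<phi> s" by blast
  have w: "w \<in> S" "0 < \<phi> (inv v \<otimes> w)" using step(2) by (auto simp: edges_def weight_adj_iff)
  show ?case
  proof (cases "w \<in> set \<pi>")
    case True
    then obtain p q where pq: "\<pi> = p @ w # q" by (meson split_list)
    then have "set (steps (p @ [w])) \<subseteq> set (steps \<pi>)" by (subst pq, subst steps_append) auto
    moreover have "hd (p @ [w]) = u" using \<pi>(4) pq by (cases p) auto
    ultimately show ?thesis using \<pi> pq by (intro exI[of _ "p @ [w]"]) auto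
  next
    case False
    obtain \<rho> where "\<pi> = \<rho> @ [v]" using \<pi>(1,5) by (metis append_butlast_last_id)
    then have "steps (\<pi> @ [w]) = steps \<pi> @ [inv v \<otimes> w]" using steps_append[of \<rho> v "[w]"] by simp
    then show ?thesis using \<pi> w False by (intro exI[of _ "\<pi> @ [w]"]) auto
  qed
qed

lemma connected:
  assumes u: "u \<in> carrier G" and v: "v \<in> carrier G"
  shows "(u, v) \<in> (edges (carrier G))\<^sup>*"
proof -
  have adj: "(u, u \<otimes> g) \<in> (edges (carrier G))\<^sup>*"
    if "u \<in> carrier G" "g \<in> carrier G" "0 < \<phi> g" for u g
    using that by (intro r_into_rtrancl) (simp add: edges_def weight_adj_iff)
  have "\<forall>u\<in>carrier G. (u, u \<otimes> g) \<in> (edges (carrier G))\<^sup>*"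
    if "g \<in> generate G (weight_support G \<phi>)" for g
    using that
  proof (induction rule: generate.induct)
    case (incl g)
    then show ?case using adj by (auto simp: weight_support_def)
  next
    case (inv g)
    then show ?case using adj weight_functionsD(2)[OF \<phi>] by (auto simp: weight_support_def)
  next
    case (eng g1 g2)
    have "weight_support G \<phi> \<subseteq> carrier G" by (auto simp: weight_support_def)
    then have g: "g1 \<in> carrier G" "g2 \<in> carrier G"
      using eng(1,2) generate_in_carrier by blast+
    show ?case
    proof
      fix u assume u: "u \<in> carrier G"
      have "(u, u \<otimes> g1) \<in> (edges (carrier G))\<^sup>*" using eng(3) u by blast
      also have "(u \<otimes> g1, u \<otimes> g1 \<otimes> g2) \<in> (edges (carrier G))\<^sup>*" using eng(4) u g by blast
      finally show "(u, u \<otimes> (g1 \<otimes> g2)) \<in> (edges (carrier G))\<^sup>*" using u g by (simp add: m_assoc)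
    qed
  qed simp
  moreover have "inv u \<otimes> v \<in> generate G (weight_support G \<phi>)"
    using \<phi> u v by (simp add: weight_functions_def)
  ultimately have "(u, u \<otimes> (inv u \<otimes> v)) \<in> (edges (carrier G))\<^sup>*" using u by blast
  then show ?thesis using u v by simp
qed

definition near :: "'a \<Rightarrow> nat \<Rightarrow> 'a set" where
  "near u D = {w \<in> carrier G. \<bar>h w - h u\<bar> \<le> int D}"

lemma near_mono: "D \<le> E \<Longrightarrow> near u D \<subseteq> near u E"
  by (auto simp: near_def)

lemma near_translate:
  assumes "\<alpha> \<in> H" "u \<in> carrier G" "w \<in> near u D"
  shows "\<alpha> \<otimes> w \<in> near (\<alpha> \<otimes> u) D"
  using assms invariant_heightD[OF h assms(1,2), of w] H_carrier by (auto simp: near_def)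

lemma connected_near:
  assumes "u \<in> carrier G" "v \<in> carrier G"
  shows "\<exists>D. (u, v) \<in> (edges (near u D))\<^sup>*"
  using connected[OF assms]
proof (induction rule: rtrancl_induct)
  case (step v w)
  then obtain D where D: "(u, v) \<in> (edges (near u D))\<^sup>*" by blast
  define E where "E = D + nat \<bar>h v - h u\<bar> + nat \<bar>h w - h u\<bar>"
  have "(u, v) \<in> (edges (near u E))\<^sup>*"
    by (rule edges_rtrancl_mono[OF near_mono D]) (simp add: E_def)
  moreover have "(v, w) \<in> edges (near u E)"
    using step(2) by (auto simp: edges_def near_def E_def)
  ultimately show ?case by (intro exI[of _ E]) simp
qed auto

text \<open>One strip width serves all pairs, at the price of reaching only some
  \<open>H\<close>-translate of \<open>v\<close>. This freedom makes the property invariant in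
  \<open>u\<close> and lets \<open>v\<close> be replaced by its representative, so only finitely
  many pairs remain.\<close>

lemma connected_near_uniform:
  "\<exists>D. \<forall>u\<in>carrier G. \<forall>v\<in>carrier G. \<exists>\<alpha>\<in>H. (u, \<alpha> \<otimes> v) \<in> (edges (near u D))\<^sup>*"
proof -
  have "\<exists>D. \<forall>u\<in>carrier G. \<forall>r\<in>R. \<exists>\<alpha>\<in>H. (u, \<alpha> \<otimes> r) \<in> (edges (near u D))\<^sup>*"
  proof (rule uniform_bound)
    fix u assume u: "u \<in> carrier G"
    obtain D where D: "\<And>r. r \<in> R \<Longrightarrow> (u, r) \<in> (edges (near u (D r)))\<^sup>*"
      using connected_near[OF u] R_carrier by (metis subsetD)
    have "(u, \<one> \<otimes> r) \<in> (edges (near u (Max (D ` R))))\<^sup>*" if "r \<in> R" for r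
    proof -
      have "D r \<le> Max (D ` R)" using R_finite that by (intro Max_ge) auto
      then show ?thesis using edges_rtrancl_mono[OF near_mono D[OF that]] R_carrier that by auto
    qed
    then show "\<exists>N. \<forall>r\<in>R. \<exists>\<alpha>\<in>H. (u, \<alpha> \<otimes> r) \<in> (edges (near u N))\<^sup>*"
      using subgroup.one_closed[OF H_subgroup] by blast
  next
    fix u N M assume "\<forall>r\<in>R. \<exists>\<alpha>\<in>H. (u, \<alpha> \<otimes> r) \<in> (edges (near u N))\<^sup>*" "N \<le> M"
    then show "\<forall>r\<in>R. \<exists>\<alpha>\<in>H. (u, \<alpha> \<otimes> r) \<in> (edges (near u M))\<^sup>*"
      using edges_rtrancl_mono[OF near_mono] by blast
  next
    fix \<alpha> u N assume \<alpha>: "\<alpha> \<in> H" "u \<in> carrier G"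
      and *: "\<forall>r\<in>R. \<exists>\<alpha>\<in>H. (u, \<alpha> \<otimes> r) \<in> (edges (near u N))\<^sup>*"
    show "\<forall>r\<in>R. \<exists>\<beta>\<in>H. (\<alpha> \<otimes> u, \<beta> \<otimes> r) \<in> (edges (near (\<alpha> \<otimes> u) N))\<^sup>*"
    proof
      fix r assume r: "r \<in> R"
      then obtain \<beta> where \<beta>: "\<beta> \<in> H" "(u, \<beta> \<otimes> r) \<in> (edges (near u N))\<^sup>*" using * by blast
      have "(\<alpha> \<otimes> u, \<alpha> \<otimes> (\<beta> \<otimes> r)) \<in> (edges (near (\<alpha> \<otimes> u) N))\<^sup>*"
        using near_translate[OF \<alpha>] H_carrier \<alpha>(1) by (intro edges_translate[OF \<beta>(2)]) auto
      moreover have "\<alpha> \<otimes> (\<beta> \<otimes> r) = (\<alpha> \<otimes> \<beta>) \<otimes> r"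
        using \<alpha>(1) \<beta>(1) r H_carrier R_carrier by (simp add: m_assoc subset_eq)
      moreover have "\<alpha> \<otimes> \<beta> \<in> H" using subgroup.m_closed[OF H_subgroup \<alpha>(1) \<beta>(1)] .
      ultimately show "\<exists>\<beta>\<in>H. (\<alpha> \<otimes> u, \<beta> \<otimes> r) \<in> (edges (near (\<alpha> \<otimes> u) N))\<^sup>*" by auto
    qed
  qed
  then obtain D where D: "\<And>u r. u \<in> carrier G \<Longrightarrow> r \<in> R \<Longrightarrow>
    \<exists>\<alpha>\<in>H. (u, \<alpha> \<otimes> r) \<in> (edges (near u D))\<^sup>*" by blast
  have "\<exists>\<alpha>\<in>H. (u, \<alpha> \<otimes> v) \<in> (edges (near u D))\<^sup>*" if u: "u \<in> carrier G" and v: "v \<in> carrier G" for u v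
  proof -
    obtain \<beta> where \<beta>: "\<beta> \<in> H" "(u, \<beta> \<otimes> rep v) \<in> (edges (near u D))\<^sup>*"
      using D[OF u rep_shift(1)[OF v]] by blast
    have "\<beta> \<otimes> rep v = (\<beta> \<otimes> inv (shift v)) \<otimes> v"
      using inv_shift[OF v] rep_shift(2)[OF v] \<beta>(1) H_carrier v by (simp add: m_assoc)
    moreover have "\<beta> \<otimes> inv (shift v) \<in> H"
      using subgroup.m_closed[OF H_subgroup \<beta>(1) H_inv[OF rep_shift(2)[OF v]]] .
    ultimately show ?thesis using \<beta>(2) by auto
  qed
  then show ?thesis by blast
qed

text \<open>Iterated up-steps, each gaining at least 1 as heights are integers. The vertex set
  already has the shape of the bridge condition, with \<open>u\<close> exempt from
  strictness.\<close>

lemma ascent: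
  assumes u: "u \<in> carrier G"
  shows "\<exists>x\<in>carrier G. h u + int n \<le> h x \<and>
    (u, x) \<in> (edges {w \<in> carrier G. (w = u \<or> h u < h w) \<and> h w \<le> h x})\<^sup>*"
proof (induction n)
  case 0
  then show ?case using u by auto
next
  case (Suc n)
  then obtain x where x: "x \<in> carrier G" "h u + int n \<le> h x"
    "(u, x) \<in> (edges {w \<in> carrier G. (w = u \<or> h u < h w) \<and> h w \<le> h x})\<^sup>*" by blast
  obtain y where y: "weight_adj G \<phi> x y" "h x < h y" using up[OF x(1)] by blast
  let ?S = "{w \<in> carrier G. (w = u \<or> h u < h w) \<and> h w \<le> h y}"
  have "(u, x) \<in> (edges ?S)\<^sup>*" by (rule edges_rtrancl_mono[OF _ x(3)]) (use y in auto)
  moreover have "x = u \<or> h u < h x" using edges_rtrancl_in[OF x(3)] by auto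
  then have "(x, y) \<in> edges ?S"
    using x(1,2) y by (auto simp: edges_def weight_adj_iff)
  ultimately have "(u, y) \<in> (edges ?S)\<^sup>*" by simp
  then show ?case using x(2) y by (intro bexI[of _ y]) (auto simp: weight_adj_iff)
qed

text \<open>Found by going down from \<open>v\<close>, but recorded as a path up to
  \<open>v\<close>; symmetry of adjacency reverses the steps.\<close>

lemma descent:
  assumes v: "v \<in> carrier G"
  shows "\<exists>y\<in>carrier G. h y + int n \<le> h v \<and>
    (y, v) \<in> (edges {w \<in> carrier G. h y \<le> h w \<and> h w \<le> h v})\<^sup>*"
proof (induction n)
  case 0
  then show ?case using v by auto
next
  case (Suc n)
  then obtain x where x: "x \<in> carrier G" "h x + int n \<le> h v"
    "(x, v) \<in> (edges {w \<in> carrier G. h x \<le> h w \<and> h w \<le> h v})\<^sup>*" by blast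
  obtain y where y: "weight_adj G \<phi> x y" "h y < h x" using down[OF x(1)] by blast
  let ?S = "{w \<in> carrier G. h y \<le> h w \<and> h w \<le> h v}"
  have "(x, v) \<in> (edges ?S)\<^sup>*" by (rule edges_rtrancl_mono[OF _ x(3)]) (use y in auto)
  moreover have "(y, x) \<in> edges ?S"
    using x(1,2) y weight_adj_sym[OF y(1)] by (auto simp: edges_def weight_adj_iff)
  ultimately have "(y, v) \<in> (edges ?S)\<^sup>*" by (rule converse_rtrancl_into_rtrancl[rotated])
  then show ?case using x(2) y by (intro bexI[of _ y]) (auto simp: weight_adj_iff)
qed

text \<open>Climb from \<open>u\<close>, change coset while staying in a strip of bounded height, and climb to a
  translate of \<open>v\<close>: if both climbs are long compared to the strip, the loop erasure is a bridge.\<close>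

lemma connecting_bridge:
  assumes u: "u \<in> carrier G" and v: "v \<in> carrier G"
  shows "\<exists>\<alpha>\<in>H. \<exists>\<pi>. bridge G h \<pi> \<and> hd \<pi> = u \<and> last \<pi> = \<alpha> \<otimes> v \<and> 0 < walk_weight G \<phi> \<pi>"
proof -
  obtain D where D: "\<And>u v. u \<in> carrier G \<Longrightarrow> v \<in> carrier G \<Longrightarrow>
    \<exists>\<alpha>\<in>H. (u, \<alpha> \<otimes> v) \<in> (edges (near u D))\<^sup>*" using connected_near_uniform by blast
  \<comment> \<open>\<open>D + 1\<close> keeps the strip of half-width \<open>D\<close> around
    \<open>x\<close> strictly above \<open>u\<close>.\<close>
  obtain x where x: "x \<in> carrier G" "h u + int (D + 1) \<le> h x"
    "(u, x) \<in> (edges {w \<in> carrier G. (w = u \<or> h u < h w) \<and> h w \<le> h x})\<^sup>*"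
    using ascent[OF u] by blast
  \<comment> \<open>The translate of \<open>y\<close> may lie as low as \<open>h x - D\<close>, and
    the end has to reach the top \<open>h x + D\<close> of the strip.\<close>
  obtain y where y: "y \<in> carrier G" "h y + int (2 * D) \<le> h v"
    "(y, v) \<in> (edges {w \<in> carrier G. h y \<le> h w \<and> h w \<le> h v})\<^sup>*"
    using descent[OF v] by blast
  obtain \<alpha> where \<alpha>: "\<alpha> \<in> H" "(x, \<alpha> \<otimes> y) \<in> (edges (near x D))\<^sup>*" using D[OF x(1) y(1)] by blast
  have \<alpha>': "\<alpha> \<in> carrier G" using H_carrier[OF \<alpha>(1)] .
  have hv: "h (\<alpha> \<otimes> v) = h (\<alpha> \<otimes> y) + h v - h y" by (rule invariant_heightD[OF h \<alpha>(1) y(1) v])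
  have hy: "\<bar>h (\<alpha> \<otimes> y) - h x\<bar> \<le> int D"
    using edges_rtrancl_in[OF \<alpha>(2)] by (auto simp: near_def)
  let ?S = "{w \<in> carrier G. (w = u \<or> h u < h w) \<and> h w \<le> h (\<alpha> \<otimes> v)}"
  have "(u, x) \<in> (edges ?S)\<^sup>*"
    by (rule edges_rtrancl_mono[OF _ x(3)]) (use hv hy y(2) in auto)
  also have "(x, \<alpha> \<otimes> y) \<in> (edges ?S)\<^sup>*"
    by (rule edges_rtrancl_mono[OF _ \<alpha>(2)]) (use hv hy y(2) x(2) in \<open>auto simp: near_def\<close>)
  also have "(\<alpha> \<otimes> y, \<alpha> \<otimes> v) \<in> (edges ?S)\<^sup>*"
  proof (rule edges_translate[OF y(3) \<alpha>'])
    fix w assume "w \<in> {w \<in> carrier G. h y \<le> h w \<and> h w \<le> h v}"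
    then show "\<alpha> \<otimes> w \<in> ?S"
      using invariant_heightD[OF h \<alpha>(1) y(1), of w] \<alpha>' hv hy x(2) by auto
  qed
  finally have reach: "(u, \<alpha> \<otimes> v) \<in> (edges ?S)\<^sup>*" .
  have "u \<in> ?S" using u hv hy y(2) x(2) by simp
  from loop_erased_path[OF reach this] obtain \<pi> where \<pi>: "\<pi> \<noteq> []" "distinct \<pi>" "set \<pi> \<subseteq> ?S"
    "hd \<pi> = u" "last \<pi> = \<alpha> \<otimes> v" "\<forall>s\<in>set (steps \<pi>). 0 < \<phi> s" by blast
  obtain \<tau> where \<tau>: "\<pi> = u # \<tau>" using \<pi>(1,4) by (cases \<pi>) auto
  have "bridge G h \<pi>"
    unfolding bridge_iff saw_def using \<pi> \<tau> by auto
  moreover have "0 < walk_weight G \<phi> \<pi>"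
  proof -
    have "0 < prod_list (map \<phi> xs)" if "\<forall>s\<in>set xs. 0 < \<phi> s" for xs
      using that by (induction xs) auto
    then show ?thesis using \<pi>(6) by (simp add: walk_weight_steps)
  qed
  ultimately show ?thesis using \<pi>(4,5) \<alpha>(1) by blast
qed

text \<open>One natural number \<open>N\<close> encodes both the lower bound on the weight and the
  upper bound on the length, the form in which \<open>uniform_bound\<close> applies.\<close>

lemma connecting_bridge_uniform:
  "\<exists>N :: nat. \<forall>u\<in>carrier G. \<forall>v\<in>carrier G. \<exists>\<alpha>\<in>H. \<exists>\<pi>. bridge G h \<pi> \<and> hd \<pi> = u \<and> last \<pi> = \<alpha> \<otimes> v \<and>
     1 / real (Suc N) \<le> walk_weight G \<phi> \<pi> \<and> walk_length G \<l> \<pi> \<le> real N"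
proof -
  define C where "C u r N \<longleftrightarrow> (\<exists>\<alpha>\<in>H. \<exists>\<pi>. bridge G h \<pi> \<and> hd \<pi> = u \<and> last \<pi> = \<alpha> \<otimes> r \<and>
     1 / real (Suc N) \<le> walk_weight G \<phi> \<pi> \<and> walk_length G \<l> \<pi> \<le> real N)" for u r N
  have mono: "C u r M" if C: "C u r N" and NM: "N \<le> M" for u r N M
  proof -
    obtain \<alpha> \<pi> where *: "\<alpha> \<in> H" "bridge G h \<pi>" "hd \<pi> = u" "last \<pi> = \<alpha> \<otimes> r"
      "1 / real (Suc N) \<le> walk_weight G \<phi> \<pi>" "walk_length G \<l> \<pi> \<le> real N"
      using C unfolding C_def by blast
    have "1 / real (Suc M) \<le> walk_weight G \<phi> \<pi>"
      using inverse_Suc_mono[OF NM] *(5) by (rule order_trans)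
    moreover have "walk_length G \<l> \<pi> \<le> real M" using *(6) NM by simp
    ultimately show ?thesis using *(1-4) unfolding C_def by blast
  qed
  have ex: "\<exists>N. C u v N" if uv: "u \<in> carrier G" "v \<in> carrier G" for u v
  proof -
    obtain \<alpha> \<pi> where \<pi>: "\<alpha> \<in> H" "bridge G h \<pi>" "hd \<pi> = u" "last \<pi> = \<alpha> \<otimes> v" "0 < walk_weight G \<phi> \<pi>"
      using connecting_bridge[OF uv] by blast
    obtain N1 where N1: "inverse (real (Suc N1)) < walk_weight G \<phi> \<pi>"
      using reals_Archimedean[OF \<pi>(5)] by blast
    obtain N2 where N2: "walk_length G \<l> \<pi> \<le> real N2" using real_arch_simple by blast
    let ?N = "max N1 N2"
    have "1 / real (Suc ?N) \<le> 1 / real (Suc N1)" by (rule inverse_Suc_mono) simp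
    then have "1 / real (Suc ?N) \<le> walk_weight G \<phi> \<pi>" using N1 by (simp add: inverse_eq_divide)
    moreover have "walk_length G \<l> \<pi> \<le> real ?N" using N2 by simp
    ultimately show ?thesis unfolding C_def using \<pi> by blast
  qed
  have "\<exists>N. \<forall>u\<in>carrier G. \<forall>r\<in>R. C u r N"
  proof (rule uniform_bound)
    fix u assume u: "u \<in> carrier G"
    obtain N where N: "\<And>r. r \<in> R \<Longrightarrow> C u r (N r)" using ex[OF u] R_carrier by (metis subsetD)
    have "C u r (Max (N ` R))" if "r \<in> R" for r
      using that R_finite by (intro mono[OF N[OF that]] Max_ge) auto
    then show "\<exists>N. \<forall>r\<in>R. C u r N" by blast
  next
    fix u N M assume "\<forall>r\<in>R. C u r N" "N \<le> M"
    then show "\<forall>r\<in>R. C u r M" using mono by blast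
  next
    fix \<alpha> u N assume \<alpha>: "\<alpha> \<in> H" "u \<in> carrier G" and *: "\<forall>r\<in>R. C u r N"
    have \<alpha>': "\<alpha> \<in> carrier G" using H_carrier[OF \<alpha>(1)] .
    show "\<forall>r\<in>R. C (\<alpha> \<otimes> u) r N"
    proof
      fix r assume r: "r \<in> R"
      then obtain \<beta> \<pi> where \<pi>: "\<beta> \<in> H" "bridge G h \<pi>" "hd \<pi> = u" "last \<pi> = \<beta> \<otimes> r"
        "1 / real (Suc N) \<le> walk_weight G \<phi> \<pi>" "walk_length G \<l> \<pi> \<le> real N"
        using * unfolding C_def by blast
      note \<pi>' = bridgeD[OF \<pi>(2)]
      have "last (map ((\<otimes>) \<alpha>) \<pi>) = (\<alpha> \<otimes> \<beta>) \<otimes> r"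
        using \<pi>(1,4) \<pi>' \<alpha>' r R_carrier H_carrier by (auto simp: last_map m_assoc)
      moreover have "\<alpha> \<otimes> \<beta> \<in> H" using subgroup.m_closed[OF H_subgroup \<alpha>(1) \<pi>(1)] .
      moreover have "bridge G h (map ((\<otimes>) \<alpha>) \<pi>)" by (rule bridge_translate[OF h \<alpha>(1) \<pi>(2)])
      moreover have "hd (map ((\<otimes>) \<alpha>) \<pi>) = \<alpha> \<otimes> u" using \<pi>(3) \<pi>' by (simp add: hd_map)
      ultimately show "C (\<alpha> \<otimes> u) r N"
        unfolding C_def using \<pi>(5,6) \<alpha>' \<pi>'(2)
        by (intro bexI[of _ "\<alpha> \<otimes> \<beta>"] exI[of _ "map ((\<otimes>) \<alpha>) \<pi>"])
           (auto simp: walk_weight_translate walk_length_translate)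
    qed
  qed
  then obtain N where N: "\<And>u r. u \<in> carrier G \<Longrightarrow> r \<in> R \<Longrightarrow> C u r N" by blast
  have "C u v N" if u: "u \<in> carrier G" and v: "v \<in> carrier G" for u v
  proof -
    have "\<beta> \<otimes> rep v = (\<beta> \<otimes> inv (shift v)) \<otimes> v \<and> \<beta> \<otimes> inv (shift v) \<in> H" if "\<beta> \<in> H" for \<beta>
      using inv_shift[OF v] rep_shift(2)[OF v] that H_carrier v
        subgroup.m_closed[OF H_subgroup that H_inv[OF rep_shift(2)[OF v]]] by (simp add: m_assoc)
    then show ?thesis
      using N[OF u rep_shift(1)[OF v]] unfolding C_def by metis
  qed
  then show ?thesis unfolding C_def by blast
qed

lemma up_uniform:
  "\<exists>N :: nat. \<forall>v\<in>carrier G. \<exists>w\<in>carrier G. h v < h w \<and> 1 / real (Suc N) \<le> \<phi> (inv v \<otimes> w) \<and>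
     \<l> (inv v \<otimes> w) \<le> real N"
proof (rule uniform_bound)
  fix v assume "v \<in> carrier G"
  then obtain w where w: "w \<in> carrier G" "h v < h w" "0 < \<phi> (inv v \<otimes> w)"
    using up by (auto simp: weight_adj_iff)
  obtain N1 where N1: "inverse (real (Suc N1)) < \<phi> (inv v \<otimes> w)"
    using reals_Archimedean[OF w(3)] by blast
  obtain N2 where N2: "\<l> (inv v \<otimes> w) \<le> real N2" using real_arch_simple by blast
  let ?N = "max N1 N2"
  have "1 / real (Suc ?N) \<le> 1 / real (Suc N1)" by (rule inverse_Suc_mono) simp
  then have "1 / real (Suc ?N) \<le> \<phi> (inv v \<otimes> w)" using N1 by (simp add: inverse_eq_divide)
  moreover have "\<l> (inv v \<otimes> w) \<le> real ?N" using N2 by simp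
  ultimately show "\<exists>N. \<exists>w\<in>carrier G. h v < h w \<and> 1 / real (Suc N) \<le> \<phi> (inv v \<otimes> w) \<and>
     \<l> (inv v \<otimes> w) \<le> real N" using w by blast
next
  fix v and N M :: nat
  assume "\<exists>w\<in>carrier G. h v < h w \<and> 1 / real (Suc N) \<le> \<phi> (inv v \<otimes> w) \<and> \<l> (inv v \<otimes> w) \<le> real N"
    and NM: "N \<le> M"
  then obtain w where w: "w \<in> carrier G" "h v < h w" "1 / real (Suc N) \<le> \<phi> (inv v \<otimes> w)"
    "\<l> (inv v \<otimes> w) \<le> real N" by blast
  have "1 / real (Suc M) \<le> \<phi> (inv v \<otimes> w)" using inverse_Suc_mono[OF NM] w(3) by (rule order_trans)
  moreover have "\<l> (inv v \<otimes> w) \<le> real M" using w(4) NM by simp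
  ultimately show "\<exists>w\<in>carrier G. h v < h w \<and> 1 / real (Suc M) \<le> \<phi> (inv v \<otimes> w) \<and> \<l> (inv v \<otimes> w) \<le> real M"
    using w by blast
next
  fix \<alpha> v N assume \<alpha>: "\<alpha> \<in> H" "v \<in> carrier G"
    and "\<exists>w\<in>carrier G. h v < h w \<and> 1 / real (Suc N) \<le> \<phi> (inv v \<otimes> w) \<and> \<l> (inv v \<otimes> w) \<le> real N"
  then obtain w where w: "w \<in> carrier G" "h v < h w" "1 / real (Suc N) \<le> \<phi> (inv v \<otimes> w)"
    "\<l> (inv v \<otimes> w) \<le> real N" by blast
  have \<alpha>': "\<alpha> \<in> carrier G" using H_carrier[OF \<alpha>(1)] .
  have "inv (\<alpha> \<otimes> v) \<otimes> (\<alpha> \<otimes> w) = inv v \<otimes> w"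
    using steps_translate[OF \<alpha>', of "[v, w]"] \<alpha>(2) w(1) by simp
  then show "\<exists>w\<in>carrier G. h (\<alpha> \<otimes> v) < h w \<and> 1 / real (Suc N) \<le> \<phi> (inv (\<alpha> \<otimes> v) \<otimes> w) \<and>
      \<l> (inv (\<alpha> \<otimes> v) \<otimes> w) \<le> real N"
    using invariant_heightD[OF h \<alpha> w(1)] w \<alpha>' by (intro bexI[of _ "\<alpha> \<otimes> w"]) auto
qed

section \<open>Prolonging and joining bridges within length windows\<close>

primrec extend :: "('a \<Rightarrow> 'a) \<Rightarrow> 'a list \<Rightarrow> nat \<Rightarrow> 'a list" where
  "extend f \<pi> 0 = \<pi>"
| "extend f \<pi> (Suc j) = extend f \<pi> j @ [f (last (extend f \<pi> j))]"

lemma length_extend [simp]: "length (extend f \<pi> j) = length \<pi> + j"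
  by (induction j) auto

lemma take_extend [simp]: "take (length \<pi>) (extend f \<pi> j) = \<pi>"
  by (induction j) auto

context
  fixes f :: "'a \<Rightarrow> 'a" and N :: nat and a :: real
  assumes f: "\<And>v. v \<in> carrier G \<Longrightarrow> f v \<in> carrier G \<and> h v < h (f v) \<and>
      1 / real (Suc N) \<le> \<phi> (inv v \<otimes> f v) \<and> \<l> (inv v \<otimes> f v) \<le> real N"
    and a: "0 < a" "\<And>\<gamma>. \<gamma> \<in> carrier G \<Longrightarrow> a \<le> \<l> \<gamma>"
begin

lemma bridge_snoc:
  assumes \<pi>: "bridge G h \<pi>"
  defines "\<rho> \<equiv> \<pi> @ [f (last \<pi>)]"
  shows "bridge G h \<rho>" "hd \<rho> = hd \<pi>"
    "walk_weight G \<phi> \<pi> / real (Suc N) \<le> walk_weight G \<phi> \<rho>"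
    "walk_length G \<l> \<pi> + a \<le> walk_length G \<l> \<rho>" "walk_length G \<l> \<rho> \<le> walk_length G \<l> \<pi> + real N"
proof -
  note P = bridgeD[OF \<pi>]
  let ?u = "last \<pi>"
  note fu = f[OF P(5)]
  have "?u \<noteq> f ?u" using fu by (metis less_irrefl)
  then have q: "bridge G h [?u, f ?u]" using fu P(5) by (simp add: bridge_iff saw_def)
  have \<rho>: "\<rho> = \<pi> @ tl [?u, f ?u]" by (simp add: \<rho>_def)
  show "bridge G h \<rho>" "hd \<rho> = hd \<pi>"
    unfolding \<rho> using bridge_concat[OF \<pi> q] by simp_all
  have w: "walk_weight G \<phi> \<rho> = walk_weight G \<phi> \<pi> * \<phi> (inv ?u \<otimes> f ?u)"
    unfolding \<rho> using P(1) by (subst walk_weight_concat) (simp_all add: walk_weight_Cons)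
  have "0 \<le> walk_weight G \<phi> \<pi>"
    using P(2) weight_functionsD(1)[OF \<phi>] by (intro walk_weight_nonneg) auto
  then have "walk_weight G \<phi> \<pi> * (1 / real (Suc N)) \<le> walk_weight G \<phi> \<rho>"
    unfolding w using fu by (intro mult_left_mono) auto
  then show "walk_weight G \<phi> \<pi> / real (Suc N) \<le> walk_weight G \<phi> \<rho>" by simp
  have l: "walk_length G \<l> \<rho> = walk_length G \<l> \<pi> + \<l> (inv ?u \<otimes> f ?u)"
    unfolding \<rho> using P(1) by (subst walk_length_concat) (simp_all add: walk_length_Cons)
  show "walk_length G \<l> \<pi> + a \<le> walk_length G \<l> \<rho>" "walk_length G \<l> \<rho> \<le> walk_length G \<l> \<pi> + real N"
    unfolding l using fu P(5) a(2)[of "inv ?u \<otimes> f ?u"] by auto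
qed

lemma extend_bridge:
  assumes "bridge G h \<pi>"
  shows "bridge G h (extend f \<pi> j) \<and> hd (extend f \<pi> j) = hd \<pi> \<and>
    walk_weight G \<phi> \<pi> / real (Suc N) ^ j \<le> walk_weight G \<phi> (extend f \<pi> j) \<and>
    walk_length G \<l> \<pi> + a * real j \<le> walk_length G \<l> (extend f \<pi> j)"
proof (induction j)
  case 0
  then show ?case using assms by simp
next
  case (Suc j)
  note b = bridge_snoc[OF Suc[THEN conjunct1]]
  have "walk_weight G \<phi> \<pi> / real (Suc N) ^ Suc j \<le> walk_weight G \<phi> (extend f \<pi> j) / real (Suc N)"
    using Suc by (simp add: field_simps del: of_nat_Suc)
  then show ?case
    using b Suc by (simp add: algebra_simps del: of_nat_Suc) (simp add: algebra_simps)
qed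

text \<open>Each bridge is prolonged until its length first reaches \<open>m + k\<close>; as no
  added step is longer than \<open>N \<le> c\<close>, it cannot jump over the window there. Every
  step adds at least \<open>a\<close>, so \<open>\<lceil>k / a\<rceil>\<close> steps suffice, each
  costing a factor at most \<open>Suc N\<close>. The number of added steps recovers the original
  bridge.\<close>

lemma fill_window:
  assumes u: "u \<in> carrier G" and c: "real N \<le> c" "0 < c"
    and Q: "Q \<subseteq> {\<pi>. bridge G h \<pi> \<and> hd \<pi> = u \<and> real m \<le> walk_length G \<l> \<pi> \<and>
      walk_length G \<l> \<pi> \<le> real m + real k}"
  shows "nsum (ew \<phi>) Q \<le> of_nat (nat \<lceil>real k / a\<rceil> + 1) *
    ennreal (real (Suc N) ^ nat \<lceil>real k / a\<rceil>) * nsum (ew \<phi>) (bridges G h \<l> (m + k) c u)"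
proof -
  define n where "n = nat \<lceil>real k / a\<rceil>"
  have n: "real k \<le> a * real n"
  proof -
    have "real k / a \<le> real n" unfolding n_def by linarith
    then show ?thesis using a(1) by (simp add: divide_le_eq mult.commute)
  qed
  define j where "j \<pi> = (LEAST j. real m + real k \<le> walk_length G \<l> (extend f \<pi> j))" for \<pi>
  have reach: "real m + real k \<le> walk_length G \<l> (extend f \<pi> n)" if "\<pi> \<in> Q" for \<pi>
    using extend_bridge[of \<pi> n] that Q n by (auto simp: subset_eq)
  have j1: "real m + real k \<le> walk_length G \<l> (extend f \<pi> (j \<pi>))" if "\<pi> \<in> Q" for \<pi>
    unfolding j_def by (rule LeastI) (rule reach[OF that])
  have j2: "j \<pi> \<le> n" if "\<pi> \<in> Q" for \<pi>
    unfolding j_def by (rule Least_le) (rule reach[OF that])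
  have j3: "walk_length G \<l> (extend f \<pi> (j \<pi>)) < real m + real k + c" if \<pi>: "\<pi> \<in> Q" for \<pi>
  proof (cases "j \<pi>")
    case 0
    then show ?thesis using \<pi> Q c by auto
  next
    case (Suc i)
    then have "\<not> real m + real k \<le> walk_length G \<l> (extend f \<pi> i)"
      unfolding j_def by (intro not_less_Least) simp
    moreover have "bridge G h \<pi>" using \<pi> Q by auto
    then have "walk_length G \<l> (extend f \<pi> (Suc i)) \<le> walk_length G \<l> (extend f \<pi> i) + real N"
      using bridge_snoc(5)[of "extend f \<pi> i"] extend_bridge[of \<pi> i] by simp
    ultimately show ?thesis using Suc c by simp
  qed
  show ?thesis
    unfolding n_def[symmetric]
  proof (rule nsum_le_fibers[where a = "\<lambda>\<pi>. extend f \<pi> (j \<pi>)" and i = j and I = "\<lambda>_. {..n}"])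
    show "inj_on (\<lambda>\<pi>. (extend f \<pi> (j \<pi>), j \<pi>)) Q"
    proof (rule inj_on_inverseI[where g = "\<lambda>(\<rho>, j). take (length \<rho> - j) \<rho>"])
      fix \<pi>
      have "length (extend f \<pi> (j \<pi>)) - j \<pi> = length \<pi>" by simp
      then show "(case (extend f \<pi> (j \<pi>), j \<pi>) of (\<rho>, j) \<Rightarrow> take (length \<rho> - j) \<rho>) = \<pi>"
        by (simp only: prod.case take_extend)
    qed
    fix \<pi> assume \<pi>: "\<pi> \<in> Q"
    then have b: "bridge G h \<pi>" "hd \<pi> = u" using Q by auto
    note e = extend_bridge[OF b(1), of "j \<pi>"]
    show "extend f \<pi> (j \<pi>) \<in> bridges G h \<l> (m + k) c u"
      unfolding bridges_eq_window window_def using e b j1[OF \<pi>] j3[OF \<pi>] by simp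
    show "j \<pi> \<in> {..n}" using j2[OF \<pi>] by simp
    have w: "0 \<le> walk_weight G \<phi> \<pi>" "0 \<le> walk_weight G \<phi> (extend f \<pi> (j \<pi>))"
      using bridgeD(2) b(1) e weight_functionsD(1)[OF \<phi>] by (auto intro!: walk_weight_nonneg)
    have "walk_weight G \<phi> \<pi> \<le> real (Suc N) ^ j \<pi> * walk_weight G \<phi> (extend f \<pi> (j \<pi>))"
      using e by (simp add: divide_le_eq mult.commute del: of_nat_Suc)
    also have "\<dots> \<le> real (Suc N) ^ n * walk_weight G \<phi> (extend f \<pi> (j \<pi>))"
      using j2[OF \<pi>] w(2) by (intro mult_right_mono power_increasing) auto
    finally show "ew \<phi> \<pi> \<le> ennreal (real (Suc N) ^ n) * ew \<phi> (extend f \<pi> (j \<pi>))"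
      using w by (subst ennreal_mult[symmetric]) (auto intro: ennreal_leI)
  qed auto
qed

end

text \<open>After \<open>\<pi>\<close> comes the connecting bridge \<open>J (last \<pi>) v\<close>,
  then the translate of \<open>\<pi>'\<close> that starts where it ends. The position of the joint
  recovers \<open>\<pi>\<close>, hence \<open>J\<close> and the translation, hence
  \<open>\<pi>'\<close>. There are few positions, because the prefix \<open>\<pi>\<close> has its
  length in a window of width \<open>c\<close>.\<close>

lemma concat_window:
  assumes J: "\<And>u v. u \<in> carrier G \<Longrightarrow> v \<in> carrier G \<Longrightarrow>
      \<kappa> u v \<in> H \<and> bridge G h (J u v) \<and> hd (J u v) = u \<and> last (J u v) = \<kappa> u v \<otimes> v \<and>
      1 / real (Suc N) \<le> walk_weight G \<phi> (J u v) \<and> walk_length G \<l> (J u v) \<le> real N"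
    and a: "0 < a" "\<And>\<gamma>. \<gamma> \<in> carrier G \<Longrightarrow> a \<le> \<l> \<gamma>"
    and u: "u \<in> carrier G" and v: "v \<in> carrier G"
  shows "nsum (ew \<phi>) (bridges G h \<l> m c u) * nsum (ew \<phi>) (bridges G h \<l> n c v) \<le>
    of_nat (nat \<lceil>c / a\<rceil> + 1) * ennreal (real (Suc N)) *
    nsum (ew \<phi>) {\<rho>. bridge G h \<rho> \<and> hd \<rho> = u \<and> real (m + n) \<le> walk_length G \<l> \<rho> \<and>
      walk_length G \<l> \<rho> \<le> real (m + n) + real (nat \<lceil>2 * c\<rceil> + N)}"
proof -
  define F where "F \<pi> \<pi>' = (\<pi> @ tl (J (last \<pi>) v)) @ tl (map ((\<otimes>) (\<kappa> (last \<pi>) v)) \<pi>')" for \<pi> \<pi>'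
  have facts: "bridge G h (F \<pi> \<pi>') \<and> hd (F \<pi> \<pi>') = u \<and> take (length \<pi>) (F \<pi> \<pi>') = \<pi> \<and>
      walk_weight G \<phi> (F \<pi> \<pi>') = walk_weight G \<phi> \<pi> * walk_weight G \<phi> (J (last \<pi>) v) * walk_weight G \<phi> \<pi>' \<and>
      walk_length G \<l> (F \<pi> \<pi>') = walk_length G \<l> \<pi> + walk_length G \<l> (J (last \<pi>) v) + walk_length G \<l> \<pi>'"
    if \<pi>: "bridge G h \<pi>" "hd \<pi> = u" and \<pi>': "bridge G h \<pi>'" "hd \<pi>' = v" for \<pi> \<pi>'
  proof -
    note P = bridgeD[OF \<pi>(1)] and P' = bridgeD[OF \<pi>'(1)]
    let ?J = "J (last \<pi>) v" and ?t = "map ((\<otimes>) (\<kappa> (last \<pi>) v)) \<pi>'"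
    note j = J[OF P(5) v]
    have k: "\<kappa> (last \<pi>) v \<in> carrier G" using j H_carrier by blast
    have jb: "bridge G h ?J" "last \<pi> = hd ?J" using j by auto
    note b1 = bridge_concat[OF \<pi>(1) jb]
    have t: "bridge G h ?t" using bridge_translate[OF h _ \<pi>'(1)] j by blast
    have "hd ?t = \<kappa> (last \<pi>) v \<otimes> v" using P'(1) \<pi>'(2) by (simp add: hd_map)
    then have eq: "last (\<pi> @ tl ?J) = hd ?t" using b1(3) j by simp
    note b2 = bridge_concat[OF b1(1) t eq]
    have ne: "\<pi> @ tl ?J \<noteq> []" "?t \<noteq> []" "\<pi> \<noteq> []" "?J \<noteq> []"
      using P(1) P'(1) bridgeD(1)[OF jb(1)] by auto
    show ?thesis
      unfolding F_def
      using b2 b1(2) \<pi>(2) walk_weight_concat[OF ne(1,2) eq] walk_weight_concat[OF ne(3,4) jb(2)]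
        walk_length_concat[OF ne(1,2) eq] walk_length_concat[OF ne(3,4) jb(2)]
        walk_weight_translate[OF k P'(2)] walk_length_translate[OF k P'(2)]
      by simp
  qed
  let ?X = "bridges G h \<l> m c u \<times> bridges G h \<l> n c v"
  let ?I = "\<lambda>\<rho>. {i. 1 \<le> i \<and> i \<le> length \<rho> \<and> real m \<le> walk_length G \<l> (take i \<rho>) \<and>
    walk_length G \<l> (take i \<rho>) < real m + c}"
  have X: "bridge G h \<pi> \<and> hd \<pi> = u \<and> real m \<le> walk_length G \<l> \<pi> \<and> walk_length G \<l> \<pi> < real m + c \<and>
      bridge G h \<pi>' \<and> hd \<pi>' = v \<and> real n \<le> walk_length G \<l> \<pi>' \<and> walk_length G \<l> \<pi>' < real n + c"
    if "(\<pi>, \<pi>') \<in> ?X" for \<pi> \<pi>'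
    using that unfolding bridges_eq_window window_def by simp
  have "nsum (ew \<phi>) (bridges G h \<l> m c u) * nsum (ew \<phi>) (bridges G h \<l> n c v) =
      nsum (\<lambda>(\<pi>, \<pi>'). ew \<phi> \<pi> * ew \<phi> \<pi>') ?X"
    by (rule nsum_product[symmetric])
  also have "\<dots> \<le> of_nat (nat \<lceil>c / a\<rceil> + 1) * ennreal (real (Suc N)) *
    nsum (ew \<phi>) {\<rho>. bridge G h \<rho> \<and> hd \<rho> = u \<and> real (m + n) \<le> walk_length G \<l> \<rho> \<and>
      walk_length G \<l> \<rho> \<le> real (m + n) + real (nat \<lceil>2 * c\<rceil> + N)}"
  proof (rule nsum_le_fibers[where a = "\<lambda>(\<pi>, \<pi>'). F \<pi> \<pi>'" and i = "\<lambda>(\<pi>, \<pi>'). length \<pi>" and I = ?I])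
    show "inj_on (\<lambda>x. (case x of (\<pi>, \<pi>') \<Rightarrow> F \<pi> \<pi>', case x of (\<pi>, \<pi>') \<Rightarrow> length \<pi>)) ?X"
    proof (rule inj_onI)
      fix p q assume pq: "p \<in> ?X" "q \<in> ?X"
        and eq: "(case p of (\<pi>, \<pi>') \<Rightarrow> F \<pi> \<pi>', case p of (\<pi>, \<pi>') \<Rightarrow> length \<pi>) =
          (case q of (\<pi>, \<pi>') \<Rightarrow> F \<pi> \<pi>', case q of (\<pi>, \<pi>') \<Rightarrow> length \<pi>)"
      obtain \<pi> \<pi>' \<sigma> \<sigma>' where p: "p = (\<pi>, \<pi>')" and q: "q = (\<sigma>, \<sigma>')" by (cases p; cases q) auto
      have Xp: "(\<pi>, \<pi>') \<in> ?X" and Xq: "(\<sigma>, \<sigma>') \<in> ?X" using pq p q by auto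
      note xp = X[OF Xp] and xq = X[OF Xq]
      have e: "F \<pi> \<pi>' = F \<sigma> \<sigma>'" "length \<pi> = length \<sigma>" using eq p q by auto
      then have \<pi>\<sigma>: "\<pi> = \<sigma>" using facts[of \<pi> \<pi>'] facts[of \<sigma> \<sigma>'] xp xq by metis
      have k: "\<kappa> (last \<pi>) v \<in> carrier G" using J[OF bridgeD(5) v] xp H_carrier by blast
      have "map ((\<otimes>) (\<kappa> (last \<pi>) v)) (tl \<pi>') = map ((\<otimes>) (\<kappa> (last \<pi>) v)) (tl \<sigma>')"
        using e(1) unfolding F_def \<pi>\<sigma> by (simp add: map_tl)
      moreover have "\<pi>' = v # tl \<pi>'" "\<sigma>' = v # tl \<sigma>'"
        using xp xq bridgeD(1)[of h \<pi>'] bridgeD(1)[of h \<sigma>'] by (metis list.collapse)+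
      ultimately have "map ((\<otimes>) (\<kappa> (last \<pi>) v)) \<pi>' = map ((\<otimes>) (\<kappa> (last \<pi>) v)) \<sigma>'"
        by (metis list.simps(9))
      then have "\<pi>' = \<sigma>'"
        using map_inv_mult_cancel(2)[OF k] bridgeD(2) xp xq by metis
      then show "p = q" using p q \<pi>\<sigma> by simp
    qed
  next
    fix p assume "p \<in> ?X"
    then obtain \<pi> \<pi>' where p: "p = (\<pi>, \<pi>')" and Xp: "(\<pi>, \<pi>') \<in> ?X" by (cases p) auto
    note x = X[OF Xp]
    have fa: "bridge G h (F \<pi> \<pi>')" "hd (F \<pi> \<pi>') = u" "take (length \<pi>) (F \<pi> \<pi>') = \<pi>"
      "walk_weight G \<phi> (F \<pi> \<pi>') = walk_weight G \<phi> \<pi> * walk_weight G \<phi> (J (last \<pi>) v) * walk_weight G \<phi> \<pi>'"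
      "walk_length G \<l> (F \<pi> \<pi>') = walk_length G \<l> \<pi> + walk_length G \<l> (J (last \<pi>) v) + walk_length G \<l> \<pi>'"
      using facts[of \<pi> \<pi>'] x by blast+
    have \<pi>_b: "bridge G h \<pi>" "bridge G h \<pi>'" using x by blast+
    have j: "bridge G h (J (last \<pi>) v)" "1 / real (Suc N) \<le> walk_weight G \<phi> (J (last \<pi>) v)"
      "walk_length G \<l> (J (last \<pi>) v) \<le> real N"
      using J[OF bridgeD(5)[OF \<pi>_b(1)] v] by blast+
    have "a * real (length (J (last \<pi>) v) - 1) \<le> walk_length G \<l> (J (last \<pi>) v)"
      by (rule walk_length_ge[OF a(2) bridgeD(2)[OF j(1)]])
    moreover have "0 \<le> a * real (length (J (last \<pi>) v) - 1)" using a(1) by simp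
    ultimately have j0: "0 \<le> walk_length G \<l> (J (last \<pi>) v)" by linarith
    have "2 * c \<le> real (nat \<lceil>2 * c\<rceil>)" by linarith
    then have "real (m + n) \<le> walk_length G \<l> (F \<pi> \<pi>')"
      "walk_length G \<l> (F \<pi> \<pi>') \<le> real (m + n) + real (nat \<lceil>2 * c\<rceil> + N)"
      unfolding fa(5) of_nat_add using x j(3) j0 by linarith+
    then show "(case p of (\<pi>, \<pi>') \<Rightarrow> F \<pi> \<pi>') \<in> {\<rho>. bridge G h \<rho> \<and> hd \<rho> = u \<and>
        real (m + n) \<le> walk_length G \<l> \<rho> \<and> walk_length G \<l> \<rho> \<le> real (m + n) + real (nat \<lceil>2 * c\<rceil> + N)}"
      unfolding p using fa(1,2) by simp
    have "1 \<le> length \<pi>" using bridgeD(1)[OF \<pi>_b(1)] by (cases \<pi>) auto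
    moreover have "length \<pi> \<le> length (F \<pi> \<pi>')" by (simp add: F_def)
    ultimately show "(case p of (\<pi>, \<pi>') \<Rightarrow> length \<pi>) \<in> ?I (case p of (\<pi>, \<pi>') \<Rightarrow> F \<pi> \<pi>')"
      using fa(3) x unfolding p by simp
    have w: "0 \<le> walk_weight G \<phi> \<pi>" "0 \<le> walk_weight G \<phi> \<pi>'" "0 \<le> walk_weight G \<phi> (F \<pi> \<pi>')"
      using bridgeD(2) \<pi>_b fa(1) weight_functionsD(1)[OF \<phi>] by (auto intro!: walk_weight_nonneg)
    have "1 \<le> real (Suc N) * walk_weight G \<phi> (J (last \<pi>) v)"
      using j(2) by (simp add: divide_le_eq mult.commute del: of_nat_Suc)
    from mult_right_mono[OF this, of "walk_weight G \<phi> \<pi> * walk_weight G \<phi> \<pi>'"]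
    have "walk_weight G \<phi> \<pi> * walk_weight G \<phi> \<pi>' \<le> real (Suc N) * walk_weight G \<phi> (F \<pi> \<pi>')"
      using w unfolding fa(4) by (simp add: ac_simps del: of_nat_Suc)
    then show "(case p of (\<pi>, \<pi>') \<Rightarrow> ew \<phi> \<pi> * ew \<phi> \<pi>') \<le>
        ennreal (real (Suc N)) * ew \<phi> (case p of (\<pi>, \<pi>') \<Rightarrow> F \<pi> \<pi>')"
      using w unfolding p prod.case
      by (subst (1 2) ennreal_mult[symmetric]) (auto intro: ennreal_leI)
  next
    fix \<rho> assume "\<rho> \<in> {\<rho>. bridge G h \<rho> \<and> hd \<rho> = u \<and>
        real (m + n) \<le> walk_length G \<l> \<rho> \<and> walk_length G \<l> \<rho> \<le> real (m + n) + real (nat \<lceil>2 * c\<rceil> + N)}"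
    then have "set \<rho> \<subseteq> carrier G" using bridgeD(2) by blast
    from card_prefixes_le[OF a this] show "finite (?I \<rho>) \<and> card (?I \<rho>) \<le> nat \<lceil>c / a\<rceil> + 1"
      by (auto intro: finite_subset[of _ "{..length \<rho>}"])
  qed
  finally show ?thesis .
qed

lemma total_weight_bridges:
  assumes "v \<in> carrier G"
  shows "ennreal (total_weight G \<phi> (bridges G h \<l> m c v)) = nsum (ew \<phi>) (bridges G h \<l> m c v)"
    and "0 \<le> total_weight G \<phi> (bridges G h \<l> m c v)"
proof -
  have "{\<pi>. bridge G h \<pi> \<and> hd \<pi> = v} \<subseteq> {\<pi>. saw G \<pi> \<and> hd \<pi> = v}" by (auto simp: bridge_def)
  from total_weight_window[OF this assms]
  show "ennreal (total_weight G \<phi> (bridges G h \<l> m c v)) = nsum (ew \<phi>) (bridges G h \<l> m c v)"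
    and "0 \<le> total_weight G \<phi> (bridges G h \<l> m c v)"
    unfolding bridges_eq_window by auto
qed

text \<open>Joining spreads the length over a range of width \<open>k\<close>, and prolongation
  brings it back into the single window at \<open>m + n + k\<close>. The shift \<open>k\<close> and
  the loss \<open>\<delta>\<close> depend on \<open>c\<close> but not on the vertices or the
  lengths.\<close>

lemma bridges_supermultiplicative:
  "\<forall>\<^sub>F c in at_top. (\<exists>k. \<exists>\<delta>>0. \<forall>u\<in>carrier G. \<forall>v\<in>carrier G. \<forall>m n.
      \<delta> * total_weight G \<phi> (bridges G h \<l> m c u) * total_weight G \<phi> (bridges G h \<l> n c v) \<le>
      total_weight G \<phi> (bridges G h \<l> (m + n + k) c u)) \<and>
    (\<forall>v\<in>carrier G. \<forall>m. 0 < total_weight G \<phi> (bridges G h \<l> m c v))"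
proof -
  obtain a where a: "0 < a" "\<And>\<gamma>. \<gamma> \<in> carrier G \<Longrightarrow> a \<le> \<l> \<gamma>"
    using length_functionsD[OF \<l>] by blast
  obtain f N where f: "\<And>v. v \<in> carrier G \<Longrightarrow> f v \<in> carrier G \<and> h v < h (f v) \<and>
      1 / real (Suc N) \<le> \<phi> (inv v \<otimes> f v) \<and> \<l> (inv v \<otimes> f v) \<le> real N"
    using up_uniform by metis
  obtain \<kappa> J M where J: "\<And>u v. u \<in> carrier G \<Longrightarrow> v \<in> carrier G \<Longrightarrow>
      \<kappa> u v \<in> H \<and> bridge G h (J u v) \<and> hd (J u v) = u \<and> last (J u v) = \<kappa> u v \<otimes> v \<and>
      1 / real (Suc M) \<le> walk_weight G \<phi> (J u v) \<and> walk_length G \<l> (J u v) \<le> real M"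
    using connecting_bridge_uniform by metis
  have "\<forall>\<^sub>F c in at_top. max 1 (real N) \<le> c" by (rule eventually_ge_at_top)
  then show ?thesis
  proof eventually_elim
    case (elim c)
    let ?b = "\<lambda>m u. total_weight G \<phi> (bridges G h \<l> m c u)"
    \<comment> \<open>Width at least the longest chosen up-step, so that prolongation lands in the
      window.\<close>
    have c: "real N \<le> c" "0 < c" using elim by auto
    define k where "k = nat \<lceil>2 * c\<rceil> + M"
    define K1 where "K1 = real (nat \<lceil>c / a\<rceil> + 1) * real (Suc M)"
    define K2 where "K2 k = real (nat \<lceil>real k / a\<rceil> + 1) * real (Suc N) ^ nat \<lceil>real k / a\<rceil>" for k
    have K: "0 < K1" "\<And>k. 0 < K2 k" by (simp_all add: K1_def K2_def)
    have fill: "nsum (ew \<phi>) Q \<le> ennreal (K2 k * ?b (m + k) u)"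
      if u: "u \<in> carrier G" and Q: "Q \<subseteq> {\<pi>. bridge G h \<pi> \<and> hd \<pi> = u \<and>
        real m \<le> walk_length G \<l> \<pi> \<and> walk_length G \<l> \<pi> \<le> real m + real k}" for u Q m k
    proof -
      note fill_window[OF f a u c Q]
      also have "of_nat (nat \<lceil>real k / a\<rceil> + 1) * ennreal (real (Suc N) ^ nat \<lceil>real k / a\<rceil>) = ennreal (K2 k)"
        unfolding K2_def ennreal_of_nat_eq_real_of_nat by (rule ennreal_mult[symmetric]) auto
      also have "ennreal (K2 k) * nsum (ew \<phi>) (bridges G h \<l> (m + k) c u) = ennreal (K2 k * ?b (m + k) u)"
        unfolding total_weight_bridges(1)[OF u, symmetric]
        using K(2)[of k] total_weight_bridges(2)[OF u] by (intro ennreal_mult[symmetric]) auto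
      finally show ?thesis .
    qed
    have mult: "?b m u * ?b n v \<le> K1 * (K2 k * ?b (m + n + k) u)"
      if u: "u \<in> carrier G" and v: "v \<in> carrier G" for u v m n
    proof -
      note nonneg = total_weight_bridges(2)[OF u] total_weight_bridges(2)[OF v]
      let ?Q = "{\<rho>. bridge G h \<rho> \<and> hd \<rho> = u \<and> real (m + n) \<le> walk_length G \<l> \<rho> \<and>
        walk_length G \<l> \<rho> \<le> real (m + n) + real k}"
      have "ennreal (?b m u * ?b n v) = nsum (ew \<phi>) (bridges G h \<l> m c u) * nsum (ew \<phi>) (bridges G h \<l> n c v)"
        unfolding total_weight_bridges(1)[OF u, symmetric] total_weight_bridges(1)[OF v, symmetric]
        using nonneg by (intro ennreal_mult) auto
      also have "\<dots> \<le> of_nat (nat \<lceil>c / a\<rceil> + 1) * ennreal (real (Suc M)) * nsum (ew \<phi>) ?Q"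
        unfolding k_def by (rule concat_window[OF J a u v])
      also have "of_nat (nat \<lceil>c / a\<rceil> + 1) * ennreal (real (Suc M)) = ennreal K1"
        unfolding K1_def ennreal_of_nat_eq_real_of_nat by (rule ennreal_mult[symmetric]) auto
      also have "ennreal K1 * nsum (ew \<phi>) ?Q \<le> ennreal K1 * ennreal (K2 k * ?b (m + n + k) u)"
        by (intro mult_left_mono fill[OF u]) auto
      also have "\<dots> = ennreal (K1 * (K2 k * ?b (m + n + k) u))"
        using K(1) K(2)[of k] nonneg by (intro ennreal_mult[symmetric]) (auto intro!: mult_nonneg_nonneg less_imp_le)
      finally show ?thesis
        using K(1) K(2)[of k] nonneg by (subst (asm) ennreal_le_iff) (auto intro!: mult_nonneg_nonneg less_imp_le)
    qed
    have "\<exists>k. \<exists>\<delta>>0. \<forall>u\<in>carrier G. \<forall>v\<in>carrier G. \<forall>m n. \<delta> * ?b m u * ?b n v \<le> ?b (m + n + k) u"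
    proof (intro exI[of _ k] exI[of _ "1 / (K1 * K2 k)"] conjI ballI allI)
      show "0 < 1 / (K1 * K2 k)" using K by simp
      fix u v m n assume "u \<in> carrier G" "v \<in> carrier G"
      from mult[OF this, of m n] show "1 / (K1 * K2 k) * ?b m u * ?b n v \<le> ?b (m + n + k) u"
        using K(1) K(2)[of k] by (simp add: field_simps)
    qed
    moreover have "0 < ?b m v" if v: "v \<in> carrier G" for v m
    proof -
      \<comment> \<open>Prolonging the one-vertex bridge, of weight 1 and length 0, puts positive
        weight into the window at \<open>m\<close>.\<close>
      have "nsum (ew \<phi>) {[v]} \<le> ennreal (K2 m * ?b (0 + m) v)"
        by (rule fill[OF v]) (use v in \<open>auto simp: bridge_iff saw_def\<close>)
      then have "1 \<le> ennreal (K2 m * ?b m v)" by (simp add: nsum_finite)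
      then have "?b m v \<noteq> 0" by auto
      then show ?thesis using total_weight_bridges(2)[OF v, of m c] by simp
    qed
    ultimately show ?case by blast
  qed
qed

text \<open>If the bridge weights from every vertex were eventually at most \<open>y ^ m\<close>,
  all bridge series would converge at \<open>1 / w\<close> for some \<open>w\<close> between
  \<open>y\<close> and the connective constant. Then \<open>saw_sum_finite\<close> would bound that
  constant by \<open>w\<close>. Negating a statement about all vertices leaves a single
  vertex.\<close>

lemma bridge_growth_frequently:
  assumes c: "1 \<le> c" and y: "0 < y" "y < connective_constant G \<phi> \<l>"
  shows "\<exists>v\<in>carrier G. \<exists>\<^sub>F m in sequentially. y ^ m < total_weight G \<phi> (bridges G h \<l> m c v)"
proof (rule ccontr)
  assume "\<not> ?thesis"
  then have ev: "\<forall>\<^sub>F m in sequentially. total_weight G \<phi> (bridges G h \<l> m c v) \<le> y ^ m"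
    if "v \<in> carrier G" for v
    using that by (simp add: not_frequently not_less)
  obtain w where w: "y < w" "w < connective_constant G \<phi> \<l>" using dense y(2) by blast
  define x where "x = 1 / w"
  have x: "0 < x" "x * y < 1" using w y by (simp_all add: x_def)
  interpret t: symmetric_weight G H R "tilt x \<l> \<phi>"
  proof
    fix \<gamma> assume \<gamma>: "\<gamma> \<in> carrier G"
    show "0 \<le> tilt x \<l> \<phi> \<gamma>" using weight_functionsD(1)[OF \<phi> \<gamma>] by (simp add: tilt_def)
    show "tilt x \<l> \<phi> (inv \<gamma>) = tilt x \<l> \<phi> \<gamma>"
      using weight_functionsD(2)[OF \<phi> \<gamma>] \<l> \<gamma> by (simp add: tilt_def length_functions_def)
  qed
  have gw: "t.gw = ew (tilt x \<l> \<phi>)" by (rule ext) (simp add: t.gw_def)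
  have "nsum t.gw {\<pi>. saw G \<pi> \<and> hd \<pi> = \<one>} < \<infinity>"
  proof (rule t.saw_sum_finite[OF h])
    fix v assume v: "v \<in> carrier G"
    show "nsum t.gw {\<pi>. bridge G h \<pi> \<and> hd \<pi> = v} < \<infinity>"
      unfolding gw
    proof (rule tilt_finite_of_growth[OF _ v x(1) y(1) x(2) c])
      show "{\<pi>. bridge G h \<pi> \<and> hd \<pi> = v} \<subseteq> {\<pi>. saw G \<pi> \<and> hd \<pi> = v}" by (auto simp: bridge_def)
      show "\<forall>\<^sub>F m in sequentially. total_weight G \<phi> (window \<l> {\<pi>. bridge G h \<pi> \<and> hd \<pi> = v} m c) \<le> y ^ m"
        using ev[OF v] unfolding bridges_eq_window .
    qed
    obtain u where "weight_adj G \<phi> v u" "h u < h v" using down[OF v] by blast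
    then show "\<exists>u\<in>carrier G. h u < h v \<and> 0 < tilt x \<l> \<phi> (inv u \<otimes> v)"
      using weight_adj_sym[of v u] x(1) by (auto simp: weight_adj_iff tilt_def)
  qed simp
  then have "limsup (\<lambda>m. ereal (root m (total_weight G \<phi> (saws G \<l> m 1)))) \<le> ereal (1 / x)"
    unfolding gw saws_eq_window using x(1) by (intro growth_le[where v = \<one>]) auto
  then have "connective_constant G \<phi> \<l> \<le> w"
    using connective_constant_limsup[of 1] w y by (simp add: x_def)
  then show False using w by simp
qed

text \<open>Once heights are forgotten, every left translation is allowed and not only those from
  \<open>H\<close>, so any start can be moved to \<open>\<one>\<close>.\<close>

lemma total_weight_bridges_le_saws:
  assumes v: "v \<in> carrier G"
  shows "total_weight G \<phi> (bridges G h \<l> m c v) \<le> total_weight G \<phi> (saws G \<l> m c)"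
proof -
  let ?Q = "{\<pi>. saw G \<pi> \<and> hd \<pi> = \<one>}"
  have Q: "?Q \<subseteq> {\<pi>. saw G \<pi> \<and> hd \<pi> = \<one>}" "\<one> \<in> carrier G" by auto
  have "nsum (ew \<phi>) (bridges G h \<l> m c v) \<le> nsum (ew \<phi>) (saws G \<l> m c)"
  proof (rule nsum_le_inj[where a = "map ((\<otimes>) (inv v))"])
    show "inj_on (map ((\<otimes>) (inv v))) (bridges G h \<l> m c v)"
      using map_inv_mult_cancel(1)[OF v]
      by (intro inj_on_inverseI[where g = "map ((\<otimes>) v)"]) (auto simp: bridges_def bridge_def saw_def)
    fix \<pi> assume "\<pi> \<in> bridges G h \<l> m c v"
    then have \<pi>: "saw G \<pi>" "hd \<pi> = v" "real m \<le> walk_length G \<l> \<pi>" "walk_length G \<l> \<pi> < real m + c"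
      by (auto simp: bridges_eq_window window_def bridge_def)
    then have s: "\<pi> \<noteq> []" "set \<pi> \<subseteq> carrier G" by (auto simp: saw_def)
    show "map ((\<otimes>) (inv v)) \<pi> \<in> saws G \<l> m c"
      unfolding saws_eq_window window_def
      using \<pi> s v saw_translate[OF _ \<pi>(1), of "inv v"] by (simp add: hd_map walk_length_translate)
    show "ew \<phi> \<pi> \<le> ew \<phi> (map ((\<otimes>) (inv v)) \<pi>)" using s v by (simp add: walk_weight_translate)
  qed
  then have "ennreal (total_weight G \<phi> (bridges G h \<l> m c v)) \<le> ennreal (total_weight G \<phi> (saws G \<l> m c))"
    unfolding total_weight_bridges(1)[OF v] saws_eq_window total_weight_window(1)[OF Q] .
  moreover have "0 \<le> total_weight G \<phi> (saws G \<l> m c)"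
    unfolding saws_eq_window by (rule total_weight_window(2)[OF Q])
  ultimately show ?thesis by simp
qed

lemma bridges_limit:
  "\<forall>\<^sub>F c in at_top. \<forall>v\<in>carrier G.
     (\<lambda>m. root m (total_weight G \<phi> (bridges G h \<l> m c v))) \<longlonglongrightarrow> connective_constant G \<phi> \<l>"
  using bridges_supermultiplicative eventually_ge_at_top[of 1]
proof eventually_elim
  case (elim c)
  let ?\<mu> = "connective_constant G \<phi> \<l>"
  let ?b = "\<lambda>m u. total_weight G \<phi> (bridges G h \<l> m c u)"
  obtain k \<delta> where k: "0 < \<delta>" "\<And>u v m n. u \<in> carrier G \<Longrightarrow> v \<in> carrier G \<Longrightarrow>
      \<delta> * ?b m u * ?b n v \<le> ?b (m + n + k) u" using elim(1) by blast
  have pos: "0 < ?b m v" if "v \<in> carrier G" for m v using elim(1) that by blast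
  show ?case
  proof
    fix v assume v: "v \<in> carrier G"
    show "(\<lambda>m. root m (?b m v)) \<longlonglongrightarrow> ?\<mu>"
    proof (rule order_tendstoI)
      fix z assume "?\<mu> < z"
      have "limsup (\<lambda>m. ereal (root m (?b m v))) \<le> limsup (\<lambda>m. ereal (root m (total_weight G \<phi> (saws G \<l> m c))))"
        using total_weight_bridges_le_saws[OF v]
        by (intro Limsup_mono eventually_sequentiallyI[of 1]) simp
      also have "\<dots> < ereal z" using connective_constant_limsup[OF elim(2)] \<open>?\<mu> < z\<close> by simp
      finally show "\<forall>\<^sub>F m in sequentially. root m (?b m v) < z"
        by (auto dest: Limsup_lessD)
    next
      fix z assume z: "z < ?\<mu>"
      show "\<forall>\<^sub>F m in sequentially. z < root m (?b m v)"
      proof (cases "z < 0")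
        case True
        have "z < root m (?b m v)" if "1 \<le> m" for m
        proof -
          have "0 \<le> root m (?b m v)" using pos[OF v, of m] that by simp
          then show ?thesis using True by linarith
        qed
        then show ?thesis by (rule eventually_sequentiallyI)
      next
        case False
        \<comment> \<open>Two gaps are needed: \<open>root_lower_bound\<close> loses from
          \<open>y\<close> to \<open>x\<close>, and the room between \<open>z\<close> and
          \<open>x\<close> absorbs the roots of the constant \<open>C\<close>.\<close>
        obtain x where x: "z < x" "x < ?\<mu>" using dense[OF z] by blast
        obtain y where y: "x < y" "y < ?\<mu>" using dense[OF x(2)] by blast
        have "0 < x" "0 < y" using False x y by linarith+
        obtain u where u: "u \<in> carrier G" "\<exists>\<^sub>F m in sequentially. y ^ m < ?b m u"
          using bridge_growth_frequently[OF elim(2) \<open>0 < y\<close> y(2)] by blast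
        obtain C where C: "0 < C" "\<And>m. C * x ^ m \<le> ?b m v"
          using root_lower_bound[where b = "\<lambda>m. ?b m v" and a = "\<lambda>n. ?b n u", OF pos[OF v] k(1) k(2)[OF v u(1)] \<open>0 < x\<close> y(1) u(2)]
          by blast
        have "(\<lambda>m. root m C * x) \<longlonglongrightarrow> 1 * x"
          using C(1) by (intro tendsto_mult LIMSEQ_root_const tendsto_const)
        then have "\<forall>\<^sub>F m in sequentially. z < root m C * x" using x(1) by (intro order_tendstoD) auto
        then show ?thesis using eventually_gt_at_top[of 0]
        proof eventually_elim
          case (elim m)
          have "root m C * x = root m (C * x ^ m)"
            using elim(2) \<open>0 < x\<close> by (simp add: real_root_mult real_root_power_cancel)
          also have "\<dots> \<le> root m (?b m v)" using C(2) elim(2) by simp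
          finally show ?case using elim(1) by linarith
        qed
      qed
    qed
  qed
qed

lemma bridge_constant_eq: "bridge_constant G h \<phi> \<l> = connective_constant G \<phi> \<l>"
  unfolding bridge_constant_def
proof (rule the_equality)
  fix \<beta>
  assume "\<forall>\<^sub>F c in at_top. \<forall>v\<in>carrier G.
    (\<lambda>m. root m (total_weight G \<phi> (bridges G h \<l> m c v))) \<longlonglongrightarrow> \<beta>"
  with bridges_limit have "\<forall>\<^sub>F c :: real in at_top. \<beta> = connective_constant G \<phi> \<l>"
    by eventually_elim (meson LIMSEQ_unique one_closed)
  then show "\<beta> = connective_constant G \<phi> \<l>" by simp
qed (rule bridges_limit)

text \<open>The limsup is known; the matching lower bound is inherited from the bridges that start
  at \<open>\<one>\<close>.\<close>

lemma saws_limit: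
  "\<forall>\<^sub>F c in at_top. (\<lambda>m. root m (total_weight G \<phi> (saws G \<l> m c))) \<longlonglongrightarrow> connective_constant G \<phi> \<l>"
  using bridges_limit eventually_ge_at_top[of 1]
proof eventually_elim
  case (elim c)
  let ?\<mu> = "connective_constant G \<phi> \<l>"
  have lim: "(\<lambda>m. root m (total_weight G \<phi> (bridges G h \<l> m c \<one>))) \<longlonglongrightarrow> ?\<mu>" using elim(1) by simp
  show ?case
  proof (rule order_tendstoI)
    fix z assume "?\<mu> < z"
    then have "limsup (\<lambda>m. ereal (root m (total_weight G \<phi> (saws G \<l> m c)))) < ereal z"
      using connective_constant_limsup[OF elim(2)] by simp
    then show "\<forall>\<^sub>F m in sequentially. root m (total_weight G \<phi> (saws G \<l> m c)) < z"
      by (auto dest: Limsup_lessD)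
  next
    fix z assume "z < ?\<mu>"
    from order_tendstoD(1)[OF lim this] eventually_gt_at_top[of 0]
    show "\<forall>\<^sub>F m in sequentially. z < root m (total_weight G \<phi> (saws G \<l> m c))"
    proof eventually_elim
      case (elim m)
      then have "root m (total_weight G \<phi> (bridges G h \<l> m c \<one>)) \<le> root m (total_weight G \<phi> (saws G \<l> m c))"
        using total_weight_bridges_le_saws[of \<one>] by simp
      then show ?case using elim by linarith
    qed
  qed
qed

end

section \<open>The connective constant and the bridge constant\<close>

lemma exists_coset_transversal:
  assumes "group G" "H \<lhd> G" "finite (rcosets\<^bsub>G\<^esub> H)"
  shows "\<exists>R. coset_transversal G H R"
proof -
  interpret group G by fact
  have sub: "subgroup H G" using assms(2) by (rule normal_imp_subgroup)
  define r where "r C = (SOME v. v \<in> carrier G \<and> H #>\<^bsub>G\<^esub> v = C)" for C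
  have r: "r C \<in> carrier G \<and> H #>\<^bsub>G\<^esub> r C = C" if "C \<in> rcosets\<^bsub>G\<^esub> H" for C
    unfolding r_def by (rule someI_ex) (use that in \<open>auto simp: RCOSETS_def\<close>)
  have "coset_transversal G H (r ` (rcosets\<^bsub>G\<^esub> H))"
  proof (rule coset_transversal.intro[OF assms(1) coset_transversal_axioms.intro])
    show "subgroup H G" by fact
    show "finite (r ` (rcosets\<^bsub>G\<^esub> H))" using assms(3) by simp
    show "r ` (rcosets\<^bsub>G\<^esub> H) \<subseteq> carrier G" using r by auto
    fix v assume v: "v \<in> carrier G"
    let ?C = "H #>\<^bsub>G\<^esub> v"
    have C: "?C \<in> rcosets\<^bsub>G\<^esub> H" using v sub by (intro rcosetsI subgroup.subset)
    have "v \<in> ?C" using v sub by (rule rcos_self)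
    also have "?C = H #>\<^bsub>G\<^esub> r ?C" using r[OF C] by simp
    finally show "\<exists>\<alpha>\<in>H. \<exists>x\<in>r ` (rcosets\<^bsub>G\<^esub> H). v = \<alpha> \<otimes>\<^bsub>G\<^esub> x"
      using C by (auto simp: r_coset_def)
  qed
  then show ?thesis by blast
qed

theorem theorem3p10:
  fixes G :: "('a, 'b) monoid_scheme"
    and H :: "'a set" and F h\<^sub>F :: "'a \<Rightarrow> int"
    and \<phi> \<l> :: "'a \<Rightarrow> real" and \<epsilon> C :: real
  assumes "finitely_generated_group G"
    and "virtually_indicable G H F"
    and "\<phi> \<in> weight_functions G"
    and "strong_graph_height_function G \<phi> h\<^sub>F H"
    and "1 \<le> \<epsilon>" and "\<epsilon> < 2" and "0 < C"
    and "\<l> \<in> holder_length_functions G h\<^sub>F \<epsilon> C \<phi>"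
  shows "(connective_constant G \<phi> \<l> = bridge_constant G h\<^sub>F \<phi> \<l> \<and>
          (\<forall>\<^sub>F c in at_top. (\<lambda>m. root m (total_weight G \<phi> (saws G \<l> m c)))
             \<longlonglongrightarrow> connective_constant G \<phi> \<l>)) \<and>
         (\<forall>\<nu>\<in>weight_functions G. (\<forall>\<gamma>\<in>carrier G. \<nu> \<gamma> \<le> \<phi> \<gamma>) \<longrightarrow>
            \<l> \<in> holder_length_functions G h\<^sub>F \<epsilon> C \<nu> \<and>
            connective_constant G \<nu> \<l> \<le> connective_constant G \<phi> \<l>)"
proof -
  interpret group G using assms(1) by (simp add: finitely_generated_group_def)
  note hF = assms(4)[unfolded strong_graph_height_function_def]
  have \<l>: "\<l> \<in> length_functions G" using assms(8) by (simp add: holder_length_functions_def)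
  have saws: "weighted_saws G \<nu> \<l>" if "\<nu> \<in> weight_functions G" for \<nu>
    using that \<l> by unfold_locales
  obtain R where "coset_transversal G H R"
    using exists_coset_transversal[OF is_group] hF by blast
  then interpret coset_transversal G H R .
  interpret weighted_saws G \<phi> \<l> using saws[OF assms(3)] .
  interpret weighted_bridges G H R \<phi> \<l> h\<^sub>F
    by unfold_locales (use hF in \<open>auto simp: invariant_height_def\<close>)
  \<comment> \<open>Where \<open>\<nu>\<close> is positive so is \<open>\<phi>\<close>, hence the
    height condition for \<open>\<nu>\<close> concerns fewer pairs.\<close>
  have "\<l> \<in> holder_length_functions G h\<^sub>F \<epsilon> C \<nu>" if "\<forall>\<gamma>\<in>carrier G. \<nu> \<gamma> \<le> \<phi> \<gamma>" for \<nu>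
    using assms(8) that unfolding holder_length_functions_def
    by (auto intro: less_le_trans)
  moreover have "connective_constant G \<nu> \<l> \<le> connective_constant G \<phi> \<l>"
    if "\<nu> \<in> weight_functions G" "\<forall>\<gamma>\<in>carrier G. \<nu> \<gamma> \<le> \<phi> \<gamma>" for \<nu>
    using connective_constant_mono[OF saws[OF that(1)] saws[OF assms(3)]] that(2) by blast
  ultimately show ?thesis using bridge_constant_eq saws_limit by simp
qed

end
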